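(* Let $p\geq 3$ be a prime, let $k$ be a field of characteristic $p$, and let $\beta\in k$ with $\beta\neq 0$. Let $$A5(\beta)=k\langle z,y\rangle\big/\big([y,z]^p,\ y^p,\ [[z,y],y],\ [[z,y],z],\ z^p+y[y,z]^{p-1}-\beta[y,z]\big).$$ Then the cohomology algebra $\operatorname{Ext}^*_{A5(\beta)}(k,k)$ is a finitely generated $k$-algebra.
   Context: $[u,v]=uv-vu$. The trivial module $k$ is the one-dimensional module on which $z$ and $y$ act as zero. $\operatorname{Ext}^*(k,k)$ carries the Yoneda product. *)

theory Defs
  imports
    "HOL-Algebra.QuotRing"
    "HOL-Algebra.Subrings"
    "HOL-Library.Poly_Mapping"
    "HOL-Computational_Algebra.Primes"
begin

section \<open>Modules over a not necessarily commutative ring\<close>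

text \<open>The locale \<^locale>\<open>module\<close> of HOL-Algebra requires a commutative ring of scalars. We keep its
  record type, whose fields \<open>mult\<close> and \<open>one\<close> play no role for modules.\<close>

locale left_module = R?: ring R + M?: abelian_group M
  for R :: "('a, 'r) ring_scheme" (structure) and M :: "('a, 'm) module" (structure) +
  assumes smult_closed: "a \<in> carrier R \<Longrightarrow> x \<in> carrier M \<Longrightarrow> a \<odot>\<^bsub>M\<^esub> x \<in> carrier M"
    and smult_l_distr: "a \<in> carrier R \<Longrightarrow> b \<in> carrier R \<Longrightarrow> x \<in> carrier M \<Longrightarrow>
      (a \<oplus> b) \<odot>\<^bsub>M\<^esub> x = a \<odot>\<^bsub>M\<^esub> x \<oplus>\<^bsub>M\<^esub> b \<odot>\<^bsub>M\<^esub> x"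
    and smult_r_distr: "a \<in> carrier R \<Longrightarrow> x \<in> carrier M \<Longrightarrow> y \<in> carrier M \<Longrightarrow>
      a \<odot>\<^bsub>M\<^esub> (x \<oplus>\<^bsub>M\<^esub> y) = a \<odot>\<^bsub>M\<^esub> x \<oplus>\<^bsub>M\<^esub> a \<odot>\<^bsub>M\<^esub> y"
    and smult_assoc: "a \<in> carrier R \<Longrightarrow> b \<in> carrier R \<Longrightarrow> x \<in> carrier M \<Longrightarrow>
      (a \<otimes> b) \<odot>\<^bsub>M\<^esub> x = a \<odot>\<^bsub>M\<^esub> (b \<odot>\<^bsub>M\<^esub> x)"
    and smult_one: "x \<in> carrier M \<Longrightarrow> \<one> \<odot>\<^bsub>M\<^esub> x = x"

text \<open>Homomorphisms are extensional (\<^const>\<open>undefined\<close> off the carrier), so that equality of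
  functions is equality of homomorphisms.\<close>

definition module_hom ::
    "('a, 'r) ring_scheme \<Rightarrow> ('a, 'm) module \<Rightarrow> ('a, 'n) module \<Rightarrow> ('m \<Rightarrow> 'n) set" where
  "module_hom A M N = {f \<in> carrier M \<rightarrow>\<^sub>E carrier N.
     (\<forall>x\<in>carrier M. \<forall>y\<in>carrier M. f (x \<oplus>\<^bsub>M\<^esub> y) = f x \<oplus>\<^bsub>N\<^esub> f y) \<and>
     (\<forall>a\<in>carrier A. \<forall>x\<in>carrier M. f (a \<odot>\<^bsub>M\<^esub> x) = a \<odot>\<^bsub>N\<^esub> f x)}"

definition free_module :: "('a, 'r) ring_scheme \<Rightarrow> 'x set \<Rightarrow> ('a, 'x \<Rightarrow> 'a) module" where
  "free_module A X =
     \<lparr>carrier = {f. (\<forall>x\<in>X. f x \<in> carrier A) \<and> (\<forall>x. x \<notin> X \<longrightarrow> f x = \<zero>\<^bsub>A\<^esub>) \<and>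
                    finite {x. f x \<noteq> \<zero>\<^bsub>A\<^esub>}},
      monoid.mult = undefined, one = undefined,
      zero = (\<lambda>x. \<zero>\<^bsub>A\<^esub>), add = (\<lambda>f g x. f x \<oplus>\<^bsub>A\<^esub> g x),
      smult = (\<lambda>a f x. a \<otimes>\<^bsub>A\<^esub> f x)\<rparr>"

text \<open>Projective means direct summand of a free module. Bases inside the type \<^typ>\<open>'m\<close> suffice:
  if \<open>P\<close> is projective, the canonical map from the free module on \<open>carrier P\<close> onto \<open>P\<close> splits.\<close>

definition projective_module :: "('a, 'r) ring_scheme \<Rightarrow> ('a, 'm) module \<Rightarrow> bool" where
  "projective_module A P \<longleftrightarrow> left_module A P \<and>
     (\<exists>(X :: 'm set) s t. s \<in> module_hom A P (free_module A X) \<and>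
        t \<in> module_hom A (free_module A X) P \<and> (\<forall>x\<in>carrier P. t (s x) = x))"

text \<open>\<open>\<dots> \<rightarrow> P 2 \<rightarrow> P 1 \<rightarrow> P 0 \<rightarrow> M \<rightarrow> 0\<close> with \<open>d n : P (n + 1) \<rightarrow> P n\<close> and \<open>e : P 0 \<rightarrow> M\<close>.\<close>

definition projective_resolution ::
    "('a, 'r) ring_scheme \<Rightarrow> ('a, 'n) module \<Rightarrow> (nat \<Rightarrow> ('a, 'm) module) \<Rightarrow>
     (nat \<Rightarrow> 'm \<Rightarrow> 'm) \<Rightarrow> ('m \<Rightarrow> 'n) \<Rightarrow> bool" where
  "projective_resolution A M P d e \<longleftrightarrow>
     (\<forall>n. projective_module A (P n)) \<and>
     (\<forall>n. d n \<in> module_hom A (P (Suc n)) (P n)) \<and>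
     e \<in> module_hom A (P 0) M \<and>
     e ` carrier (P 0) = carrier M \<and>
     d 0 ` carrier (P 1) = {x \<in> carrier (P 0). e x = \<zero>\<^bsub>M\<^esub>} \<and>
     (\<forall>n. d (Suc n) ` carrier (P (Suc (Suc n))) = {x \<in> carrier (P (Suc n)). d n x = \<zero>\<^bsub>P n\<^esub>})"


section \<open>\<open>Ext\<^sub>A(M, M)\<close> with the Yoneda product\<close>

text \<open>\<open>Ext\<^sup>n(M, M)\<close> is the \<open>n\<close>-th cohomology of the complex \<open>Hom\<^sub>A(P n, M)\<close>.\<close>

definition cocycles where
  "cocycles A M P d n =
     {f \<in> module_hom A (P n) M. \<forall>x\<in>carrier (P (Suc n)). f (d n x) = \<zero>\<^bsub>M\<^esub>}"

definition coboundaries where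
  "coboundaries A M P d n =
     (case n of
        0 \<Rightarrow> {\<lambda>x\<in>carrier (P 0). \<zero>\<^bsub>M\<^esub>}
      | Suc m \<Rightarrow> (\<lambda>g. \<lambda>x\<in>carrier (P (Suc m)). g (d m x)) ` module_hom A (P m) M)"

text \<open>An additive group, as a \<^type>\<open>monoid\<close> record.\<close>

definition cocycle_group ::
    "('a, 'r) ring_scheme \<Rightarrow> ('a, 'n) module \<Rightarrow> (nat \<Rightarrow> ('a, 'm) module) \<Rightarrow>
     (nat \<Rightarrow> 'm \<Rightarrow> 'm) \<Rightarrow> nat \<Rightarrow> ('m \<Rightarrow> 'n) monoid" where
  "cocycle_group A M P d n =
     \<lparr>carrier = cocycles A M P d n,
      monoid.mult = (\<lambda>f g. \<lambda>x\<in>carrier (P n). f x \<oplus>\<^bsub>M\<^esub> g x),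
      one = (\<lambda>x\<in>carrier (P n). \<zero>\<^bsub>M\<^esub>)\<rparr>"

definition ext_group ::
    "('a, 'r) ring_scheme \<Rightarrow> ('a, 'n) module \<Rightarrow> (nat \<Rightarrow> ('a, 'm) module) \<Rightarrow>
     (nat \<Rightarrow> 'm \<Rightarrow> 'm) \<Rightarrow> nat \<Rightarrow> ('m \<Rightarrow> 'n) set monoid" where
  "ext_group A M P d n = cocycle_group A M P d n Mod coboundaries A M P d n"

definition cohomology_class ::
    "('a, 'r) ring_scheme \<Rightarrow> ('a, 'n) module \<Rightarrow> (nat \<Rightarrow> ('a, 'm) module) \<Rightarrow>
     (nat \<Rightarrow> 'm \<Rightarrow> 'm) \<Rightarrow> nat \<Rightarrow> ('m \<Rightarrow> 'n) \<Rightarrow> ('m \<Rightarrow> 'n) set" where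
  "cohomology_class A M P d n f = coboundaries A M P d n #>\<^bsub>cocycle_group A M P d n\<^esub> f"

text \<open>The chain maps \<open>G i : P (n + i) \<rightarrow> P i\<close> lifting an \<open>n\<close>-cocycle \<open>g\<close>.\<close>

definition lifts ::
    "('a, 'r) ring_scheme \<Rightarrow> (nat \<Rightarrow> ('a, 'm) module) \<Rightarrow> (nat \<Rightarrow> 'm \<Rightarrow> 'm) \<Rightarrow> ('m \<Rightarrow> 'n) \<Rightarrow>
     nat \<Rightarrow> ('m \<Rightarrow> 'n) \<Rightarrow> (nat \<Rightarrow> 'm \<Rightarrow> 'm) set" where
  "lifts A P d e n g =
     {G. (\<forall>i. G i \<in> module_hom A (P (n + i)) (P i)) \<and>
         (\<forall>x\<in>carrier (P n). e (G 0 x) = g x) \<and>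
         (\<forall>i. \<forall>x\<in>carrier (P (n + Suc i)). d i (G (Suc i) x) = G i (d (n + i) x))}"

text \<open>The Yoneda product of the classes \<open>a\<close> of an \<open>m\<close>-cocycle \<open>f\<close> and \<open>b\<close> of an \<open>n\<close>-cocycle \<open>g\<close> is the class
  of \<open>f \<circ> G m\<close> for any lift \<open>G\<close> of \<open>g\<close>. As with \<^const>\<open>rcoset_mult\<close>, this is written as a union
  over all choices; the class does not depend on them. No sign is introduced: the sign
  conventions in use change products of homogeneous elements by a factor \<open>\<plusminus>1\<close> depending only on
  their degrees.\<close>

definition yoneda_product ::
    "('a, 'r) ring_scheme \<Rightarrow> ('a, 'n) module \<Rightarrow> (nat \<Rightarrow> ('a, 'm) module) \<Rightarrow>
     (nat \<Rightarrow> 'm \<Rightarrow> 'm) \<Rightarrow> ('m \<Rightarrow> 'n) \<Rightarrow> nat \<Rightarrow> nat \<Rightarrow>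
     ('m \<Rightarrow> 'n) set \<Rightarrow> ('m \<Rightarrow> 'n) set \<Rightarrow> ('m \<Rightarrow> 'n) set" where
  "yoneda_product A M P d e m n a b =
     (\<Union>f\<in>a. \<Union>g\<in>b. \<Union>G\<in>lifts A P d e n g.
        cohomology_class A M P d (m + n) (compose (carrier (P (n + m))) f (G m)))"

text \<open>The direct sum of all \<open>Ext\<^sup>n(M, M)\<close>, where \<open>A\<close> is a \<open>k\<close>-algebra with structure map \<open>\<iota> : k \<rightarrow> A\<close>.
  Its unit is the class of \<open>e\<close>, that is, the identity of \<open>M\<close>.\<close>

definition ext_algebra ::
    "('k \<Rightarrow> 'a) \<Rightarrow> ('a, 'r) ring_scheme \<Rightarrow> ('a, 'n) module \<Rightarrow> (nat \<Rightarrow> ('a, 'm) module) \<Rightarrow>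
     (nat \<Rightarrow> 'm \<Rightarrow> 'm) \<Rightarrow> ('m \<Rightarrow> 'n) \<Rightarrow> ('k, nat \<Rightarrow> ('m \<Rightarrow> 'n) set) module" where
  "ext_algebra \<iota> A M P d e =
     \<lparr>carrier = {u. (\<forall>n. u n \<in> carrier (ext_group A M P d n)) \<and>
                    finite {n. u n \<noteq> \<one>\<^bsub>ext_group A M P d n\<^esub>}},
      monoid.mult = (\<lambda>u v n. finprod (ext_group A M P d n)
                 (\<lambda>i. yoneda_product A M P d e i (n - i) (u i) (v (n - i))) {..n}),
      one = (\<lambda>n. if n = 0 then cohomology_class A M P d 0 e else \<one>\<^bsub>ext_group A M P d n\<^esub>),
      zero = (\<lambda>n. \<one>\<^bsub>ext_group A M P d n\<^esub>),
      add = (\<lambda>u v n. u n \<otimes>\<^bsub>ext_group A M P d n\<^esub> v n),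
      smult = (\<lambda>c u n. \<Union>f\<in>u n.
                 cohomology_class A M P d n (\<lambda>x\<in>carrier (P n). \<iota> c \<odot>\<^bsub>M\<^esub> f x))\<rparr>"

text \<open>The scalars of the algebra \<open>E\<close> are all elements of the type \<^typ>\<open>'k\<close>.\<close>

definition finitely_generated_algebra :: "('k, 'b) module \<Rightarrow> bool" where
  "finitely_generated_algebra E \<longleftrightarrow>
     (\<exists>S \<subseteq> carrier E. finite S \<and>
        (\<forall>B. subring B E \<and> (\<forall>c. \<forall>b\<in>B. c \<odot>\<^bsub>E\<^esub> b \<in> B) \<and> S \<subseteq> B \<longrightarrow> B = carrier E))"


section \<open>The free algebra and the algebra \<open>A5(\<beta>)\<close>\<close>

datatype 'x free_monoid = Word (letters: "'x list")

instantiation free_monoid :: (type) monoid_add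
begin

definition "0 = Word []"
definition "u + v = Word (letters u @ letters v)"

instance
  by standard (simp_all add: zero_free_monoid_def plus_free_monoid_def)

end

text \<open>The monoid algebra of the free monoid on \<open>z, y\<close>; the product of \<^typ>\<open>'w \<Rightarrow>\<^sub>0 'k\<close> is convolution.\<close>

datatype generator = Gen_z | Gen_y

type_synonym 'k free_algebra = "generator free_monoid \<Rightarrow>\<^sub>0 'k"

abbreviation free_z :: "'k::field free_algebra" where
  "free_z \<equiv> Poly_Mapping.single (Word [Gen_z]) 1"
abbreviation free_y :: "'k::field free_algebra" where
  "free_y \<equiv> Poly_Mapping.single (Word [Gen_y]) 1"

abbreviation scalar :: "'k::field \<Rightarrow> 'k free_algebra" where "scalar \<equiv> Poly_Mapping.single 0"

definition commutator :: "'r::ring \<Rightarrow> 'r \<Rightarrow> 'r" where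
  "commutator u v = u * v - v * u"

definition type_ring :: "'r::ring_1 ring" where
  "type_ring = \<lparr>carrier = UNIV, monoid.mult = (*), one = 1, zero = 0, add = (+)\<rparr>"

definition A5_relations :: "nat \<Rightarrow> 'k::field \<Rightarrow> 'k free_algebra set" where
  "A5_relations p \<beta> =
     (let z = free_z; y = free_y in
       {commutator y z ^ p,
        y ^ p,
        commutator (commutator z y) y,
        commutator (commutator z y) z,
        z ^ p + y * commutator y z ^ (p - 1) - scalar \<beta> * commutator y z})"

definition A5_ideal :: "nat \<Rightarrow> 'k::field \<Rightarrow> 'k free_algebra set" where
  "A5_ideal p \<beta> = Idl\<^bsub>type_ring\<^esub> (A5_relations p \<beta>)"

definition A5 :: "nat \<Rightarrow> 'k::field \<Rightarrow> 'k free_algebra set ring" where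
  "A5 p \<beta> = type_ring Quot A5_ideal p \<beta>"

definition A5_class :: "nat \<Rightarrow> 'k::field \<Rightarrow> 'k free_algebra \<Rightarrow> 'k free_algebra set" where
  "A5_class p \<beta> r = A5_ideal p \<beta> +>\<^bsub>type_ring\<^esub> r"

text \<open>A residue class acts on \<open>k\<close> by the common constant coefficient of its representatives.\<close>

definition trivial_module :: "('k::field free_algebra set, 'k) module" where
  "trivial_module =
     \<lparr>carrier = UNIV, monoid.mult = (*), one = 1, zero = 0, add = (+),
      smult = (\<lambda>a x. the_elem ((\<lambda>r. Poly_Mapping.lookup r 0) ` a) * x)\<rparr>"

text \<open>The following facts confirm that this is the one-dimensional module on which \<open>z\<close> and \<open>y\<close> act as
  zero.\<close>

lemma type_ring_simps [simp]:
  "carrier type_ring = UNIV" "monoid.mult type_ring = (*)" "one type_ring = 1"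
  "zero type_ring = 0" "add type_ring = (+)"
  by (simp_all add: type_ring_def)

lemma ring_type_ring: "ring (type_ring :: 'r::ring_1 ring)"
proof (rule ringI)
  show "abelian_group (type_ring :: 'r ring)"
  proof (rule abelian_groupI)
    fix u :: 'r
    show "\<exists>v\<in>carrier type_ring. v \<oplus>\<^bsub>type_ring\<^esub> u = \<zero>\<^bsub>type_ring\<^esub>"
      by (rule bexI[of _ "- u"]) simp_all
  qed (simp_all add: add_ac)
  show "monoid (type_ring :: 'r ring)"
    by (rule monoidI) (simp_all add: mult.assoc)
qed (simp_all add: distrib_left distrib_right)

lemma free_monoid_sum_eq_0 [simp]: "u + v = 0 \<longleftrightarrow> u = 0 \<and> v = (0 :: 'x free_monoid)"
  by (cases u; cases v) (auto simp: zero_free_monoid_def plus_free_monoid_def)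

lemma lookup_mult_0:
  fixes r s :: "'x free_monoid \<Rightarrow>\<^sub>0 'k::field"
  shows "Poly_Mapping.lookup (r * s) 0 = Poly_Mapping.lookup r 0 * Poly_Mapping.lookup s 0"
proof -
  have inner: "Sum_any (\<lambda>q. Poly_Mapping.lookup s q when 0 = l + q) =
      (Poly_Mapping.lookup s 0 when l = 0)" for l :: "'x free_monoid"
  proof -
    have "(\<lambda>q. Poly_Mapping.lookup s q when 0 = l + q) =
        (\<lambda>q. (Poly_Mapping.lookup s 0 when l = 0) when q = 0)"
      by (rule ext) (simp add: when_def eq_commute[of 0])
    then show ?thesis by (simp only: Sum_any_when_equal)
  qed
  have "Poly_Mapping.lookup (r * s) 0 =
      Sum_any (\<lambda>l. Poly_Mapping.lookup r l * (Poly_Mapping.lookup s 0 when l = 0))"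
    by (simp only: lookup_mult inner)
  also have "(\<lambda>l. Poly_Mapping.lookup r l * (Poly_Mapping.lookup s 0 when l = 0)) =
      (\<lambda>l. (Poly_Mapping.lookup r 0 * Poly_Mapping.lookup s 0) when l = 0)"
    by (rule ext) (simp add: when_def)
  finally show ?thesis by simp
qed

lemma lookup_power_0:
  fixes r :: "'x free_monoid \<Rightarrow>\<^sub>0 'k::field"
  shows "Poly_Mapping.lookup (r ^ n) 0 = Poly_Mapping.lookup r 0 ^ n"
  by (induction n) (simp_all add: lookup_mult_0)

lemma lookup_commutator_0:
  fixes r s :: "'x free_monoid \<Rightarrow>\<^sub>0 'k::field"
  shows "Poly_Mapping.lookup (commutator r s) 0 = 0"
  by (simp add: commutator_def lookup_minus lookup_mult_0)

lemma lookup_generator_0: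
  "Poly_Mapping.lookup (Poly_Mapping.single (Word [x]) (c :: 'k::field)) 0 = 0"
  by (simp add: lookup_single zero_free_monoid_def)

lemma ideal_A5_ideal: "ideal (A5_ideal p \<beta>) (type_ring :: 'k::field free_algebra ring)"
  unfolding A5_ideal_def by (rule ring.genideal_ideal[OF ring_type_ring]) simp

lemma A5_ideal_lookup_0:
  assumes "p > 0" "r \<in> A5_ideal p (\<beta> :: 'k::field)"
  shows "Poly_Mapping.lookup r 0 = 0"
proof -
  let ?N = "{r :: 'k free_algebra. Poly_Mapping.lookup r 0 = 0}"
  have "ideal ?N type_ring"
  proof (rule idealI[OF ring_type_ring])
    have grp: "group (add_monoid (type_ring :: 'k free_algebra ring))"
      by (rule abelian_group.a_group[OF ring.is_abelian_group[OF ring_type_ring]])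
    show "subgroup ?N (add_monoid type_ring)"
    proof (rule group.subgroupI[OF grp])
      fix r :: "'k free_algebra"
      assume "r \<in> ?N"
      moreover have "inv\<^bsub>add_monoid type_ring\<^esub> r = - r"
        by (rule group.inv_equality[OF grp]) simp_all
      ultimately show "inv\<^bsub>add_monoid type_ring\<^esub> r \<in> ?N" by (simp only: mem_Collect_eq) simp
    qed (auto simp: lookup_add intro: exI[of _ 0])
  qed (simp_all add: lookup_mult_0)
  moreover have "A5_relations p \<beta> \<subseteq> ?N"
    using assms(1)
    by (auto simp: A5_relations_def Let_def lookup_power_0 lookup_commutator_0 lookup_generator_0
        lookup_mult_0 lookup_add lookup_minus zero_power)
  ultimately have "A5_ideal p \<beta> \<subseteq> ?N"
    unfolding A5_ideal_def by (rule ring.genideal_minimal[OF ring_type_ring])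
  with assms(2) show ?thesis by auto
qed

lemma A5_carrier: "carrier (A5 p \<beta>) = range (A5_class p \<beta>)"
  by (auto simp: A5_def FactRing_def A_RCOSETS_def' A5_class_def)

lemma trivial_module_smult:
  assumes "p > 0"
  shows "A5_class p \<beta> r \<odot>\<^bsub>trivial_module\<^esub> x = Poly_Mapping.lookup r 0 * (x :: 'k::field)"
proof -
  interpret ideal "A5_ideal p \<beta>" "type_ring :: 'k free_algebra ring"
    by (rule ideal_A5_ideal)
  have "r \<in> A5_class p \<beta> r"
    unfolding A5_class_def by (rule a_rcos_self) simp
  moreover have "Poly_Mapping.lookup s 0 = Poly_Mapping.lookup r 0" if "s \<in> A5_class p \<beta> r" for s
    using that A5_ideal_lookup_0[OF assms]
    by (auto simp: A5_class_def a_r_coset_def' lookup_add)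
  ultimately have "(\<lambda>s. Poly_Mapping.lookup s 0) ` A5_class p \<beta> r = {Poly_Mapping.lookup r 0}"
    by blast
  then show ?thesis by (simp add: trivial_module_def)
qed

lemma trivial_module_generators:
  assumes "p > 0"
  shows "A5_class p \<beta> free_z \<odot>\<^bsub>trivial_module\<^esub> x = 0"
    and "A5_class p \<beta> free_y \<odot>\<^bsub>trivial_module\<^esub> x = 0"
    and "A5_class p \<beta> (scalar c) \<odot>\<^bsub>trivial_module\<^esub> x = c * x"
  by (simp_all add: trivial_module_smult[OF assms] lookup_generator_0)

lemma trivial_module_left_module:
  assumes "p > 0"
  shows "left_module (A5 p \<beta>) (trivial_module :: ('k::field free_algebra set, 'k) module)"
proof -
  interpret I: ideal "A5_ideal p \<beta>" "type_ring :: 'k free_algebra ring"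
    by (rule ideal_A5_ideal)
  have cadd: "A5_class p \<beta> r \<oplus>\<^bsub>A5 p \<beta>\<^esub> A5_class p \<beta> s = A5_class p \<beta> (r + s)" for r s
    using I.a_rcos_sum[of r s] by (simp add: A5_def A5_class_def FactRing_def)
  have cmult: "A5_class p \<beta> r \<otimes>\<^bsub>A5 p \<beta>\<^esub> A5_class p \<beta> s = A5_class p \<beta> (r * s)" for r s
    using I.rcoset_mult_add[of r s] by (simp add: A5_def A5_class_def FactRing_def)
  have cone: "\<one>\<^bsub>A5 p \<beta>\<^esub> = A5_class p \<beta> 1"
    by (simp add: A5_def A5_class_def FactRing_def)
  have "abelian_group (trivial_module :: ('k free_algebra set, 'k) module)"
  proof (rule abelian_groupI)
    fix u :: 'k
    show "\<exists>v\<in>carrier (trivial_module :: ('k free_algebra set, 'k) module).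
        v \<oplus>\<^bsub>trivial_module\<^esub> u = \<zero>\<^bsub>trivial_module\<^esub>"
      by (rule bexI[of _ "- u"]) (simp_all add: trivial_module_def)
  qed (simp_all add: trivial_module_def add_ac)
  moreover have "ring (A5 p \<beta>)"
    unfolding A5_def by (rule I.quotient_is_ring)
  moreover have "left_module_axioms (A5 p \<beta>) (trivial_module :: ('k free_algebra set, 'k) module)"
  proof
    fix a b and u v :: 'k
    assume "a \<in> carrier (A5 p \<beta>)"
    then obtain r where a: "a = A5_class p \<beta> r" by (auto simp: A5_carrier)
    have plus: "u \<oplus>\<^bsub>trivial_module\<^esub> v = u + v"
      for u v :: 'k by (simp add: trivial_module_def)
    note act = trivial_module_smult[OF assms]
    show "a \<odot>\<^bsub>trivial_module\<^esub> u \<in> carrier trivial_module"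
      by (simp add: trivial_module_def)
    show "a \<odot>\<^bsub>trivial_module\<^esub> (u \<oplus>\<^bsub>trivial_module\<^esub> v) =
        a \<odot>\<^bsub>trivial_module\<^esub> u \<oplus>\<^bsub>trivial_module\<^esub> a \<odot>\<^bsub>trivial_module\<^esub> v"
      by (simp only: a plus act distrib_left)
    assume "b \<in> carrier (A5 p \<beta>)"
    then obtain s where b: "b = A5_class p \<beta> s" by (auto simp: A5_carrier)
    show "(a \<oplus>\<^bsub>A5 p \<beta>\<^esub> b) \<odot>\<^bsub>trivial_module\<^esub> u =
        a \<odot>\<^bsub>trivial_module\<^esub> u \<oplus>\<^bsub>trivial_module\<^esub> b \<odot>\<^bsub>trivial_module\<^esub> u"
      by (simp only: a b cadd plus act lookup_add distrib_right)
    show "(a \<otimes>\<^bsub>A5 p \<beta>\<^esub> b) \<odot>\<^bsub>trivial_module\<^esub> u =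
        a \<odot>\<^bsub>trivial_module\<^esub> (b \<odot>\<^bsub>trivial_module\<^esub> u)"
      by (simp only: a b cmult act lookup_mult_0 mult.assoc)
  next
    fix u :: 'k
    show "\<one>\<^bsub>A5 p \<beta>\<^esub> \<odot>\<^bsub>trivial_module\<^esub> u = u"
      by (simp add: cone trivial_module_smult[OF assms])
  qed
  ultimately show ?thesis
    by (simp add: left_module_def)
qed

end

theory Submission
  imports Defs
begin

text \<open>
  Write \<open>x = [y, z]\<close>. Since \<open>\<beta> \<noteq> 0\<close>, the relation \<open>z\<^sup>p = \<beta> x - y x\<^sup>p\<^sup>-\<^sup>1\<close> expresses \<open>x\<close> as \<open>u z\<close> with
  \<open>u = (\<beta>\<^sup>-\<^sup>1 + \<beta>\<^sup>-\<^sup>2 y x\<^sup>p\<^sup>-\<^sup>2) z\<^sup>p\<^sup>-\<^sup>1\<close>, so \<open>A = A5(\<beta>)\<close> is a twisted version of the truncated polynomial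
  ring \<open>k[z, y] / (z\<^sup>N\<^sup>+\<^sup>1, y\<^sup>p)\<close> with \<open>N + 1 = p\<^sup>2\<close>: one has \<open>z y = y\<^sub>1 z\<close> for \<open>y\<^sub>1 = y - u\<close>, and
  \<open>[u, y] = u\<^sup>2\<close> gives \<open>y\<^sub>1\<^sup>n = y\<^sup>n - n y\<^sup>n\<^sup>-\<^sup>1 u\<close>, whence \<open>y\<^sub>1\<^sup>p = 0\<close>; moreover \<open>y z\<^sup>N = z\<^sup>N y = z\<^sup>N y\<^sub>1\<close>.
  The periodic resolutions over \<open>k[z] / (z\<^sup>N\<^sup>+\<^sup>1)\<close> and \<open>k[y] / (y\<^sup>p)\<close> therefore combine to a double
  complex of free modules of rank one, whose differentials are right multiplications by \<open>z\<close> or \<open>z\<^sup>N\<close>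
  in one direction and, up to sign, by powers of \<open>y\<close> or \<open>y\<^sub>1\<close>, depending on the parity of the column,
  in the other. Exactness reduces to \<open>A = k[y] + A z\<close> and \<open>z\<^sup>N y\<^sup>p\<^sup>-\<^sup>1 \<noteq> 0\<close>; the latter is seen in an
  explicit representation.

  The total complex is a minimal resolution of \<open>k\<close>, and its differentials are invariant under shifts
  by \<open>2\<close> in either direction. The shifts are lifts of two classes in \<open>Ext\<^sup>2\<close>, and multiplication by
  these classes carries the dual basis in degree \<open>n\<close> to dual basis elements in degree \<open>n + 2\<close>, covering
  all of them for \<open>n \<ge> 1\<close>. Hence \<open>Ext\<close> is generated in degrees at most \<open>2\<close>.
\<close>

section \<open>Module homomorphisms\<close>

text \<open>Two things shape the proof. First, the projective resolution is arbitrary, over any type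
  of elements, so the double complex cannot simply replace it: classes are carried along comparison
  maps in both directions, and each equality of classes becomes the claim that a chain map covering
  zero is null-homotopic. Second, no basis of A is constructed. The formulas for u come from
  pretending that z is invertible: if u = x z^-1 with x central, then [z^-1, y] = z^-1 [y, z] z^-1 =
  x z^-2, so [u, y] = u^2. As z is nilpotent, u is instead a genuine element with u z = x, and such
  identities are checked directly. The second summand of u comes from a geometric series whose next
  term dies because x^(2p-3) = 0, which uses p >= 3. From z^N y^(p-1) != 0, multiplication by powers
  of y shows that right multiplication by z^N is injective on the span of 1, y, ..., y^(p-1). Since
  it kills A z, the quotient A / A z is k[y] / (y^p). Exactness of the total complex is then settled
  column by column, starting from exactness of the powers of y modulo A z.\<close>

lemma module_homI:
  assumes "f \<in> extensional (carrier M)"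
    and "\<And>x. x \<in> carrier M \<Longrightarrow> f x \<in> carrier N"
    and "\<And>x y. x \<in> carrier M \<Longrightarrow> y \<in> carrier M \<Longrightarrow> f (x \<oplus>\<^bsub>M\<^esub> y) = f x \<oplus>\<^bsub>N\<^esub> f y"
    and "\<And>a x. a \<in> carrier A \<Longrightarrow> x \<in> carrier M \<Longrightarrow> f (a \<odot>\<^bsub>M\<^esub> x) = a \<odot>\<^bsub>N\<^esub> f x"
  shows "f \<in> module_hom A M N"
  using assms by (auto simp: module_hom_def PiE_def)

lemma module_homD:
  assumes "f \<in> module_hom A M N"
  shows "f \<in> extensional (carrier M)"
    and "x \<in> carrier M \<Longrightarrow> f x \<in> carrier N"
    and "x \<in> carrier M \<Longrightarrow> y \<in> carrier M \<Longrightarrow> f (x \<oplus>\<^bsub>M\<^esub> y) = f x \<oplus>\<^bsub>N\<^esub> f y"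
    and "a \<in> carrier A \<Longrightarrow> x \<in> carrier M \<Longrightarrow> f (a \<odot>\<^bsub>M\<^esub> x) = a \<odot>\<^bsub>N\<^esub> f x"
  using assms by (auto simp: module_hom_def PiE_def)

lemma restrict_module_homI:
  assumes "left_module A M"
    and "\<And>x. x \<in> carrier M \<Longrightarrow> f x \<in> carrier N"
    and "\<And>x y. x \<in> carrier M \<Longrightarrow> y \<in> carrier M \<Longrightarrow> f (x \<oplus>\<^bsub>M\<^esub> y) = f x \<oplus>\<^bsub>N\<^esub> f y"
    and "\<And>a x. a \<in> carrier A \<Longrightarrow> x \<in> carrier M \<Longrightarrow> f (a \<odot>\<^bsub>M\<^esub> x) = a \<odot>\<^bsub>N\<^esub> f x"
  shows "(\<lambda>x\<in>carrier M. f x) \<in> module_hom A M N"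
proof -
  interpret left_module A M by fact
  show ?thesis
    using assms by (intro module_homI) (auto simp: smult_closed)
qed

lemma left_module_abelian_group: "left_module A M \<Longrightarrow> abelian_group M"
  by (simp add: left_module_def)

lemma abelian_group_hom_zero:
  assumes "abelian_group M" "abelian_group N"
    and "\<And>x. x \<in> carrier M \<Longrightarrow> f x \<in> carrier N"
    and "\<And>x y. x \<in> carrier M \<Longrightarrow> y \<in> carrier M \<Longrightarrow> f (x \<oplus>\<^bsub>M\<^esub> y) = f x \<oplus>\<^bsub>N\<^esub> f y"
  shows "f \<zero>\<^bsub>M\<^esub> = \<zero>\<^bsub>N\<^esub>"
proof -
  interpret M: abelian_group M by fact
  interpret N: abelian_group N by fact
  have "f \<zero>\<^bsub>M\<^esub> \<oplus>\<^bsub>N\<^esub> f \<zero>\<^bsub>M\<^esub> = f \<zero>\<^bsub>M\<^esub>"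
    using assms(4)[of "\<zero>\<^bsub>M\<^esub>" "\<zero>\<^bsub>M\<^esub>"] by simp
  then show ?thesis using assms(3) by simp
qed

lemma module_hom_zero:
  assumes "left_module A M" "left_module A N" "f \<in> module_hom A M N"
  shows "f \<zero>\<^bsub>M\<^esub> = \<zero>\<^bsub>N\<^esub>"
  using abelian_group_hom_zero[of M N f] left_module_abelian_group[OF assms(1)]
    left_module_abelian_group[OF assms(2)] module_homD[OF assms(3)] by blast

lemma module_hom_minus:
  assumes "left_module A M" "left_module A N" "f \<in> module_hom A M N"
    and "x \<in> carrier M" "y \<in> carrier M"
  shows "f (x \<ominus>\<^bsub>M\<^esub> y) = f x \<ominus>\<^bsub>N\<^esub> f y"
proof -
  interpret M: left_module A M by fact
  interpret N: left_module A N by fact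
  note f = module_homD[OF assms(3)]
  have xy: "x = (x \<ominus>\<^bsub>M\<^esub> y) \<oplus>\<^bsub>M\<^esub> y"
    using assms by (simp add: M.M.minus_eq M.M.a_assoc M.M.l_neg)
  have "f x = f (x \<ominus>\<^bsub>M\<^esub> y) \<oplus>\<^bsub>N\<^esub> f y"
    using assms by (subst xy) (simp add: f)
  then show ?thesis
    using assms f(2) by (simp add: N.M.minus_eq N.M.a_assoc N.M.r_neg)
qed

context left_module
begin

lemma smult_r_minus:
  assumes "a \<in> carrier R" "x \<in> carrier M" "y \<in> carrier M"
  shows "a \<odot>\<^bsub>M\<^esub> (x \<ominus>\<^bsub>M\<^esub> y) = a \<odot>\<^bsub>M\<^esub> x \<ominus>\<^bsub>M\<^esub> a \<odot>\<^bsub>M\<^esub> y"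
proof -
  have xy: "x = (x \<ominus>\<^bsub>M\<^esub> y) \<oplus>\<^bsub>M\<^esub> y"
    using assms by (simp add: M.minus_eq M.a_assoc M.l_neg)
  have "a \<odot>\<^bsub>M\<^esub> x = a \<odot>\<^bsub>M\<^esub> (x \<ominus>\<^bsub>M\<^esub> y) \<oplus>\<^bsub>M\<^esub> a \<odot>\<^bsub>M\<^esub> y"
    using assms by (subst xy) (simp add: smult_r_distr)
  then show ?thesis
    using assms by (simp add: M.minus_eq M.a_assoc M.r_neg smult_closed)
qed

lemma smult_r_zero: "a \<in> carrier R \<Longrightarrow> a \<odot>\<^bsub>M\<^esub> \<zero>\<^bsub>M\<^esub> = \<zero>\<^bsub>M\<^esub>"
  using smult_r_distr[of a "\<zero>\<^bsub>M\<^esub>" "\<zero>\<^bsub>M\<^esub>"] smult_closed[of a "\<zero>\<^bsub>M\<^esub>"] by simp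

lemma smult_l_zero: "x \<in> carrier M \<Longrightarrow> \<zero>\<^bsub>R\<^esub> \<odot>\<^bsub>M\<^esub> x = \<zero>\<^bsub>M\<^esub>"
  using smult_l_distr[of "\<zero>" "\<zero>" x] smult_closed[of "\<zero>" x] by simp

end

lemma module_hom_compose:
  assumes "left_module A M" "f \<in> module_hom A M N" "g \<in> module_hom A N L"
  shows "(\<lambda>x\<in>carrier M. g (f x)) \<in> module_hom A M L"
  using assms(1) by (rule restrict_module_homI) (simp_all add: module_homD[OF assms(2)] module_homD[OF assms(3)])

lemma module_hom_diff:
  assumes "left_module A M" "left_module A N" "f \<in> module_hom A M N" "g \<in> module_hom A M N"
  shows "(\<lambda>x\<in>carrier M. f x \<ominus>\<^bsub>N\<^esub> g x) \<in> module_hom A M N"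
proof -
  interpret N: left_module A N by fact
  note f = module_homD[OF assms(3)] module_homD[OF assms(4)]
  show ?thesis
    by (rule restrict_module_homI[OF assms(1)])
      (simp_all add: f N.smult_r_minus, simp_all add: f N.M.minus_eq N.M.minus_add N.M.a_ac)
qed

lemma module_hom_add:
  assumes "left_module A M" "left_module A N" "f \<in> module_hom A M N" "g \<in> module_hom A M N"
  shows "(\<lambda>x\<in>carrier M. f x \<oplus>\<^bsub>N\<^esub> g x) \<in> module_hom A M N"
proof -
  interpret N: left_module A N by fact
  note f = module_homD[OF assms(3)] module_homD[OF assms(4)]
  show ?thesis
    by (rule restrict_module_homI[OF assms(1)]) (simp_all add: f N.smult_r_distr N.M.a_ac)
qed


section \<open>Free modules and retracts of free modules\<close>

definition unit_vector :: "('a, 'r) ring_scheme \<Rightarrow> 'x \<Rightarrow> 'x \<Rightarrow> 'a" where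
  "unit_vector A x = (\<lambda>y. if y = x then \<one>\<^bsub>A\<^esub> else \<zero>\<^bsub>A\<^esub>)"

lemma free_module_simps:
  "carrier (free_module A X) = {f. (\<forall>x\<in>X. f x \<in> carrier A) \<and> (\<forall>x. x \<notin> X \<longrightarrow> f x = \<zero>\<^bsub>A\<^esub>) \<and>
                    finite {x. f x \<noteq> \<zero>\<^bsub>A\<^esub>}}"
  "zero (free_module A X) = (\<lambda>x. \<zero>\<^bsub>A\<^esub>)"
  "add (free_module A X) = (\<lambda>f g x. f x \<oplus>\<^bsub>A\<^esub> g x)"
  "smult (free_module A X) = (\<lambda>a f x. a \<otimes>\<^bsub>A\<^esub> f x)"
  by (simp_all add: free_module_def)

context ring
begin

lemma free_module_carrierD:
  assumes "f \<in> carrier (free_module R X)"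
  shows "f x \<in> carrier R"
  using assms by (cases "x \<in> X") (auto simp: free_module_simps)

lemma free_module_add_closed:
  assumes "f \<in> carrier (free_module R X)" "g \<in> carrier (free_module R X)"
  shows "(\<lambda>x. f x \<oplus> g x) \<in> carrier (free_module R X)"
proof -
  have "{x. f x \<oplus> g x \<noteq> \<zero>} \<subseteq> {x. f x \<noteq> \<zero>} \<union> {x. g x \<noteq> \<zero>}"
    using free_module_carrierD[OF assms(1)] by auto
  then show ?thesis
    using assms finite_subset[of "{x. f x \<oplus> g x \<noteq> \<zero>}"] by (auto simp: free_module_simps)
qed

lemma free_module_smult_closed:
  assumes "a \<in> carrier R" "f \<in> carrier (free_module R X)"
  shows "(\<lambda>x. a \<otimes> f x) \<in> carrier (free_module R X)"
proof -
  have "{x. a \<otimes> f x \<noteq> \<zero>} \<subseteq> {x. f x \<noteq> \<zero>}" using assms(1) by auto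
  then show ?thesis
    using assms finite_subset[of "{x. a \<otimes> f x \<noteq> \<zero>}"] by (auto simp: free_module_simps)
qed

lemma left_module_free_module: "left_module R (free_module R X)"
proof -
  let ?F = "free_module R X"
  note c = free_module_carrierD[of _ X]
  have "abelian_group ?F"
  proof (rule abelian_groupI)
    fix f assume f: "f \<in> carrier ?F"
    have "(\<lambda>x. \<ominus> \<one> \<otimes> f x) \<in> carrier ?F" using f by (simp add: free_module_smult_closed)
    moreover have "(\<lambda>x. \<ominus> \<one> \<otimes> f x) \<oplus>\<^bsub>?F\<^esub> f = \<zero>\<^bsub>?F\<^esub>"
      using c[OF f] by (simp add: free_module_simps l_minus l_neg)
    ultimately show "\<exists>g\<in>carrier ?F. g \<oplus>\<^bsub>?F\<^esub> f = \<zero>\<^bsub>?F\<^esub>" by blast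
  next
    fix f g assume "f \<in> carrier ?F" "g \<in> carrier ?F"
    then show "f \<oplus>\<^bsub>?F\<^esub> g \<in> carrier ?F"
      using free_module_add_closed by (simp add: free_module_simps(3))
  next
    fix f g h assume "f \<in> carrier ?F" "g \<in> carrier ?F" "h \<in> carrier ?F"
    then show "f \<oplus>\<^bsub>?F\<^esub> g \<oplus>\<^bsub>?F\<^esub> h = f \<oplus>\<^bsub>?F\<^esub> (g \<oplus>\<^bsub>?F\<^esub> h)"
      using c by (simp add: free_module_simps(3) a_assoc)
  next
    fix f g assume "f \<in> carrier ?F" "g \<in> carrier ?F"
    then show "f \<oplus>\<^bsub>?F\<^esub> g = g \<oplus>\<^bsub>?F\<^esub> f"
      using c by (simp add: free_module_simps(3) a_comm)
  next
    fix f assume "f \<in> carrier ?F"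
    then show "\<zero>\<^bsub>?F\<^esub> \<oplus>\<^bsub>?F\<^esub> f = f"
      using c by (simp add: free_module_simps(2,3))
  qed (auto simp: free_module_simps)
  moreover have "left_module_axioms R ?F"
  proof
    fix a f assume "a \<in> carrier R" "f \<in> carrier ?F"
    then show "a \<odot>\<^bsub>?F\<^esub> f \<in> carrier ?F"
      using free_module_smult_closed by (simp add: free_module_simps(4))
  qed (simp_all add: free_module_simps(3,4) c l_distr r_distr m_assoc)
  ultimately show ?thesis using ring_axioms by (simp add: left_module_def)
qed

lemma unit_vector_closed: "x \<in> X \<Longrightarrow> unit_vector R x \<in> carrier (free_module R X)"
  by (auto simp: free_module_simps unit_vector_def)

lemma free_module_hom_eqI:
  assumes f: "f \<in> module_hom R (free_module R X) N" and g: "g \<in> module_hom R (free_module R X) N"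
    and N: "left_module R N"
    and eq: "\<And>x. x \<in> X \<Longrightarrow> f (unit_vector R x) = g (unit_vector R x)"
    and v: "v \<in> carrier (free_module R X)"
  shows "f v = g v"
proof -
  let ?F = "free_module R X"
  note F = left_module_free_module[of X]
  have "finite S \<Longrightarrow> v \<in> carrier ?F \<Longrightarrow> {x. v x \<noteq> \<zero>} \<subseteq> S \<Longrightarrow> f v = g v" for S v
  proof (induction S arbitrary: v rule: finite_induct)
    case empty
    then have "v = \<zero>\<^bsub>?F\<^esub>" by (auto simp: free_module_simps)
    then show ?case using module_hom_zero[OF F N f] module_hom_zero[OF F N g] by simp
  next
    case (insert x S)
    show ?case
    proof (cases "x \<in> X")
      case False
      then have "v x = \<zero>" using insert.prems by (auto simp: free_module_simps)
      then show ?thesis using insert by blast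
    next
      case True
      define w where "w = v(x := \<zero>)"
      have w: "w \<in> carrier ?F"
      proof -
        have "{y. w y \<noteq> \<zero>} \<subseteq> {y. v y \<noteq> \<zero>}" by (auto simp: w_def)
        with insert.prems(1) have "finite {y. w y \<noteq> \<zero>}"
          using finite_subset by (auto simp: free_module_simps(1))
        with insert.prems(1) show ?thesis by (simp add: w_def free_module_simps(1))
      qed
      have e: "unit_vector R x \<in> carrier ?F" using True by (rule unit_vector_closed)
      have vx: "v x \<in> carrier R" using insert.prems(1) by (rule free_module_carrierD)
      have ve: "v x \<odot>\<^bsub>?F\<^esub> unit_vector R x \<in> carrier ?F"
        using F vx e by (rule left_module.smult_closed)
      have "v y = w y \<oplus> v x \<otimes> unit_vector R x y" for y
        using free_module_carrierD[OF insert.prems(1), of y] vx by (simp add: w_def unit_vector_def)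
      then have dec: "v = w \<oplus>\<^bsub>?F\<^esub> (v x \<odot>\<^bsub>?F\<^esub> unit_vector R x)"
        unfolding free_module_simps(3,4) by (rule ext)
      have "{y. w y \<noteq> \<zero>} \<subseteq> S" using insert.prems(2) by (auto simp: w_def)
      then have "f w = g w" using insert.IH w by blast
      then show ?thesis
        by (subst (1 2) dec) (simp only: module_homD(3,4)[OF f] module_homD(3,4)[OF g] w ve vx e eq[OF True])
    qed
  qed
  from this[of "{x. v x \<noteq> \<zero>}" v] v show ?thesis by (simp add: free_module_simps(1))
qed

text \<open>The extension is the linear combination of the \<open>g x\<close> over the support of
  \<open>v\<close>. The support of a sum may be smaller than the union of the supports, so
  \<open>h_eq\<close> first allows summation over any finite set between the support and
  \<open>X\<close>.\<close>

lemma free_module_hom_ex: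
  fixes X :: "'x set"
  assumes N: "left_module R N" and g: "\<And>x. x \<in> X \<Longrightarrow> g x \<in> carrier N"
  obtains h where "h \<in> module_hom R (free_module R X) N"
    and "\<And>x. x \<in> X \<Longrightarrow> h (unit_vector R x) = g x"
proof -
  interpret N: left_module R N by fact
  let ?F = "free_module R X"
  define s where "s v = {x. v x \<noteq> \<zero>}" for v :: "'x \<Rightarrow> 'a"
  define h where "h = (\<lambda>v\<in>carrier ?F. \<Oplus>\<^bsub>N\<^esub>x\<in>s v. v x \<odot>\<^bsub>N\<^esub> g x)"
  have s: "finite (s v)" "s v \<subseteq> X" if "v \<in> carrier ?F" for v
    using that by (auto simp: s_def free_module_simps)
  have c: "v x \<odot>\<^bsub>N\<^esub> g x \<in> carrier N" if "v \<in> carrier ?F" "x \<in> X" for v x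
    using that(2) g free_module_carrierD[OF that(1)] by (intro N.smult_closed) auto
  have h_eq: "h v = (\<Oplus>\<^bsub>N\<^esub>x\<in>T. v x \<odot>\<^bsub>N\<^esub> g x)" if "v \<in> carrier ?F" "finite T" "s v \<subseteq> T" "T \<subseteq> X" for v T
  proof -
    have "(\<Oplus>\<^bsub>N\<^esub>x\<in>s v. v x \<odot>\<^bsub>N\<^esub> g x) = (\<Oplus>\<^bsub>N\<^esub>x\<in>T. v x \<odot>\<^bsub>N\<^esub> g x)"
    proof (rule N.M.add.finprod_mono_neutral_cong_left[OF that(2,3)])
      show "(\<lambda>x. v x \<odot>\<^bsub>N\<^esub> g x) \<in> T \<rightarrow> carrier N" using c that by blast
    qed (use that g in \<open>auto simp: s_def N.smult_l_zero\<close>)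
    then show ?thesis using that(1) by (simp add: h_def)
  qed
  have "h \<in> module_hom R ?F N"
    unfolding h_def
  proof (rule restrict_module_homI[OF left_module_free_module])
    fix v assume v: "v \<in> carrier ?F"
    then show "(\<Oplus>\<^bsub>N\<^esub>x\<in>s v. v x \<odot>\<^bsub>N\<^esub> g x) \<in> carrier N"
      using c s by (intro N.M.finsum_closed) blast
  next
    fix v w assume v: "v \<in> carrier ?F" and w: "w \<in> carrier ?F"
    let ?T = "s v \<union> s w"
    have vw: "v \<oplus>\<^bsub>?F\<^esub> w \<in> carrier ?F"
      using v w by (simp add: free_module_add_closed free_module_simps(3))
    have T: "finite ?T" "?T \<subseteq> X" using s v w by auto
    have "s (v \<oplus>\<^bsub>?F\<^esub> w) \<subseteq> ?T"
      by (auto simp: s_def free_module_simps(3))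
    then have "h (v \<oplus>\<^bsub>?F\<^esub> w) = (\<Oplus>\<^bsub>N\<^esub>x\<in>?T. (v \<oplus>\<^bsub>?F\<^esub> w) x \<odot>\<^bsub>N\<^esub> g x)"
      using h_eq vw T by blast
    also have "\<dots> = (\<Oplus>\<^bsub>N\<^esub>x\<in>?T. v x \<odot>\<^bsub>N\<^esub> g x \<oplus>\<^bsub>N\<^esub> w x \<odot>\<^bsub>N\<^esub> g x)"
      using T(2) v w g c
      by (intro N.M.finsum_cong') (auto simp: free_module_simps(3) free_module_carrierD subset_eq intro!: N.smult_l_distr)
    also have "\<dots> = h v \<oplus>\<^bsub>N\<^esub> h w"
      using T v w c by (subst N.M.finsum_addf) (auto simp: h_eq[of _ ?T] subset_eq)
    finally show "(\<Oplus>\<^bsub>N\<^esub>x\<in>s (v \<oplus>\<^bsub>?F\<^esub> w). (v \<oplus>\<^bsub>?F\<^esub> w) x \<odot>\<^bsub>N\<^esub> g x) =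
      (\<Oplus>\<^bsub>N\<^esub>x\<in>s v. v x \<odot>\<^bsub>N\<^esub> g x) \<oplus>\<^bsub>N\<^esub> (\<Oplus>\<^bsub>N\<^esub>x\<in>s w. w x \<odot>\<^bsub>N\<^esub> g x)"
      using v w vw by (simp add: h_def)
  next
    fix a v assume a: "a \<in> carrier R" and v: "v \<in> carrier ?F"
    have av: "a \<odot>\<^bsub>?F\<^esub> v \<in> carrier ?F"
      using a v by (simp add: free_module_smult_closed free_module_simps(4))
    have sv: "s (a \<odot>\<^bsub>?F\<^esub> v) \<subseteq> s v" using a by (auto simp: s_def free_module_simps(4))
    have hom: "(\<Oplus>\<^bsub>N\<^esub>x\<in>T. a \<odot>\<^bsub>N\<^esub> (v x \<odot>\<^bsub>N\<^esub> g x)) = a \<odot>\<^bsub>N\<^esub> (\<Oplus>\<^bsub>N\<^esub>x\<in>T. v x \<odot>\<^bsub>N\<^esub> g x)"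
      if "finite T" "T \<subseteq> X" for T
      using that
    proof (induction T rule: finite_induct)
      case empty
      then show ?case using a by (simp add: N.smult_r_zero)
    next
      case (insert x T)
      then have "(\<lambda>x. v x \<odot>\<^bsub>N\<^esub> g x) \<in> T \<rightarrow> carrier N" using c v by auto
      with insert show ?case using c v a
        by (auto simp: N.smult_closed N.smult_r_distr Pi_def)
    qed
    have "h (a \<odot>\<^bsub>?F\<^esub> v) = (\<Oplus>\<^bsub>N\<^esub>x\<in>s v. (a \<odot>\<^bsub>?F\<^esub> v) x \<odot>\<^bsub>N\<^esub> g x)"
      using h_eq av s[OF v] sv by blast
    also have "\<dots> = (\<Oplus>\<^bsub>N\<^esub>x\<in>s v. a \<odot>\<^bsub>N\<^esub> (v x \<odot>\<^bsub>N\<^esub> g x))"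
      using s[OF v] v g c a
      by (intro N.M.finsum_cong')
        (auto simp: free_module_simps(4) free_module_carrierD subset_eq N.smult_closed intro!: N.smult_assoc)
    also have "\<dots> = a \<odot>\<^bsub>N\<^esub> h v" using hom s[OF v] v by (simp add: h_def)
    finally show "(\<Oplus>\<^bsub>N\<^esub>x\<in>s (a \<odot>\<^bsub>?F\<^esub> v). (a \<odot>\<^bsub>?F\<^esub> v) x \<odot>\<^bsub>N\<^esub> g x) =
        a \<odot>\<^bsub>N\<^esub> (\<Oplus>\<^bsub>N\<^esub>x\<in>s v. v x \<odot>\<^bsub>N\<^esub> g x)"
      using v av by (simp add: h_def)
  qed
  moreover have "h (unit_vector R x) = g x" if x: "x \<in> X" for x
  proof -
    have "h (unit_vector R x) = (\<Oplus>\<^bsub>N\<^esub>y\<in>{x}. unit_vector R x y \<odot>\<^bsub>N\<^esub> g y)"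
      using x unit_vector_closed[OF x] by (intro h_eq) (auto simp: s_def unit_vector_def)
    then show ?thesis using g[OF x] by (simp add: unit_vector_def N.smult_one)
  qed
  ultimately show ?thesis by (rule that)
qed

end

text \<open>As \<^const>\<open>projective_module\<close>, but with the basis in an arbitrary type.\<close>

definition free_retract :: "('a, 'r) ring_scheme \<Rightarrow> 'x set \<Rightarrow> ('a, 'm) module \<Rightarrow> bool" where
  "free_retract A X P \<longleftrightarrow> left_module A P \<and>
     (\<exists>s t. s \<in> module_hom A P (free_module A X) \<and>
        t \<in> module_hom A (free_module A X) P \<and> (\<forall>x\<in>carrier P. t (s x) = x))"

lemma projective_module_free_retract:
  "projective_module A P \<Longrightarrow> \<exists>X :: 'm set. free_retract A X (P :: ('a, 'm) module)"
  by (auto simp: projective_module_def free_retract_def)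

lemma free_module_free_retract:
  assumes "ring A"
  shows "free_retract A X (free_module A X)"
proof -
  interpret ring A by fact
  have "(\<lambda>v\<in>carrier (free_module A X). v) \<in> module_hom A (free_module A X) (free_module A X)"
    by (rule restrict_module_homI[OF left_module_free_module]) auto
  then show ?thesis
    unfolding free_retract_def
    by (intro conjI left_module_free_module exI[of _ "\<lambda>v\<in>carrier (free_module A X). v"]) auto
qed

text \<open>Choose preimages under \<open>q\<close> for the images of the basis, extend to the free
  module and precompose with the section \<open>s\<close>. Only the image of \<open>g\<close> has to
  lie in that of \<open>q\<close>: in the applications \<open>q\<close> is often a differential,
  whose image is known from exactness.\<close>

lemma free_retract_lift:
  assumes P: "free_retract A X P" and N: "left_module A N" and N': "left_module A N'"
    and q: "q \<in> module_hom A N N'" and g: "g \<in> module_hom A P N'"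
    and sub: "\<And>x. x \<in> carrier P \<Longrightarrow> g x \<in> q ` carrier N"
  obtains h where "h \<in> module_hom A P N" and "\<And>x. x \<in> carrier P \<Longrightarrow> q (h x) = g x"
proof -
  from P obtain s t where PM: "left_module A P" and s: "s \<in> module_hom A P (free_module A X)"
    and t: "t \<in> module_hom A (free_module A X) P" and ts: "\<And>x. x \<in> carrier P \<Longrightarrow> t (s x) = x"
    by (auto simp: free_retract_def)
  let ?F = "free_module A X"
  interpret P: left_module A P by fact
  note F = P.left_module_free_module[of X]
  have "\<exists>n. n \<in> carrier N \<and> q n = g (t (unit_vector A x))" if "x \<in> X" for x
    using sub[OF module_homD(2)[OF t P.unit_vector_closed[OF that]]] by auto
  then obtain m where m: "\<And>x. x \<in> X \<Longrightarrow> m x \<in> carrier N \<and> q (m x) = g (t (unit_vector A x))"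
    by metis
  obtain k where k: "k \<in> module_hom A ?F N" and km: "\<And>x. x \<in> X \<Longrightarrow> k (unit_vector A x) = m x"
    using P.free_module_hom_ex[OF N, of X m] m by blast
  let ?h = "\<lambda>x\<in>carrier P. k (s x)"
  have "q (k v) = g (t v)" if v: "v \<in> carrier ?F" for v
  proof -
    have "(\<lambda>x\<in>carrier ?F. q (k x)) v = (\<lambda>x\<in>carrier ?F. g (t x)) v"
      using module_hom_compose[OF F k q] module_hom_compose[OF F t g] N' _ v
    proof (rule P.free_module_hom_eqI)
      fix x assume x: "x \<in> X"
      then show "(\<lambda>x\<in>carrier ?F. q (k x)) (unit_vector A x) = (\<lambda>x\<in>carrier ?F. g (t x)) (unit_vector A x)"
        using P.unit_vector_closed[OF x] m[OF x] km[OF x] by simp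
    qed
    then show ?thesis using v by simp
  qed
  then have "q (?h x) = g x" if "x \<in> carrier P" for x
    using that module_homD(2)[OF s] ts by simp
  then show ?thesis using that[of ?h] module_hom_compose[OF PM s k] by blast
qed

lemma (in abelian_group) a_inv_zero: "\<ominus> \<zero> = \<zero>"
  using r_neg[OF zero_closed] l_zero[OF a_inv_closed[OF zero_closed]] by simp

section \<open>Chain maps into exact complexes\<close>

text \<open>What the target of a lifting must satisfy: a resolution without projectivity. It puts
  the double complex, whose basis consists of natural numbers, on the same footing as the given
  resolution, for which \<open>projective_module\<close> fixes the type of the basis.\<close>

definition exact_augmented ::
    "('a, 'r) ring_scheme \<Rightarrow> ('a, 'n) module \<Rightarrow> (nat \<Rightarrow> ('a, 'm) module) \<Rightarrow>
     (nat \<Rightarrow> 'm \<Rightarrow> 'm) \<Rightarrow> ('m \<Rightarrow> 'n) \<Rightarrow> bool" where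
  "exact_augmented A M D d e \<longleftrightarrow>
     left_module A M \<and> (\<forall>n. left_module A (D n)) \<and>
     (\<forall>n. d n \<in> module_hom A (D (Suc n)) (D n)) \<and>
     e \<in> module_hom A (D 0) M \<and>
     e ` carrier (D 0) = carrier M \<and>
     d 0 ` carrier (D 1) = {x \<in> carrier (D 0). e x = \<zero>\<^bsub>M\<^esub>} \<and>
     (\<forall>n. d (Suc n) ` carrier (D (Suc (Suc n))) = {x \<in> carrier (D (Suc n)). d n x = \<zero>\<^bsub>D n\<^esub>})"

lemma exact_augmentedD:
  assumes "exact_augmented A M D d e"
  shows "left_module A M" "left_module A (D n)" "d n \<in> module_hom A (D (Suc n)) (D n)"
    "e \<in> module_hom A (D 0) M" "e ` carrier (D 0) = carrier M"
    "x \<in> carrier (D 0) \<Longrightarrow> e x = \<zero>\<^bsub>M\<^esub> \<Longrightarrow> x \<in> d 0 ` carrier (D (Suc 0))"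
    "x \<in> carrier (D (Suc n)) \<Longrightarrow> d n x = \<zero>\<^bsub>D n\<^esub> \<Longrightarrow> x \<in> d (Suc n) ` carrier (D (Suc (Suc n)))"
    "y \<in> carrier (D (Suc 0)) \<Longrightarrow> e (d 0 y) = \<zero>\<^bsub>M\<^esub>"
    "z \<in> carrier (D (Suc (Suc n))) \<Longrightarrow> d n (d (Suc n) z) = \<zero>\<^bsub>D n\<^esub>"
proof -
  show "left_module A M" "left_module A (D n)" "d n \<in> module_hom A (D (Suc n)) (D n)"
    "e \<in> module_hom A (D 0) M" "e ` carrier (D 0) = carrier M"
    using assms by (simp_all add: exact_augmented_def)
  have 1: "d 0 ` carrier (D (Suc 0)) = {x \<in> carrier (D 0). e x = \<zero>\<^bsub>M\<^esub>}"
    and 2: "d (Suc n) ` carrier (D (Suc (Suc n))) = {x \<in> carrier (D (Suc n)). d n x = \<zero>\<^bsub>D n\<^esub>}"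
    using assms by (simp_all add: exact_augmented_def)
  show "x \<in> carrier (D 0) \<Longrightarrow> e x = \<zero>\<^bsub>M\<^esub> \<Longrightarrow> x \<in> d 0 ` carrier (D (Suc 0))"
    "y \<in> carrier (D (Suc 0)) \<Longrightarrow> e (d 0 y) = \<zero>\<^bsub>M\<^esub>" using 1 by auto
  show "x \<in> carrier (D (Suc n)) \<Longrightarrow> d n x = \<zero>\<^bsub>D n\<^esub> \<Longrightarrow> x \<in> d (Suc n) ` carrier (D (Suc (Suc n)))"
    "z \<in> carrier (D (Suc (Suc n))) \<Longrightarrow> d n (d (Suc n) z) = \<zero>\<^bsub>D n\<^esub>" using 2 by auto
qed

text \<open>Projectivity is asked of the source and exactness of the target, so the two may live in
  different types. In the dependent choice, \<open>P n h\<close> records that \<open>h\<close> after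
  \<open>b n\<close> lands in the image of \<open>d n\<close>; the next lifting requires precisely
  this, and exactness of the target passes it on.\<close>

lemma chain_map_lift:
  fixes C :: "nat \<Rightarrow> ('a, 'c) module" and D :: "nat \<Rightarrow> ('a, 'm) module" and X :: "nat \<Rightarrow> 'x set"
  assumes D: "exact_augmented A M D d e"
    and C: "\<And>n. free_retract A (X n) (C n)"
    and b: "\<And>n. b n \<in> module_hom A (C (Suc n)) (C n)"
    and bb: "\<And>n x. x \<in> carrier (C (Suc (Suc n))) \<Longrightarrow> b n (b (Suc n) x) = \<zero>\<^bsub>C n\<^esub>"
    and g: "g \<in> module_hom A (C 0) M"
    and gb: "\<And>x. x \<in> carrier (C (Suc 0)) \<Longrightarrow> g (b 0 x) = \<zero>\<^bsub>M\<^esub>"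
  obtains G where "\<And>n. G n \<in> module_hom A (C n) (D n)"
    and "\<And>x. x \<in> carrier (C 0) \<Longrightarrow> e (G 0 x) = g x"
    and "\<And>n x. x \<in> carrier (C (Suc n)) \<Longrightarrow> d n (G (Suc n) x) = G n (b n x)"
proof -
  note D = exact_augmentedD[OF D]
  have CM: "left_module A (C n)" for n using C by (simp add: free_retract_def)
  define P where "P n h \<longleftrightarrow> h \<in> module_hom A (C n) (D n) \<and>
    (\<forall>x\<in>carrier (C (Suc n)). h (b n x) \<in> d n ` carrier (D (Suc n))) \<and>
    (n = 0 \<longrightarrow> (\<forall>x\<in>carrier (C 0). e (h x) = g x))" for n h
  define Q where "Q n h k \<longleftrightarrow> (\<forall>x\<in>carrier (C (Suc n)). d n (k x) = h (b n x))" for n and h k :: "'c \<Rightarrow> 'm"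
  obtain h0 where h0: "h0 \<in> module_hom A (C 0) (D 0)" "\<And>x. x \<in> carrier (C 0) \<Longrightarrow> e (h0 x) = g x"
    using free_retract_lift[OF C D(2) D(1) D(4) g] module_homD(2)[OF g] D(5) by metis
  have "h0 (b 0 x) \<in> d 0 ` carrier (D (Suc 0))" if "x \<in> carrier (C (Suc 0))" for x
    using that h0 gb module_homD(2)[OF b] module_homD(2)[OF h0(1)] by (intro D(6)) auto
  then have P0: "\<exists>h. P 0 h" using h0 by (auto simp: P_def)
  have step: "\<exists>k. P (Suc n) k \<and> Q n h k" if "P n h" for n h
  proof -
    have h: "h \<in> module_hom A (C n) (D n)"
      and hb: "\<And>x. x \<in> carrier (C (Suc n)) \<Longrightarrow> h (b n x) \<in> d n ` carrier (D (Suc n))"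
      using that by (auto simp: P_def)
    define hb' where "hb' = (\<lambda>x\<in>carrier (C (Suc n)). h (b n x))"
    have hom: "hb' \<in> module_hom A (C (Suc n)) (D n)"
      unfolding hb'_def using CM b h by (rule module_hom_compose)
    have hb'_eq: "hb' x = h (b n x)" if "x \<in> carrier (C (Suc n))" for x
      using that by (simp add: hb'_def)
    have sub: "hb' x \<in> d n ` carrier (D (Suc n))" if "x \<in> carrier (C (Suc n))" for x
      using hb[OF that] hb'_eq[OF that] by simp
    obtain k where k: "k \<in> module_hom A (C (Suc n)) (D (Suc n))"
      and dk: "\<And>x. x \<in> carrier (C (Suc n)) \<Longrightarrow> d n (k x) = hb' x"
      using free_retract_lift[OF C D(2) D(2) D(3) hom sub] by blast
    have "k (b (Suc n) x) \<in> d (Suc n) ` carrier (D (Suc (Suc n)))" if x: "x \<in> carrier (C (Suc (Suc n)))" for x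
    proof (rule D(7))
      show "k (b (Suc n) x) \<in> carrier (D (Suc n))"
        using module_homD(2)[OF k] module_homD(2)[OF b] x by blast
      have "d n (k (b (Suc n) x)) = h \<zero>\<^bsub>C n\<^esub>"
        using dk hb'_eq module_homD(2)[OF b x] bb[OF x] by simp
      then show "d n (k (b (Suc n) x)) = \<zero>\<^bsub>D n\<^esub>"
        using module_hom_zero[OF CM D(2) h] by simp
    qed
    then show ?thesis using k dk hb'_eq by (auto simp: P_def Q_def)
  qed
  obtain G where "\<forall>n. P n (G n) \<and> Q n (G n) (G (Suc n))"
    using dependent_nat_choice[of P Q] P0 step by blast
  then show ?thesis by (intro that[of G]) (auto simp: P_def Q_def)
qed

text \<open>Again a dependent choice. The invariant in \<open>P\<close> says that
  \<open>G (Suc n)\<close> minus \<open>h\<close> after \<open>b n\<close> has values in the image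
  of \<open>d (Suc n)\<close>, so that the next component of the homotopy is a lifting of this
  difference.\<close>

lemma null_homotopy:
  fixes C :: "nat \<Rightarrow> ('a, 'c) module" and D :: "nat \<Rightarrow> ('a, 'm) module" and X :: "nat \<Rightarrow> 'x set"
  assumes D: "exact_augmented A M D d e"
    and C: "\<And>n. free_retract A (X n) (C n)"
    and b: "\<And>n. b n \<in> module_hom A (C (Suc n)) (C n)"
    and bb: "\<And>n x. x \<in> carrier (C (Suc (Suc n))) \<Longrightarrow> b n (b (Suc n) x) = \<zero>\<^bsub>C n\<^esub>"
    and G: "\<And>n. G n \<in> module_hom A (C n) (D n)"
    and G0: "\<And>x. x \<in> carrier (C 0) \<Longrightarrow> e (G 0 x) = \<zero>\<^bsub>M\<^esub>"
    and dG: "\<And>n x. x \<in> carrier (C (Suc n)) \<Longrightarrow> d n (G (Suc n) x) = G n (b n x)"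
  obtains h where "\<And>n. h n \<in> module_hom A (C n) (D (Suc n))"
    and "\<And>x. x \<in> carrier (C 0) \<Longrightarrow> G 0 x = d 0 (h 0 x)"
    and "\<And>n x. x \<in> carrier (C (Suc n)) \<Longrightarrow> G (Suc n) x = d (Suc n) (h (Suc n) x) \<oplus>\<^bsub>D (Suc n)\<^esub> h n (b n x)"
proof -
  note D = exact_augmentedD[OF D]
  have CM: "left_module A (C n)" for n using C by (simp add: free_retract_def)
  note b' = module_homD(2)[OF b] and G' = module_homD(2)[OF G] and d' = module_homD(2)[OF D(3)]
  define P where "P n h \<longleftrightarrow> h \<in> module_hom A (C n) (D (Suc n)) \<and>
    (\<forall>x\<in>carrier (C (Suc n)). G (Suc n) x \<ominus>\<^bsub>D (Suc n)\<^esub> h (b n x) \<in> d (Suc n) ` carrier (D (Suc (Suc n)))) \<and>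
    (n = 0 \<longrightarrow> (\<forall>x\<in>carrier (C 0). d 0 (h x) = G 0 x))" for n h
  define Q where "Q n h k \<longleftrightarrow> (\<forall>x\<in>carrier (C (Suc n)).
    d (Suc n) (k x) = G (Suc n) x \<ominus>\<^bsub>D (Suc n)\<^esub> h (b n x))" for n and h k :: "'c \<Rightarrow> 'm"
  have ab: "abelian_group (D n)" for n using D(2) by (rule left_module_abelian_group)
  obtain h0 where h0: "h0 \<in> module_hom A (C 0) (D (Suc 0))" "\<And>x. x \<in> carrier (C 0) \<Longrightarrow> d 0 (h0 x) = G 0 x"
    using free_retract_lift[OF C D(2) D(2) D(3) G] D(6)[OF G' G0] by metis
  have "G (Suc 0) x \<ominus>\<^bsub>D (Suc 0)\<^esub> h0 (b 0 x) \<in> d (Suc 0) ` carrier (D (Suc (Suc 0)))"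
    if x: "x \<in> carrier (C (Suc 0))" for x
  proof (rule D(7))
    interpret D0: abelian_group "D 0" by (rule ab)
    interpret D1: abelian_group "D (Suc 0)" by (rule ab)
    have hc: "h0 (b 0 x) \<in> carrier (D (Suc 0))" using module_homD(2)[OF h0(1)] b' x by blast
    show "G (Suc 0) x \<ominus>\<^bsub>D (Suc 0)\<^esub> h0 (b 0 x) \<in> carrier (D (Suc 0))" using hc G' x by simp
    have "d 0 (G (Suc 0) x \<ominus>\<^bsub>D (Suc 0)\<^esub> h0 (b 0 x)) = G 0 (b 0 x) \<ominus>\<^bsub>D 0\<^esub> G 0 (b 0 x)"
      using module_hom_minus[OF D(2) D(2) D(3) G' hc] x dG h0(2) b' by simp
    then show "d 0 (G (Suc 0) x \<ominus>\<^bsub>D (Suc 0)\<^esub> h0 (b 0 x)) = \<zero>\<^bsub>D 0\<^esub>"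
      using G' b' x by (simp add: D0.minus_eq D0.r_neg)
  qed
  then have P0: "\<exists>h. P 0 h" using h0 by (auto simp: P_def)
  have step: "\<exists>k. P (Suc n) k \<and> Q n h k" if "P n h" for n h
  proof -
    have h: "h \<in> module_hom A (C n) (D (Suc n))"
      and hb: "\<And>x. x \<in> carrier (C (Suc n)) \<Longrightarrow>
        G (Suc n) x \<ominus>\<^bsub>D (Suc n)\<^esub> h (b n x) \<in> d (Suc n) ` carrier (D (Suc (Suc n)))"
      using that by (auto simp: P_def)
    define F where "F = (\<lambda>x\<in>carrier (C (Suc n)).
      G (Suc n) x \<ominus>\<^bsub>D (Suc n)\<^esub> (\<lambda>x\<in>carrier (C (Suc n)). h (b n x)) x)"
    have F: "F \<in> module_hom A (C (Suc n)) (D (Suc n))"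
      unfolding F_def using CM D(2) G module_hom_compose[OF CM b h] by (rule module_hom_diff)
    have Fx: "F x = G (Suc n) x \<ominus>\<^bsub>D (Suc n)\<^esub> h (b n x)" if "x \<in> carrier (C (Suc n))" for x
      using that by (simp add: F_def)
    obtain k where k: "k \<in> module_hom A (C (Suc n)) (D (Suc (Suc n)))"
      and dk: "\<And>x. x \<in> carrier (C (Suc n)) \<Longrightarrow> d (Suc n) (k x) = F x"
      using free_retract_lift[OF C D(2) D(2) D(3) F] hb Fx by metis
    have "G (Suc (Suc n)) x \<ominus>\<^bsub>D (Suc (Suc n))\<^esub> k (b (Suc n) x) \<in> d (Suc (Suc n)) ` carrier (D (Suc (Suc (Suc n))))"
      if x: "x \<in> carrier (C (Suc (Suc n)))" for x
    proof (rule D(7))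
      interpret D1: abelian_group "D (Suc n)" by (rule ab)
      interpret D2: abelian_group "D (Suc (Suc n))" by (rule ab)
      have kc: "k (b (Suc n) x) \<in> carrier (D (Suc (Suc n)))"
        using module_homD(2)[OF k] b' x by blast
      show "G (Suc (Suc n)) x \<ominus>\<^bsub>D (Suc (Suc n))\<^esub> k (b (Suc n) x) \<in> carrier (D (Suc (Suc n)))"
        using kc G' x by simp
      \<comment> \<open>The previous stage rewrites \<open>d (Suc n)\<close> after \<open>k\<close>
        as \<open>G (Suc n)\<close> minus \<open>h\<close> after \<open>b n\<close>; applied to a
        boundary, the second part becomes \<open>h\<close> of zero, and the difference is a
        cycle.\<close>
      have "d (Suc n) (G (Suc (Suc n)) x \<ominus>\<^bsub>D (Suc (Suc n))\<^esub> k (b (Suc n) x)) =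
        G (Suc n) (b (Suc n) x) \<ominus>\<^bsub>D (Suc n)\<^esub> (G (Suc n) (b (Suc n) x) \<ominus>\<^bsub>D (Suc n)\<^esub> h \<zero>\<^bsub>C n\<^esub>)"
        using module_hom_minus[OF D(2) D(2) D(3) G' kc] x dG dk b' Fx bb by simp
      also have "\<dots> = \<zero>\<^bsub>D (Suc n)\<^esub>"
        using G' b' x module_hom_zero[OF CM D(2) h] by (simp add: D1.minus_eq D1.r_neg D1.a_inv_zero)
      finally show "d (Suc n) (G (Suc (Suc n)) x \<ominus>\<^bsub>D (Suc (Suc n))\<^esub> k (b (Suc n) x)) = \<zero>\<^bsub>D (Suc n)\<^esub>" .
    qed
    then show ?thesis using k dk Fx by (auto simp: P_def Q_def)
  qed
  obtain h where h: "\<forall>n. P n (h n) \<and> Q n (h n) (h (Suc n))"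
    using dependent_nat_choice[of P Q] P0 step by blast
  then have hom: "h n \<in> module_hom A (C n) (D (Suc n))" for n by (auto simp: P_def)
  show ?thesis
  proof (rule that[OF hom])
    show "G 0 x = d 0 (h 0 x)" if "x \<in> carrier (C 0)" for x
      using h that by (metis P_def)
  next
    fix n x assume x: "x \<in> carrier (C (Suc n))"
    interpret D1: abelian_group "D (Suc n)" by (rule ab)
    have hc: "h n (b n x) \<in> carrier (D (Suc n))" using module_homD(2)[OF hom] b' x by blast
    have "d (Suc n) (h (Suc n) x) = G (Suc n) x \<ominus>\<^bsub>D (Suc n)\<^esub> h n (b n x)"
      using h x by (auto simp: Q_def)
    then show "G (Suc n) x = d (Suc n) (h (Suc n) x) \<oplus>\<^bsub>D (Suc n)\<^esub> h n (b n x)"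
      using hc G' x by (simp add: D1.minus_eq D1.a_assoc D1.l_neg)
  qed
qed


section \<open>The algebra of self-extensions\<close>

locale ext_setting =
  fixes A :: "('a, 'r) ring_scheme" and M :: "('a, 'n) module" and P :: "nat \<Rightarrow> ('a, 'm) module"
    and d :: "nat \<Rightarrow> 'm \<Rightarrow> 'm" and e :: "'m \<Rightarrow> 'n"
  assumes M: "left_module A M" and resolution: "projective_resolution A M P d e"
begin

lemma P_free_retract: "\<exists>X :: 'm set. free_retract A X (P n)"
  using resolution by (auto simp: projective_resolution_def intro: projective_module_free_retract)

definition basis :: "nat \<Rightarrow> 'm set" where
  "basis n = (SOME X. free_retract A X (P n))"

lemma free_retract_basis: "free_retract A (basis n) (P n)"
  unfolding basis_def using P_free_retract by (rule someI_ex)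

lemma P_left_module: "left_module A (P n)"
  using free_retract_basis by (simp add: free_retract_def)

lemma P_exact: "exact_augmented A M P d e"
  using resolution M P_left_module by (simp add: projective_resolution_def exact_augmented_def)

lemmas P_exactD = exact_augmentedD[OF P_exact]

section \<open>Cocycles, coboundaries and the groups of extensions\<close>

abbreviation "Z \<equiv> cocycles A M P d"
abbreviation "B \<equiv> coboundaries A M P d"
abbreviation "cls \<equiv> cohomology_class A M P d"
abbreviation "add_cochain n f g \<equiv> \<lambda>x\<in>carrier (P n). f x \<oplus>\<^bsub>M\<^esub> g x"
abbreviation "zero_cochain n \<equiv> \<lambda>x\<in>carrier (P n). \<zero>\<^bsub>M\<^esub>"

sublocale M: left_module A M by (rule M)

lemma zero_cochain_hom: "zero_cochain n \<in> module_hom A (P n) M"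
  by (rule restrict_module_homI[OF P_left_module]) (auto simp: M.smult_r_zero)

lemma cocyclesD:
  assumes "f \<in> Z n"
  shows "f \<in> module_hom A (P n) M" "x \<in> carrier (P (Suc n)) \<Longrightarrow> f (d n x) = \<zero>\<^bsub>M\<^esub>"
  using assms by (auto simp: cocycles_def)

lemma d_closed: "x \<in> carrier (P (Suc n)) \<Longrightarrow> d n x \<in> carrier (P n)"
  using module_homD(2)[OF P_exactD(3)] by blast

lemma zero_cocycle: "zero_cochain n \<in> Z n"
  using zero_cochain_hom by (simp add: cocycles_def d_closed)

lemma coboundary_SucI:
  assumes "g \<in> module_hom A (P n) M" "f \<in> extensional (carrier (P (Suc n)))"
    "\<And>x. x \<in> carrier (P (Suc n)) \<Longrightarrow> f x = g (d n x)"
  shows "f \<in> B (Suc n)"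
proof -
  have "f = (\<lambda>x\<in>carrier (P (Suc n)). g (d n x))"
    using assms(2,3) by (intro extensionalityI) auto
  then show ?thesis using assms(1) by (auto simp: coboundaries_def)
qed

lemma zero_coboundary: "zero_cochain n \<in> B n"
proof (cases n)
  case (Suc m)
  show ?thesis unfolding Suc
    by (rule coboundary_SucI[OF zero_cochain_hom]) (simp_all add: d_closed)
qed (simp add: coboundaries_def)

lemma coboundary_SucE:
  assumes "f \<in> B (Suc n)"
  obtains g where "g \<in> module_hom A (P n) M" "\<And>x. x \<in> carrier (P (Suc n)) \<Longrightarrow> f x = g (d n x)"
  using assms by (auto simp: coboundaries_def)

lemma coboundary_0: "f \<in> B 0 \<longleftrightarrow> f = zero_cochain 0"
  by (simp add: coboundaries_def)

lemma coboundary_cocycle: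
  assumes "f \<in> B n"
  shows "f \<in> Z n"
proof (cases n)
  case 0
  then show ?thesis using assms zero_cocycle by (simp add: coboundary_0)
next
  case (Suc m)
  from assms obtain g where g: "g \<in> module_hom A (P m) M"
    and f: "f = (\<lambda>x\<in>carrier (P (Suc m)). g (d m x))"
    unfolding Suc by (auto simp: coboundaries_def)
  have "f \<in> module_hom A (P (Suc m)) M"
    unfolding f using P_left_module P_exactD(3) g by (rule module_hom_compose)
  moreover have "f (d (Suc m) x) = \<zero>\<^bsub>M\<^esub>" if "x \<in> carrier (P (Suc (Suc m)))" for x
    using that P_exactD(9)[OF that] module_hom_zero[OF P_left_module M g] by (simp add: f d_closed)
  ultimately show ?thesis unfolding Suc by (simp add: cocycles_def)
qed

lemma add_cocycle:
  assumes "f \<in> Z n" "g \<in> Z n"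
  shows "add_cochain n f g \<in> Z n"
  using module_hom_add[OF P_left_module M cocyclesD(1)[OF assms(1)] cocyclesD(1)[OF assms(2)]]
    cocyclesD(2)[OF assms(1)] cocyclesD(2)[OF assms(2)]
  by (simp add: cocycles_def d_closed)

lemma add_coboundary:
  assumes "f \<in> B n" "g \<in> B n"
  shows "add_cochain n f g \<in> B n"
proof (cases n)
  case 0
  have "add_cochain 0 (zero_cochain 0) (zero_cochain 0) = zero_cochain 0"
    by (intro restrict_ext) simp
  then show ?thesis using assms 0 by (simp add: coboundary_0)
next
  case (Suc m)
  from assms obtain f' g' where f': "f' \<in> module_hom A (P m) M" and g': "g' \<in> module_hom A (P m) M"
    and "\<And>x. x \<in> carrier (P (Suc m)) \<Longrightarrow> f x = f' (d m x)"
    and "\<And>x. x \<in> carrier (P (Suc m)) \<Longrightarrow> g x = g' (d m x)"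
    unfolding Suc by (metis coboundary_SucE)
  then show ?thesis unfolding Suc
    by (intro coboundary_SucI[OF module_hom_add[OF P_left_module M f' g']]) (auto simp: d_closed)
qed

lemma neg_coboundary:
  assumes "f \<in> B n"
  shows "(\<lambda>x\<in>carrier (P n). \<ominus>\<^bsub>M\<^esub> f x) \<in> B n"
proof (cases n)
  case 0
  have "(\<lambda>x\<in>carrier (P 0). \<ominus>\<^bsub>M\<^esub> zero_cochain 0 x) = zero_cochain 0"
    by (intro restrict_ext) simp
  then show ?thesis using assms 0 by (simp add: coboundary_0)
next
  case (Suc m)
  from assms obtain f' where f': "f' \<in> module_hom A (P m) M"
    and "\<And>x. x \<in> carrier (P (Suc m)) \<Longrightarrow> f x = f' (d m x)"
    unfolding Suc by (metis coboundary_SucE)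
  then show ?thesis unfolding Suc
    using module_homD(2)[OF f']
    by (intro coboundary_SucI[OF module_hom_diff[OF P_left_module M zero_cochain_hom f']])
      (auto simp: d_closed M.M.minus_eq)
qed

lemma cocycle_closed: "f \<in> Z n \<Longrightarrow> x \<in> carrier (P n) \<Longrightarrow> f x \<in> carrier M"
  using module_homD(2)[OF cocyclesD(1)] by blast

lemma cocycle_extensional: "f \<in> Z n \<Longrightarrow> f \<in> extensional (carrier (P n))"
  using module_homD(1)[OF cocyclesD(1)] by blast

lemma neg_cocycle:
  assumes "f \<in> Z n"
  shows "(\<lambda>x\<in>carrier (P n). \<ominus>\<^bsub>M\<^esub> f x) \<in> Z n"
proof -
  have "(\<lambda>x\<in>carrier (P n). \<ominus>\<^bsub>M\<^esub> f x) = (\<lambda>x\<in>carrier (P n). zero_cochain n x \<ominus>\<^bsub>M\<^esub> f x)"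
    using cocycle_closed[OF assms] by (intro restrict_ext) (simp add: M.M.minus_eq)
  also have "\<dots> \<in> module_hom A (P n) M"
    using P_left_module M zero_cochain_hom cocyclesD(1)[OF assms] by (rule module_hom_diff)
  finally show ?thesis
    using cocyclesD(2)[OF assms] by (simp add: cocycles_def d_closed)
qed

lemma cocycle_comm_group: "comm_group (cocycle_group A M P d n)"
proof (rule comm_groupI)
  fix f assume f: "f \<in> carrier (cocycle_group A M P d n)"
  then have f': "f \<in> Z n" by (simp add: cocycle_group_def)
  show "\<one>\<^bsub>cocycle_group A M P d n\<^esub> \<otimes>\<^bsub>cocycle_group A M P d n\<^esub> f = f"
    using cocycle_closed[OF f'] cocycle_extensional[OF f']
    by (auto simp: cocycle_group_def extensional_def fun_eq_iff)
  show "\<exists>g\<in>carrier (cocycle_group A M P d n).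
      g \<otimes>\<^bsub>cocycle_group A M P d n\<^esub> f = \<one>\<^bsub>cocycle_group A M P d n\<^esub>"
    using neg_cocycle[OF f'] cocycle_closed[OF f']
    by (intro bexI[of _ "\<lambda>x\<in>carrier (P n). \<ominus>\<^bsub>M\<^esub> f x"])
      (auto simp: cocycle_group_def fun_eq_iff M.M.l_neg)
qed (auto simp: cocycle_group_def add_cocycle zero_cocycle cocycle_closed fun_eq_iff M.M.a_ac)

sublocale cg: comm_group "cocycle_group A M P d n" for n
  by (rule cocycle_comm_group)

lemma coboundaries_normal: "B n \<lhd> cocycle_group A M P d n"
proof -
  have "subgroup (B n) (cocycle_group A M P d n)"
  proof (rule cg.subgroupI)
    show "B n \<subseteq> carrier (cocycle_group A M P d n)"
      using coboundary_cocycle by (auto simp: cocycle_group_def)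
    show "B n \<noteq> {}" using zero_coboundary by blast
  next
    fix f assume f: "f \<in> B n"
    then have f': "f \<in> Z n" by (rule coboundary_cocycle)
    have "inv\<^bsub>cocycle_group A M P d n\<^esub> f = (\<lambda>x\<in>carrier (P n). \<ominus>\<^bsub>M\<^esub> f x)"
      using f' neg_cocycle[OF f'] cocycle_closed[OF f']
      by (intro cg.inv_equality) (auto simp: cocycle_group_def fun_eq_iff M.M.l_neg)
    then show "inv\<^bsub>cocycle_group A M P d n\<^esub> f \<in> B n" using neg_coboundary[OF f] by simp
  next
    fix f g assume "f \<in> B n" "g \<in> B n"
    then show "f \<otimes>\<^bsub>cocycle_group A M P d n\<^esub> g \<in> B n"
      using add_coboundary by (simp add: cocycle_group_def)
  qed
  then show ?thesis by (simp add: cg.normal_iff_subgroup)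
qed

lemma ext_comm_group: "comm_group (ext_group A M P d n)"
  unfolding ext_group_def using cg.abelian_FactGroup coboundaries_normal
  by (simp add: normal_imp_subgroup)

lemma ext_group_carrier: "carrier (ext_group A M P d n) = cls n ` Z n"
  by (simp add: ext_group_def carrier_FactGroup cohomology_class_def cocycle_group_def)

lemma ext_group_one: "\<one>\<^bsub>ext_group A M P d n\<^esub> = cls n (zero_cochain n)"
proof -
  have "B n #>\<^bsub>cocycle_group A M P d n\<^esub> \<one>\<^bsub>cocycle_group A M P d n\<^esub> = B n"
    using coboundary_cocycle
    by (intro cg.coset_mult_one) (auto simp: cocycle_group_def)
  then show ?thesis by (simp add: ext_group_def cohomology_class_def cocycle_group_def)
qed

lemma ext_group_mult:
  assumes "f \<in> Z n" "g \<in> Z n"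
  shows "cls n f \<otimes>\<^bsub>ext_group A M P d n\<^esub> cls n g = cls n (add_cochain n f g)"
  using normal.rcos_sum[OF coboundaries_normal, of f n g] assms
  by (simp add: ext_group_def cohomology_class_def cocycle_group_def)

lemma mem_cls_iff: "f' \<in> cls n f \<longleftrightarrow> (\<exists>b\<in>B n. f' = add_cochain n b f)"
  by (auto simp: cohomology_class_def r_coset_def cocycle_group_def)

lemma cls_eqI:
  assumes "g \<in> Z n" "f \<in> extensional (carrier (P n))" "b \<in> B n"
    and "\<And>x. x \<in> carrier (P n) \<Longrightarrow> f x = b x \<oplus>\<^bsub>M\<^esub> g x"
  shows "cls n f = cls n g"
proof -
  let ?G = "cocycle_group A M P d n"
  have f: "f = b \<otimes>\<^bsub>?G\<^esub> g"
    using assms(2,4) by (auto simp: cocycle_group_def extensional_def fun_eq_iff)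
  have sub: "B n \<subseteq> carrier ?G" and b: "b \<in> carrier ?G" and g: "g \<in> carrier ?G"
    using coboundary_cocycle assms by (auto simp: cocycle_group_def)
  have "B n #>\<^bsub>?G\<^esub> b = B n"
    using b coboundaries_normal normal_imp_subgroup assms(3) by (intro cg.coset_join2) auto
  then show ?thesis
    using cg.coset_mult_assoc[OF sub b g] by (simp add: cohomology_class_def f)
qed

lemma cls_eq_diffI:
  assumes f: "f \<in> Z n" and g: "g \<in> Z n"
    and diff: "(\<lambda>x\<in>carrier (P n). f x \<ominus>\<^bsub>M\<^esub> g x) \<in> B n"
  shows "cls n f = cls n g"
  using g cocycle_extensional[OF f] diff
proof (rule cls_eqI)
  fix x assume "x \<in> carrier (P n)"
  then show "f x = (\<lambda>x\<in>carrier (P n). f x \<ominus>\<^bsub>M\<^esub> g x) x \<oplus>\<^bsub>M\<^esub> g x"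
    using cocycle_closed[OF f] cocycle_closed[OF g] by (simp add: M.M.minus_eq M.M.a_assoc M.M.l_neg)
qed


text \<open>A null-homotopy writes \<open>G m\<close> as a boundary of \<open>D\<close> plus
  \<open>h (m - 1)\<close> after the differential. The boundary is killed by \<open>f\<close>, so
  \<open>f\<close> after \<open>G m\<close> is the coboundary of \<open>f\<close> after
  \<open>h (m - 1)\<close>, or zero if \<open>m = 0\<close>. The target \<open>D\<close> is general
  because it will be the given resolution as well as the double complex.\<close>

lemma null_chain_map_coboundary_aux:
  assumes D: "exact_augmented A M D \<delta> \<epsilon>"
    and f: "f \<in> module_hom A (D m) M" and fd: "\<And>x. x \<in> carrier (D (Suc m)) \<Longrightarrow> f (\<delta> m x) = \<zero>\<^bsub>M\<^esub>"
    and G: "\<And>i. G i \<in> module_hom A (P (n + i)) (D i)"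
    and dG: "\<And>i x. x \<in> carrier (P (n + Suc i)) \<Longrightarrow> \<delta> i (G (Suc i) x) = G i (d (n + i) x)"
    and G0: "\<And>x. x \<in> carrier (P n) \<Longrightarrow> \<epsilon> (G 0 x) = \<zero>\<^bsub>M\<^esub>"
  shows "(\<lambda>x\<in>carrier (P (n + m)). f (G m x)) \<in> B (n + m)"
proof -
  note D' = exact_augmentedD[OF D]
  have ret: "free_retract A (basis (n + i)) (P (n + i))" for i by (rule free_retract_basis)
  obtain h where h: "\<And>i. h i \<in> module_hom A (P (n + i)) (D (Suc i))"
    and h0: "\<And>x. x \<in> carrier (P n) \<Longrightarrow> G 0 x = \<delta> 0 (h 0 x)"
    and hS: "\<And>i x. x \<in> carrier (P (Suc (n + i))) \<Longrightarrow>
      G (Suc i) x = \<delta> (Suc i) (h (Suc i) x) \<oplus>\<^bsub>D (Suc i)\<^esub> h i (d (n + i) x)"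
    using null_homotopy[of A M D \<delta> \<epsilon> "\<lambda>i. basis (n + i)" "\<lambda>i. P (n + i)" "\<lambda>i. d (n + i)" G, OF D ret]
      P_exactD(3) P_exactD(9) G dG G0 by auto
  show ?thesis
  proof (cases m)
    case 0
    have "(\<lambda>x\<in>carrier (P n). f (G 0 x)) = zero_cochain n"
      using h0 fd module_homD(2)[OF h[of 0]] 0 by (intro restrict_ext) simp
    then show ?thesis using zero_coboundary 0 by simp
  next
    case (Suc k)
    have hk: "h k \<in> module_hom A (P (n + k)) (D m)" using h Suc by simp
    have "(\<lambda>x\<in>carrier (P (Suc (n + k))). f (G (Suc k) x)) \<in> B (Suc (n + k))"
    proof (rule coboundary_SucI[OF module_hom_compose[OF P_left_module hk f]])
      fix x assume x: "x \<in> carrier (P (Suc (n + k)))"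
      have hx: "h (Suc k) x \<in> carrier (D (Suc m))" using module_homD(2)[OF h[of "Suc k"]] x Suc by simp
      have "f (G (Suc k) x) = f (\<delta> m (h (Suc k) x) \<oplus>\<^bsub>D m\<^esub> h k (d (n + k) x))"
        using hS[OF x] Suc by simp
      also have "\<dots> = f (\<delta> m (h (Suc k) x)) \<oplus>\<^bsub>M\<^esub> f (h k (d (n + k) x))"
        using module_homD(2)[OF D'(3) hx] module_homD(2)[OF hk d_closed[OF x]]
        by (rule module_homD(3)[OF f])
      also have "\<dots> = f (h k (d (n + k) x))"
        using fd[OF hx] module_homD(2)[OF f module_homD(2)[OF hk d_closed[OF x]]] by simp
      finally show "(\<lambda>x\<in>carrier (P (Suc (n + k))). f (G (Suc k) x)) x =
          (\<lambda>x\<in>carrier (P (n + k)). f (h k x)) (d (n + k) x)"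
        using x d_closed by simp
    qed simp
    then show ?thesis using Suc by simp
  qed
qed

text \<open>If the map covered by \<open>G\<close> is the coboundary of \<open>c\<close>, lift
  \<open>c\<close> through \<epsilon> to \<open>c'\<close> and subtract \<open>c'\<close> after the
  differential from \<open>G 0\<close> alone. The result is still a chain map because the
  differential squares to zero, and it covers zero. For \<open>m > 0\<close> the component
  \<open>G m\<close> is unchanged; for \<open>m = 0\<close> the composite changes by a
  coboundary.\<close>

lemma null_chain_map_coboundary:
  assumes D: "exact_augmented A M D \<delta> \<epsilon>"
    and f: "f \<in> module_hom A (D m) M" and fd: "\<And>x. x \<in> carrier (D (Suc m)) \<Longrightarrow> f (\<delta> m x) = \<zero>\<^bsub>M\<^esub>"
    and G: "\<And>i. G i \<in> module_hom A (P (n + i)) (D i)"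
    and dG: "\<And>i x. x \<in> carrier (P (n + Suc i)) \<Longrightarrow> \<delta> i (G (Suc i) x) = G i (d (n + i) x)"
    and G0: "(\<lambda>x\<in>carrier (P n). \<epsilon> (G 0 x)) \<in> B n"
  shows "(\<lambda>x\<in>carrier (P (n + m)). f (G m x)) \<in> B (n + m)"
proof (cases n)
  case 0
  then have "(\<lambda>x\<in>carrier (P 0). \<epsilon> (G 0 x)) = zero_cochain 0" using G0 by (simp add: coboundary_0)
  then have "\<epsilon> (G 0 x) = \<zero>\<^bsub>M\<^esub>" if "x \<in> carrier (P n)" for x
    using that 0 by (metis restrict_apply')
  with D f fd G dG show ?thesis by (rule null_chain_map_coboundary_aux)
next
  case (Suc k)
  note D' = exact_augmentedD[OF D]
  interpret D0: left_module A "D 0" by (rule D'(2))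
  have G0h: "G 0 \<in> module_hom A (P (Suc k)) (D 0)" using G[of 0] Suc by simp
  obtain c where c: "c \<in> module_hom A (P k) M"
    and cd: "\<And>x. x \<in> carrier (P (Suc k)) \<Longrightarrow> (\<lambda>x\<in>carrier (P (Suc k)). \<epsilon> (G 0 x)) x = c (d k x)"
    using G0 unfolding Suc by (metis coboundary_SucE)
  have "c x \<in> \<epsilon> ` carrier (D 0)" if "x \<in> carrier (P k)" for x
    using module_homD(2)[OF c that] D'(5) by simp
  then obtain c' where c': "c' \<in> module_hom A (P k) (D 0)"
    and cc': "\<And>x. x \<in> carrier (P k) \<Longrightarrow> \<epsilon> (c' x) = c x"
    using free_retract_lift[OF free_retract_basis D'(2) M D'(4) c] by blast
  define b where "b = (\<lambda>x\<in>carrier (P (Suc k)). c' (d k x))"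
  have b: "b \<in> module_hom A (P (Suc k)) (D 0)"
    unfolding b_def using P_left_module P_exactD(3) c' by (rule module_hom_compose)
  define K where "K = (\<lambda>x\<in>carrier (P (Suc k)). G 0 x \<ominus>\<^bsub>D 0\<^esub> b x)"
  have K: "K \<in> module_hom A (P (Suc k)) (D 0)"
    unfolding K_def using P_left_module D'(2) G0h b by (rule module_hom_diff)
  define H where "H i = (case i of 0 \<Rightarrow> K | Suc j \<Rightarrow> G i)" for i
  have bd: "b (d (Suc k) x) = \<zero>\<^bsub>D 0\<^esub>" if "x \<in> carrier (P (Suc (Suc k)))" for x
    using that d_closed P_exactD(9)[OF that] module_hom_zero[OF P_left_module D'(2) c'] by (simp add: b_def)
  have main: "(\<lambda>x\<in>carrier (P (n + m)). f (H m x)) \<in> B (n + m)"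
    using D f fd
  proof (rule null_chain_map_coboundary_aux)
    show "H i \<in> module_hom A (P (n + i)) (D i)" for i
      using K G[of "i"] Suc by (cases i) (auto simp: H_def)
    show "\<delta> i (H (Suc i) x) = H i (d (n + i) x)" if x: "x \<in> carrier (P (n + Suc i))" for i x
    proof (cases i)
      case 0
      then show ?thesis
        using x dG[of x 0] Suc bd d_closed module_homD(2)[OF G0h]
        by (simp add: H_def K_def D0.M.minus_eq D0.M.a_inv_zero)
    next
      case (Suc j)
      then show ?thesis using x dG[of x i] by (simp add: H_def)
    qed
    show "\<epsilon> (H 0 x) = \<zero>\<^bsub>M\<^esub>" if "x \<in> carrier (P n)" for x
    proof -
      have x: "x \<in> carrier (P (Suc k))" using that Suc by simp
      have "\<epsilon> (H 0 x) = \<epsilon> (G 0 x) \<ominus>\<^bsub>M\<^esub> \<epsilon> (b x)"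
        using module_hom_minus[OF D'(2) M D'(4) module_homD(2)[OF G0h x] module_homD(2)[OF b x]] x
        by (simp add: H_def K_def)
      also have "\<epsilon> (b x) = \<epsilon> (G 0 x)" using x cd[OF x] cc' d_closed by (simp add: b_def)
      finally show ?thesis
        using module_homD(2)[OF D'(4) module_homD(2)[OF G0h x]] by (simp add: M.M.minus_eq M.M.r_neg)
    qed
  qed
  show ?thesis
  proof (cases m)
    case 0
    have f0: "f \<in> module_hom A (D 0) M" using f 0 by simp
    have "(\<lambda>x\<in>carrier (P (Suc k)). f (b x)) \<in> B (Suc k)"
      by (rule coboundary_SucI[OF module_hom_compose[OF P_left_module c' f0]])
        (auto simp: b_def d_closed)
    moreover have "(\<lambda>x\<in>carrier (P (Suc k)). f (K x)) \<in> B (Suc k)"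
      using main 0 Suc by (simp add: H_def)
    ultimately have "add_cochain (Suc k) (\<lambda>x\<in>carrier (P (Suc k)). f (K x))
        (\<lambda>x\<in>carrier (P (Suc k)). f (b x)) \<in> B (Suc k)"
      by (intro add_coboundary)
    moreover have "add_cochain (Suc k) (\<lambda>x\<in>carrier (P (Suc k)). f (K x))
        (\<lambda>x\<in>carrier (P (Suc k)). f (b x)) = (\<lambda>x\<in>carrier (P (Suc k)). f (G 0 x))"
    proof (intro restrict_ext)
      fix x assume x: "x \<in> carrier (P (Suc k))"
      have "G 0 x = K x \<oplus>\<^bsub>D 0\<^esub> b x"
        using x module_homD(2)[OF G0h x] module_homD(2)[OF b x]
        by (simp add: K_def D0.M.minus_eq D0.M.a_assoc D0.M.l_neg)
      then show "(\<lambda>x\<in>carrier (P (Suc k)). f (K x)) x \<oplus>\<^bsub>M\<^esub> (\<lambda>x\<in>carrier (P (Suc k)). f (b x)) x = f (G 0 x)"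
        using module_homD(3)[OF f0 module_homD(2)[OF K x] module_homD(2)[OF b x]] x by simp
    qed
    ultimately show ?thesis using 0 Suc by simp
  next
    case (Suc j)
    then show ?thesis using main by (simp add: H_def)
  qed
qed

section \<open>Lifts of cocycles and the Yoneda product\<close>

lemma liftsD:
  assumes "G \<in> lifts A P d e n g"
  shows "G i \<in> module_hom A (P (n + i)) (P i)"
    "x \<in> carrier (P n) \<Longrightarrow> e (G 0 x) = g x"
    "x \<in> carrier (P (n + Suc i)) \<Longrightarrow> d i (G (Suc i) x) = G i (d (n + i) x)"
  using assms by (auto simp: lifts_def)

lemma lifts_ex:
  assumes "g \<in> Z n"
  obtains G where "G \<in> lifts A P d e n g"
proof -
  have ret: "free_retract A (basis (n + i)) (P (n + i))" for i by (rule free_retract_basis)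
  obtain G where "\<And>i. G i \<in> module_hom A (P (n + i)) (P i)"
    and "\<And>x. x \<in> carrier (P n) \<Longrightarrow> e (G 0 x) = g x"
    and "\<And>i x. x \<in> carrier (P (Suc (n + i))) \<Longrightarrow> d i (G (Suc i) x) = G i (d (n + i) x)"
    using chain_map_lift[of A M P d e "\<lambda>i. basis (n + i)" "\<lambda>i. P (n + i)" "\<lambda>i. d (n + i)" g, OF P_exact ret]
      P_exactD(3) P_exactD(9) cocyclesD[OF assms] by auto
  then show ?thesis using that[of G] by (simp add: lifts_def)
qed

lemma lift_compose_cocycle:
  assumes f: "f \<in> Z m" and G: "G \<in> lifts A P d e n g"
  shows "compose (carrier (P (n + m))) f (G m) \<in> Z (n + m)"
proof -
  have "(\<lambda>x\<in>carrier (P (n + m)). f (G m x)) \<in> module_hom A (P (n + m)) M"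
    using P_left_module liftsD(1)[OF G] cocyclesD(1)[OF f] by (rule module_hom_compose)
  moreover have "f (G m (d (n + m) x)) = \<zero>\<^bsub>M\<^esub>" if "x \<in> carrier (P (Suc (n + m)))" for x
    using liftsD(3)[OF G, of x m] that cocyclesD(2)[OF f] module_homD(2)[OF liftsD(1)[OF G, of "Suc m"]]
    by (metis add_Suc_right)
  ultimately show ?thesis by (simp add: compose_def cocycles_def d_closed)
qed

lemma lift_compose_coboundary:
  assumes f: "f \<in> B m" and G: "G \<in> lifts A P d e n g"
  shows "compose (carrier (P (n + m))) f (G m) \<in> B (n + m)"
proof (cases m)
  case 0
  have "compose (carrier (P (n + m))) f (G m) = zero_cochain (n + m)"
    unfolding compose_def using f module_homD(2)[OF liftsD(1)[OF G, of 0]] 0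
    by (intro restrict_ext) (simp add: coboundary_0)
  then show ?thesis by (simp add: zero_coboundary)
next
  case (Suc k)
  with f obtain c where c: "c \<in> module_hom A (P k) M"
    and cd: "\<And>x. x \<in> carrier (P (Suc k)) \<Longrightarrow> f x = c (d k x)"
    by (metis coboundary_SucE)
  have "(\<lambda>x\<in>carrier (P (Suc (n + k))). f (G (Suc k) x)) \<in> B (Suc (n + k))"
  proof (rule coboundary_SucI[OF module_hom_compose[OF P_left_module liftsD(1)[OF G] c]])
    fix x assume x: "x \<in> carrier (P (Suc (n + k)))"
    then have "G (Suc k) x \<in> carrier (P (Suc k))"
      using module_homD(2)[OF liftsD(1)[OF G, of "Suc k"]] by simp
    then show "(\<lambda>x\<in>carrier (P (Suc (n + k))). f (G (Suc k) x)) x =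
        (\<lambda>x\<in>carrier (P (n + k)). c (G k x)) (d (n + k) x)"
      using x cd liftsD(3)[OF G, of x k] d_closed by simp
  qed simp
  then show ?thesis by (simp add: Suc compose_def)
qed

text \<open>The difference of the two lifts is a chain map covering \<open>g'\<close> minus
  \<open>g\<close>, which is a coboundary. One argument thus gives independence of the lift and of
  the representative of the second factor.\<close>

lemma lift_compose_unique:
  assumes f: "f \<in> Z m" and g: "g \<in> Z n" and g': "g' \<in> cls n g"
    and G: "G \<in> lifts A P d e n g" and G': "G' \<in> lifts A P d e n g'"
  shows "cls (n + m) (compose (carrier (P (n + m))) f (G' m)) =
    cls (n + m) (compose (carrier (P (n + m))) f (G m))"
proof (rule cls_eq_diffI[OF lift_compose_cocycle[OF f G'] lift_compose_cocycle[OF f G]])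
  note P = P_exactD
  note GG = liftsD[OF G] liftsD[OF G']
  define H where "H i = (\<lambda>x\<in>carrier (P (n + i)). G' i x \<ominus>\<^bsub>P i\<^esub> G i x)" for i
  have H: "H i \<in> module_hom A (P (n + i)) (P i)" for i
    unfolding H_def using P(2) P(2) liftsD(1)[OF G'] liftsD(1)[OF G] by (rule module_hom_diff)
  have minus: "k (G' i x \<ominus>\<^bsub>P i\<^esub> G i x) = k (G' i x) \<ominus>\<^bsub>N\<^esub> k (G i x)"
    if "k \<in> module_hom A (P i) N" "left_module A N" "x \<in> carrier (P (n + i))"
    for k i x and N :: "('a, 'z) module"
    using P(2) that(2,1) module_homD(2)[OF liftsD(1)[OF G'] that(3)] module_homD(2)[OF liftsD(1)[OF G] that(3)]
    by (rule module_hom_minus)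
  have "(\<lambda>x\<in>carrier (P (n + m)). f (H m x)) \<in> B (n + m)"
    using P_exact cocyclesD[OF f] H
  proof (rule null_chain_map_coboundary)
    show "d i (H (Suc i) x) = H i (d (n + i) x)" if x: "x \<in> carrier (P (n + Suc i))" for i x
      using minus[OF P(3) P(2) x] x d_closed GG(3,6) by (simp add: H_def)
    obtain b where b: "b \<in> B n" "g' = add_cochain n b g"
      using g' by (auto simp: mem_cls_iff)
    have "(\<lambda>x\<in>carrier (P n). e (H 0 x)) = b"
    proof (rule extensionalityI)
      show "b \<in> extensional (carrier (P n))"
        using b(1) coboundary_cocycle cocycle_extensional by blast
    next
      fix x assume x: "x \<in> carrier (P n)"
      have "b x \<in> carrier M" "g x \<in> carrier M"
        using b(1) coboundary_cocycle cocycle_closed g x by blast+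
      then have "(b x \<oplus>\<^bsub>M\<^esub> g x) \<ominus>\<^bsub>M\<^esub> g x = b x"
        by (simp add: M.M.minus_eq M.M.a_assoc M.M.r_neg)
      then show "(\<lambda>x\<in>carrier (P n). e (H 0 x)) x = b x"
        using x minus[OF P(4) P(1), of x] GG(2)[OF x] GG(5)[OF x] b(2) by (simp add: H_def)
    qed simp
    then show "(\<lambda>x\<in>carrier (P n). e (H 0 x)) \<in> B n" using b(1) by simp
  qed
  moreover have "(\<lambda>x\<in>carrier (P (n + m)). f (H m x)) = (\<lambda>x\<in>carrier (P (n + m)).
    compose (carrier (P (n + m))) f (G' m) x \<ominus>\<^bsub>M\<^esub> compose (carrier (P (n + m))) f (G m) x)"
    using minus[OF cocyclesD(1)[OF f] M]
    by (intro restrict_ext) (simp add: H_def compose_def)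
  ultimately show "(\<lambda>x\<in>carrier (P (n + m)).
    compose (carrier (P (n + m))) f (G' m) x \<ominus>\<^bsub>M\<^esub> compose (carrier (P (n + m))) f (G m) x) \<in> B (n + m)"
    by simp
qed

lemma cls_self: "f \<in> Z n \<Longrightarrow> f \<in> cls n f"
proof -
  assume f: "f \<in> Z n"
  have "f = add_cochain n (zero_cochain n) f"
    using cocycle_closed[OF f] cocycle_extensional[OF f]
    by (auto simp: extensional_def fun_eq_iff)
  then show ?thesis unfolding mem_cls_iff by (rule bexI[OF _ zero_coboundary])
qed

text \<open>The union collapses to one coset: a change of \<open>f\<close> alters the composite by a
  coboundary, a change of \<open>g\<close> or of the lift is covered by
  \<open>lift_compose_unique\<close>, and the given choice shows that the coset is attained.\<close>

lemma yoneda_product_cls: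
  assumes f: "f \<in> Z m" and g: "g \<in> Z n" and G: "G \<in> lifts A P d e n g"
  shows "yoneda_product A M P d e m n (cls m f) (cls n g) =
    cls (m + n) (compose (carrier (P (n + m))) f (G m))"
proof -
  have eq: "cls (n + m) (compose (carrier (P (n + m))) f' (G' m)) =
      cls (n + m) (compose (carrier (P (n + m))) f (G m))"
    if f': "f' \<in> cls m f" and g': "g' \<in> cls n g" and G': "G' \<in> lifts A P d e n g'" for f' g' G'
  proof -
    obtain b where b: "b \<in> B m" "f' = add_cochain m b f"
      using f' by (auto simp: mem_cls_iff)
    have "cls (n + m) (compose (carrier (P (n + m))) f' (G' m)) =
        cls (n + m) (compose (carrier (P (n + m))) f (G' m))"
    proof (rule cls_eqI[OF lift_compose_cocycle[OF f G'] _ lift_compose_coboundary[OF b(1) G']])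
      fix x assume x: "x \<in> carrier (P (n + m))"
      then show "compose (carrier (P (n + m))) f' (G' m) x =
        compose (carrier (P (n + m))) b (G' m) x \<oplus>\<^bsub>M\<^esub> compose (carrier (P (n + m))) f (G' m) x"
        using module_homD(2)[OF liftsD(1)[OF G'] x] by (simp add: compose_def b(2))
    qed simp
    then show ?thesis using lift_compose_unique[OF f g g' G G'] by simp
  qed
  have "yoneda_product A M P d e m n (cls m f) (cls n g) \<subseteq>
      cls (n + m) (compose (carrier (P (n + m))) f (G m))"
    using eq unfolding yoneda_product_def add.commute[of m n] by blast
  moreover have "cls (n + m) (compose (carrier (P (n + m))) f (G m)) \<subseteq>
      yoneda_product A M P d e m n (cls m f) (cls n g)"
    using cls_self[OF f] cls_self[OF g] G unfolding yoneda_product_def add.commute[of m n] by blast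
  ultimately show ?thesis by (simp add: add.commute)
qed

end

section \<open>The graded algebra and its generation by homogeneous classes\<close>

locale ext_algebra_setting = ext_setting A M P d e
  for A :: "('a, 'r) ring_scheme" and M :: "('a, 'n) module" and P :: "nat \<Rightarrow> ('a, 'm) module"
    and d :: "nat \<Rightarrow> 'm \<Rightarrow> 'm" and e :: "'m \<Rightarrow> 'n" +
  fixes \<iota> :: "'k \<Rightarrow> 'a"
  assumes scalar_closed: "\<iota> c \<in> carrier A"
    and scalar_commute: "a \<in> carrier A \<Longrightarrow> x \<in> carrier M \<Longrightarrow> \<iota> c \<odot>\<^bsub>M\<^esub> (a \<odot>\<^bsub>M\<^esub> x) = a \<odot>\<^bsub>M\<^esub> (\<iota> c \<odot>\<^bsub>M\<^esub> x)"
begin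

abbreviation "E \<equiv> ext_algebra \<iota> A M P d e"
abbreviation "scale_cochain n c f \<equiv> \<lambda>x\<in>carrier (P n). \<iota> c \<odot>\<^bsub>M\<^esub> f x"

definition homogeneous :: "nat \<Rightarrow> ('m \<Rightarrow> 'n) \<Rightarrow> nat \<Rightarrow> ('m \<Rightarrow> 'n) set" where
  "homogeneous n f = (\<lambda>k. cls k (if k = n then f else zero_cochain k))"

text \<open>This is the purpose of \<open>scalar_commute\<close>: over a noncommutative ring a
  scaled cochain is linear only if the scalars commute with the action on \<open>M\<close>, where
  the cochains take their values.\<close>

lemma scale_hom:
  assumes "f \<in> module_hom A (P n) M"
  shows "scale_cochain n c f \<in> module_hom A (P n) M"
  using module_homD[OF assms] scalar_closed
  by (intro restrict_module_homI[OF P_left_module])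
    (auto simp: M.smult_closed M.smult_r_distr scalar_commute)

lemma scale_cocycle:
  assumes "f \<in> Z n"
  shows "scale_cochain n c f \<in> Z n"
  using scale_hom[OF cocyclesD(1)[OF assms]] cocyclesD(2)[OF assms]
  by (simp add: cocycles_def d_closed M.smult_r_zero scalar_closed)

lemma scale_coboundary:
  assumes "f \<in> B n"
  shows "scale_cochain n c f \<in> B n"
proof (cases n)
  case 0
  have "scale_cochain 0 c (zero_cochain 0) = zero_cochain 0"
    by (intro restrict_ext) (simp add: M.smult_r_zero scalar_closed)
  then show ?thesis using assms 0 by (simp add: coboundary_0)
next
  case (Suc m)
  with assms obtain g where g: "g \<in> module_hom A (P m) M" and "\<And>x. x \<in> carrier (P (Suc m)) \<Longrightarrow> f x = g (d m x)"
    by (metis coboundary_SucE)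
  then show ?thesis unfolding Suc
    by (intro coboundary_SucI[OF scale_hom[OF g]]) (auto simp: d_closed)
qed

lemma scale_cls:
  assumes f: "f \<in> Z n"
  shows "(\<Union>g\<in>cls n f. cls n (scale_cochain n c g)) = cls n (scale_cochain n c f)"
proof -
  have "cls n (scale_cochain n c g) = cls n (scale_cochain n c f)" if g: "g \<in> cls n f" for g
  proof -
    obtain b where b: "b \<in> B n" "g = add_cochain n b f" using g unfolding mem_cls_iff by blast
    have "b x \<in> carrier M" if "x \<in> carrier (P n)" for x
      using that b(1) coboundary_cocycle cocycle_closed by blast
    then show ?thesis
      using cocycle_closed[OF f] b(2)
      by (intro cls_eqI[OF scale_cocycle[OF f] _ scale_coboundary[OF b(1)]])
        (auto simp: M.smult_r_distr scalar_closed)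
  qed
  then show ?thesis using cls_self[OF f] by blast
qed

lemma scale_zero_cochain: "scale_cochain n c (zero_cochain n) = zero_cochain n"
  by (intro restrict_ext) (simp add: M.smult_r_zero scalar_closed)

lemma add_zero_cochain: "add_cochain n (zero_cochain n) (zero_cochain n) = zero_cochain n"
  by (intro restrict_ext) simp

lemma homogeneous_smult:
  assumes "f \<in> Z n"
  shows "c \<odot>\<^bsub>E\<^esub> homogeneous n f = homogeneous n (scale_cochain n c f)"
proof -
  have "(c \<odot>\<^bsub>E\<^esub> homogeneous n f) k = homogeneous n (scale_cochain n c f) k" for k
    using scale_cls[of "if k = n then f else zero_cochain k" k c] assms zero_cocycle scale_zero_cochain
    by (cases "k = n") (simp_all add: ext_algebra_def homogeneous_def)
  then show ?thesis by (rule ext)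
qed

lemma homogeneous_add:
  assumes "f \<in> Z n" "g \<in> Z n"
  shows "homogeneous n f \<oplus>\<^bsub>E\<^esub> homogeneous n g = homogeneous n (add_cochain n f g)"
proof -
  have "(homogeneous n f \<oplus>\<^bsub>E\<^esub> homogeneous n g) k = homogeneous n (add_cochain n f g) k" for k
    using assms ext_group_mult[OF zero_cocycle zero_cocycle, of k] ext_group_mult[OF assms]
    by (cases "k = n") (simp_all add: ext_algebra_def homogeneous_def add_zero_cochain del: restrict_apply)
  then show ?thesis by (rule ext)
qed

lemma yoneda_product_zero_left:
  assumes "g \<in> Z n"
  shows "yoneda_product A M P d e m n (cls m (zero_cochain m)) (cls n g) = cls (m + n) (zero_cochain (m + n))"
proof -
  obtain G where G: "G \<in> lifts A P d e n g" using lifts_ex[OF assms] .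
  have "compose (carrier (P (n + m))) (zero_cochain m) (G m) = zero_cochain (n + m)"
    unfolding compose_def using module_homD(2)[OF liftsD(1)[OF G]] by (intro restrict_ext) simp
  then show ?thesis using yoneda_product_cls[OF zero_cocycle assms G] by (simp add: add.commute)
qed

lemma yoneda_product_zero_right:
  assumes f: "f \<in> Z m"
  shows "yoneda_product A M P d e m n (cls m f) (cls n (zero_cochain n)) = cls (m + n) (zero_cochain (m + n))"
proof -
  define G where "G i = (\<lambda>x\<in>carrier (P (n + i)). \<zero>\<^bsub>P i\<^esub>)" for i
  interpret P: left_module A "P i" for i by (rule P_left_module)
  have "G i \<in> module_hom A (P (n + i)) (P i)" for i
    unfolding G_def by (rule restrict_module_homI[OF P_left_module]) (auto simp: P.smult_r_zero)
  moreover have "d i \<zero>\<^bsub>P (Suc i)\<^esub> = \<zero>\<^bsub>P i\<^esub>" for i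
    using P_left_module P_left_module P_exactD(3) by (rule module_hom_zero)
  moreover have "e \<zero>\<^bsub>P 0\<^esub> = \<zero>\<^bsub>M\<^esub>"
    using P_left_module M P_exactD(4) by (rule module_hom_zero)
  ultimately have G: "G \<in> lifts A P d e n (zero_cochain n)"
    by (auto simp: lifts_def G_def d_closed)
  have "f \<zero>\<^bsub>P m\<^esub> = \<zero>\<^bsub>M\<^esub>"
    using P_left_module M cocyclesD(1)[OF f] by (rule module_hom_zero)
  then have "compose (carrier (P (n + m))) f (G m) = zero_cochain (n + m)"
    unfolding compose_def G_def by (intro restrict_ext) simp
  then show ?thesis using yoneda_product_cls[OF f zero_cocycle G] by (simp add: add.commute)
qed

lemma homogeneous_mult:
  assumes f: "f \<in> Z m" and g: "g \<in> Z n" and G: "G \<in> lifts A P d e n g"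
  shows "homogeneous m f \<otimes>\<^bsub>E\<^esub> homogeneous n g = homogeneous (n + m) (compose (carrier (P (n + m))) f (G m))"
proof
  fix k
  let ?h = "compose (carrier (P (n + m))) f (G m)"
  interpret X: comm_group "ext_group A M P d k" by (rule ext_comm_group)
  let ?t = "\<lambda>i. yoneda_product A M P d e i (k - i) (homogeneous m f i) (homogeneous n g (k - i))"
  \<comment> \<open>For \<open>i\<close> other than \<open>m\<close> the first factor is zero; for
    \<open>i = m\<close> the second factor is zero unless \<open>k = n + m\<close>.\<close>
  have t: "?t i = (if i = m \<and> k = n + m then cls k ?h else \<one>\<^bsub>ext_group A M P d k\<^esub>)" if "i \<le> k" for i
  proof (cases "i = m")
    case False
    have "(if k - i = n then g else zero_cochain (k - i)) \<in> Z (k - i)" using g zero_cocycle by auto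
    from yoneda_product_zero_left[OF this, of i] that False show ?thesis
      by (simp add: homogeneous_def ext_group_one)
  next
    case i: True
    show ?thesis
    proof (cases "k = n + m")
      case True
      then show ?thesis using i yoneda_product_cls[OF f g G] by (simp add: homogeneous_def add.commute)
    next
      case False
      then have "k - i \<noteq> n" using i that by auto
      then show ?thesis using yoneda_product_zero_right[OF f, of "k - i"] i False that
        by (simp add: homogeneous_def ext_group_one)
    qed
  qed
  have hc: "cls k ?h \<in> carrier (ext_group A M P d k)" if "k = n + m"
    using that lift_compose_cocycle[OF f G] by (auto simp: ext_group_carrier)
  have "finprod (ext_group A M P d k) ?t {..k} =
      finprod (ext_group A M P d k) (\<lambda>i. if i = m \<and> k = n + m then cls k ?h else \<one>\<^bsub>ext_group A M P d k\<^esub>) {..k}"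
    using t hc by (intro X.finprod_cong') auto
  also have "\<dots> = (if k = n + m then cls k ?h else \<one>\<^bsub>ext_group A M P d k\<^esub>)"
  proof (cases "k = n + m")
    case True
    then have "m \<in> {..k}" by simp
    from X.finprod_singleton_swap[OF this, of "\<lambda>_. cls k ?h"] True hc show ?thesis by simp
  qed (simp add: X.finprod_one_eqI)
  also have "\<dots> = homogeneous (n + m) ?h k" by (simp add: homogeneous_def ext_group_one)
  finally show "(homogeneous m f \<otimes>\<^bsub>E\<^esub> homogeneous n g) k = homogeneous (n + m) ?h k"
    by (simp add: ext_algebra_def)
qed

lemma homogeneous_cong:
  assumes "f \<in> Z n" "g \<in> Z n" "(\<lambda>x\<in>carrier (P n). f x \<ominus>\<^bsub>M\<^esub> g x) \<in> B n"
  shows "homogeneous n f = homogeneous n g"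
  using cls_eq_diffI[OF assms] by (simp add: homogeneous_def fun_eq_iff)

lemma homogeneous_closed:
  assumes "f \<in> Z n"
  shows "homogeneous n f \<in> carrier E"
proof -
  have "{k. homogeneous n f k \<noteq> \<one>\<^bsub>ext_group A M P d k\<^esub>} \<subseteq> {n}"
    by (auto simp: homogeneous_def ext_group_one)
  then have "finite {k. homogeneous n f k \<noteq> \<one>\<^bsub>ext_group A M P d k\<^esub>}"
    by (rule finite_subset) simp
  then show ?thesis
    using assms zero_cocycle by (auto simp: ext_algebra_def ext_group_carrier homogeneous_def)
qed

text \<open>The subalgebra generated by \<open>T\<close>, described by cocycles tagged with their
  degree instead of classes, so that each product comes with an explicit lift. The rule
  \<open>cohomologous\<close> makes membership a property of the class.\<close>

inductive_set generated :: "(nat \<times> ('m \<Rightarrow> 'n)) set \<Rightarrow> (nat \<times> ('m \<Rightarrow> 'n)) set"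
  for T where
  base: "(n, f) \<in> T \<Longrightarrow> f \<in> Z n \<Longrightarrow> (n, f) \<in> generated T"
| zero: "(n, zero_cochain n) \<in> generated T"
| add: "(n, f) \<in> generated T \<Longrightarrow> (n, g) \<in> generated T \<Longrightarrow> (n, add_cochain n f g) \<in> generated T"
| scale: "(n, f) \<in> generated T \<Longrightarrow> (n, scale_cochain n c f) \<in> generated T"
| mult: "(m, f) \<in> generated T \<Longrightarrow> (n, g) \<in> generated T \<Longrightarrow> G \<in> lifts A P d e n g \<Longrightarrow>
    (n + m, compose (carrier (P (n + m))) f (G m)) \<in> generated T"
| cohomologous: "(n, f) \<in> generated T \<Longrightarrow> g \<in> Z n \<Longrightarrow> (\<lambda>x\<in>carrier (P n). f x \<ominus>\<^bsub>M\<^esub> g x) \<in> B n \<Longrightarrow>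
    (n, g) \<in> generated T"

lemma generated_homogeneous:
  assumes "(n, f) \<in> generated T" and S: "subring S E" and scalars: "\<And>c b. b \<in> S \<Longrightarrow> c \<odot>\<^bsub>E\<^esub> b \<in> S"
    and T: "\<And>n f. (n, f) \<in> T \<Longrightarrow> homogeneous n f \<in> S"
  shows "f \<in> Z n \<and> homogeneous n f \<in> S"
proof -
  interpret S: subring S E by fact
  have hzero: "homogeneous n (zero_cochain n) \<in> S" for n
  proof -
    have "homogeneous n (zero_cochain n) = \<zero>\<^bsub>E\<^esub>"
      by (simp add: homogeneous_def ext_algebra_def ext_group_one if_distrib[symmetric] del: restrict_apply cong: if_cong)
    then show ?thesis using subgroup.one_closed[OF S.subgroup_axioms] by simp
  qed
  have plus: "u \<oplus>\<^bsub>E\<^esub> v \<in> S" if "u \<in> S" "v \<in> S" for u v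
    using subgroup.m_closed[OF S.subgroup_axioms that] by simp
  show ?thesis
    using assms(1)
  proof (induction rule: generated.induct)
    case (base n f)
    then show ?case using T by blast
  next
    case (zero n)
    show ?case using zero_cocycle hzero by (rule conjI)
  next
    case (add n f g)
    then have f: "f \<in> Z n" and g: "g \<in> Z n" and S: "homogeneous n f \<in> S" "homogeneous n g \<in> S" by auto
    show ?case
      unfolding homogeneous_add[OF f g, symmetric] using add_cocycle[OF f g] plus[OF S] by (rule conjI)
  next
    case (scale n f c)
    then have f: "f \<in> Z n" and S: "homogeneous n f \<in> S" by auto
    show ?case
      unfolding homogeneous_smult[OF f, symmetric] using scale_cocycle[OF f] scalars[OF S] by (rule conjI)
  next
    case (mult m f n g G)
    then have f: "f \<in> Z m" and g: "g \<in> Z n" and S: "homogeneous m f \<in> S" "homogeneous n g \<in> S"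
      and G: "G \<in> lifts A P d e n g" by auto
    show ?case
      unfolding homogeneous_mult[OF f g G, symmetric] using lift_compose_cocycle[OF f G] S.m_closed[OF S]
      by (rule conjI)
  next
    case (cohomologous n f g)
    then have f: "f \<in> Z n" and S: "homogeneous n f \<in> S" by auto
    show ?case
      using S unfolding homogeneous_cong[OF f cohomologous.hyps(2,3)] using cohomologous.hyps(2) by simp
  qed
qed

theorem finitely_generated_ext_algebra:
  assumes T: "finite T" "\<And>n f. (n, f) \<in> T \<Longrightarrow> f \<in> Z n" and gen: "\<And>n f. f \<in> Z n \<Longrightarrow> (n, f) \<in> generated T"
  shows "finitely_generated_algebra E"
  unfolding finitely_generated_algebra_def
proof (intro exI[of _ "(\<lambda>(n, f). homogeneous n f) ` T"] conjI allI impI)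
  show "(\<lambda>(n, f). homogeneous n f) ` T \<subseteq> carrier E" using T(2) homogeneous_closed by auto
  show "finite ((\<lambda>(n, f). homogeneous n f) ` T)" using T(1) by simp
  fix S assume S: "subring S E \<and> (\<forall>c. \<forall>b\<in>S. c \<odot>\<^bsub>E\<^esub> b \<in> S) \<and> (\<lambda>(n, f). homogeneous n f) ` T \<subseteq> S"
  then interpret S: subring S E by simp
  have hom: "homogeneous n f \<in> S" if "f \<in> Z n" for n f
  proof -
    have "homogeneous n f \<in> S" if "(n, f) \<in> T" for n f
    proof -
      from that have "homogeneous n f \<in> (\<lambda>(n, f). homogeneous n f) ` T" by force
      with S show ?thesis by blast
    qed
    then show ?thesis using generated_homogeneous[OF gen[OF that], of S] S by blast
  qed
  \<comment> \<open>Every element is a finite sum of homogeneous ones; the induction is on a finite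
    set \<open>D\<close> of degrees outside of which \<open>u\<close> is the neutral coset.\<close>
  have "finite D \<Longrightarrow> u \<in> carrier E \<Longrightarrow> {n. u n \<noteq> \<one>\<^bsub>ext_group A M P d n\<^esub>} \<subseteq> D \<Longrightarrow> u \<in> S" for D u
  proof (induction D arbitrary: u rule: finite_induct)
    case empty
    then have "u = \<zero>\<^bsub>E\<^esub>" by (auto simp: ext_algebra_def)
    then show ?case using subgroup.one_closed[OF S.subgroup_axioms] by simp
  next
    case (insert n D)
    let ?w = "u(n := \<one>\<^bsub>ext_group A M P d n\<^esub>)"
    have un: "u k \<in> carrier (ext_group A M P d k)" for k using insert.prems(1) by (simp add: ext_algebra_def)
    then obtain f where f: "f \<in> Z n" "u n = cls n f" by (auto simp: ext_group_carrier)
    have sub: "{k. ?w k \<noteq> \<one>\<^bsub>ext_group A M P d k\<^esub>} \<subseteq> D" using insert.prems(2) by auto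
    moreover have "?w \<in> carrier E"
      using un finite_subset[OF sub insert.hyps(1)] zero_cocycle
      by (auto simp: ext_algebra_def ext_group_one ext_group_carrier)
    ultimately have w: "?w \<in> S" using insert.IH by blast
    have "homogeneous n f \<oplus>\<^bsub>E\<^esub> ?w = u"
    proof
      fix k
      interpret X: comm_group "ext_group A M P d k" by (rule ext_comm_group)
      have "homogeneous n f k = (if k = n then u k else \<one>\<^bsub>ext_group A M P d k\<^esub>)"
        using f(2) by (simp add: homogeneous_def ext_group_one del: restrict_apply)
      then show "(homogeneous n f \<oplus>\<^bsub>E\<^esub> ?w) k = u k"
        using un[of k] X.r_one[OF un[of k]] by (cases "k = n") (simp_all add: ext_algebra_def)
    qed
    then show ?case using subgroup.m_closed[OF S.subgroup_axioms hom[OF f(1)] w] by simp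
  qed
  then have "carrier E \<subseteq> S" by (auto simp: ext_algebra_def)
  moreover have "S \<subseteq> carrier E" using subgroup.subset[OF S.subgroup_axioms] by simp
  ultimately show "S = carrier E" by simp
qed

end

section \<open>Twisted double complexes\<close>

text \<open>The double complex has \<open>A\<close> in each bidegree \<open>(i, j)\<close>. Right multiplication by \<open>zz i\<close> goes from
  \<open>(i, j)\<close> to \<open>(i - 1, j)\<close>, and right multiplication by \<open>ww i j\<close>, which includes a sign, from \<open>(i, j)\<close> to
  \<open>(i, j - 1)\<close>; hence \<open>zz 0\<close> and \<open>ww i 0\<close> are junk. Then \<open>m\<close> augments the double complex to \<open>M\<close>.\<close>

locale twisted_double_complex = left_module A M
  for A :: "('a, 'r) ring_scheme" (structure) and M :: "('a, 'n) module" +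
  fixes m :: 'n and zz :: "nat \<Rightarrow> 'a" and ww :: "nat \<Rightarrow> nat \<Rightarrow> 'a"
  assumes m_closed: "m \<in> carrier M"
    and m_generates: "x \<in> carrier M \<Longrightarrow> \<exists>a\<in>carrier A. x = a \<odot>\<^bsub>M\<^esub> m"
    and zz_closed [simp]: "zz i \<in> carrier A" and ww_closed [simp]: "ww i j \<in> carrier A"
    and zz_zz: "zz (Suc (Suc i)) \<otimes> zz (Suc i) = \<zero>"
    and ww_ww: "ww i (Suc (Suc j)) \<otimes> ww i (Suc j) = \<zero>"
    and ww_zz: "ww (Suc i) (Suc j) \<otimes> zz (Suc i) = \<ominus> (zz (Suc i) \<otimes> ww i (Suc j))"
    and zz_m: "zz (Suc i) \<odot>\<^bsub>M\<^esub> m = \<zero>\<^bsub>M\<^esub>"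
    and ww_m: "ww i (Suc j) \<odot>\<^bsub>M\<^esub> m = \<zero>\<^bsub>M\<^esub>"
    and zz_exact: "a \<in> carrier A \<Longrightarrow> a \<otimes> zz (Suc i) = \<zero> \<Longrightarrow>
      \<exists>b\<in>carrier A. a = b \<otimes> zz (Suc (Suc i))"
    and ww_exact: "a \<in> carrier A \<Longrightarrow> b \<in> carrier A \<Longrightarrow> a \<otimes> ww 0 (Suc j) = b \<otimes> zz (Suc 0) \<Longrightarrow>
      \<exists>c\<in>carrier A. \<exists>c'\<in>carrier A. a = c' \<otimes> zz (Suc 0) \<oplus> c \<otimes> ww 0 (Suc (Suc j))"
    and m_exact: "a \<in> carrier A \<Longrightarrow> a \<odot>\<^bsub>M\<^esub> m = \<zero>\<^bsub>M\<^esub> \<Longrightarrow>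
      \<exists>c\<in>carrier A. \<exists>c'\<in>carrier A. a = c' \<otimes> zz (Suc 0) \<oplus> c \<otimes> ww 0 (Suc 0)"
    and zz_period: "zz (Suc (Suc (Suc i))) = zz (Suc i)"
    and ww_period: "ww (Suc (Suc i)) (Suc j) = ww i (Suc j)" "ww i (Suc (Suc (Suc j))) = ww i (Suc j)"
begin

text \<open>The coordinate \<open>i\<close> of an element of \<open>F n\<close> has bidegree \<open>(i, n - i)\<close>.\<close>

definition F :: "nat \<Rightarrow> ('a, nat \<Rightarrow> 'a) module" where
  "F n = free_module A {..n}"

text \<open>The source coordinate \<open>i\<close> has second degree \<open>n + 1 - i\<close>,
  written as \<open>Suc (n - i)\<close> because the assumptions of the locale are stated at
  successors.\<close>

definition dF :: "nat \<Rightarrow> (nat \<Rightarrow> 'a) \<Rightarrow> nat \<Rightarrow> 'a" where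
  "dF n = (\<lambda>v\<in>carrier (F (Suc n)). \<lambda>i.
     if i \<le> n then v (Suc i) \<otimes> zz (Suc i) \<oplus> v i \<otimes> ww i (Suc (n - i)) else \<zero>)"

definition eF :: "(nat \<Rightarrow> 'a) \<Rightarrow> 'n" where
  "eF = (\<lambda>v\<in>carrier (F 0). v 0 \<odot>\<^bsub>M\<^esub> m)"

lemma F_simps:
  "v \<in> carrier (F n) \<longleftrightarrow> (\<forall>i. v i \<in> carrier A) \<and> (\<forall>i. n < i \<longrightarrow> v i = \<zero>)"
  "\<zero>\<^bsub>F n\<^esub> = (\<lambda>i. \<zero>)"
  "v \<oplus>\<^bsub>F n\<^esub> w = (\<lambda>i. v i \<oplus> w i)"
  "a \<odot>\<^bsub>F n\<^esub> v = (\<lambda>i. a \<otimes> v i)"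
proof -
  have "v i \<in> carrier A" if "\<forall>i\<in>{..n}. v i \<in> carrier A" "\<forall>i. i \<notin> {..n} \<longrightarrow> v i = \<zero>" for i
    using that by (cases "i \<le> n") auto
  moreover have "finite {i. v i \<noteq> \<zero>}" if "\<forall>i. n < i \<longrightarrow> v i = \<zero>"
  proof (rule finite_subset)
    show "{i. v i \<noteq> \<zero>} \<subseteq> {..n}" using that not_less by auto
  qed simp
  ultimately show "v \<in> carrier (F n) \<longleftrightarrow> (\<forall>i. v i \<in> carrier A) \<and> (\<forall>i. n < i \<longrightarrow> v i = \<zero>)"
    by (auto simp: F_def free_module_simps(1) not_le)
qed (simp_all add: F_def free_module_simps)

lemma F_left_module: "left_module A (F n)"
  unfolding F_def by (rule left_module_free_module)

lemma F_closed: "v \<in> carrier (F n) \<Longrightarrow> v i \<in> carrier A"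
  by (simp add: F_simps(1))

lemma dF_apply:
  "v \<in> carrier (F (Suc n)) \<Longrightarrow>
    dF n v i = (if i \<le> n then v (Suc i) \<otimes> zz (Suc i) \<oplus> v i \<otimes> ww i (Suc (n - i)) else \<zero>)"
  by (simp add: dF_def)

lemma dF_hom: "dF n \<in> module_hom A (F (Suc n)) (F n)"
  unfolding dF_def
proof (rule restrict_module_homI[OF F_left_module])
  fix v w assume v: "v \<in> carrier (F (Suc n))" and w: "w \<in> carrier (F (Suc n))"
  note c = F_closed[OF v] F_closed[OF w]
  show "(\<lambda>i. if i \<le> n then (v \<oplus>\<^bsub>F (Suc n)\<^esub> w) (Suc i) \<otimes> zz (Suc i) \<oplus> (v \<oplus>\<^bsub>F (Suc n)\<^esub> w) i \<otimes> ww i (Suc (n - i)) else \<zero>) =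
    (\<lambda>i. if i \<le> n then v (Suc i) \<otimes> zz (Suc i) \<oplus> v i \<otimes> ww i (Suc (n - i)) else \<zero>) \<oplus>\<^bsub>F n\<^esub>
    (\<lambda>i. if i \<le> n then w (Suc i) \<otimes> zz (Suc i) \<oplus> w i \<otimes> ww i (Suc (n - i)) else \<zero>)"
    by (rule ext) (simp add: F_simps(3) c l_distr R.a_ac)
next
  fix a v assume a: "a \<in> carrier A" and v: "v \<in> carrier (F (Suc n))"
  show "(\<lambda>i. if i \<le> n then (a \<odot>\<^bsub>F (Suc n)\<^esub> v) (Suc i) \<otimes> zz (Suc i) \<oplus> (a \<odot>\<^bsub>F (Suc n)\<^esub> v) i \<otimes> ww i (Suc (n - i)) else \<zero>) =
    a \<odot>\<^bsub>F n\<^esub> (\<lambda>i. if i \<le> n then v (Suc i) \<otimes> zz (Suc i) \<oplus> v i \<otimes> ww i (Suc (n - i)) else \<zero>)"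
    by (rule ext) (simp add: F_simps(4) F_closed[OF v] a r_distr m_assoc)
qed (auto simp: F_simps(1))

lemma eF_hom: "eF \<in> module_hom A (F 0) M"
  unfolding eF_def
  by (rule restrict_module_homI[OF F_left_module])
    (auto simp: F_simps smult_closed smult_l_distr smult_assoc m_closed)

lemma dF_dF:
  assumes v: "v \<in> carrier (F (Suc (Suc n)))"
  shows "dF n (dF (Suc n) v) = \<zero>\<^bsub>F n\<^esub>"
proof
  fix i
  note c = F_closed[OF v]
  have dv: "dF (Suc n) v \<in> carrier (F (Suc n))" using module_homD(2)[OF dF_hom v] .
  show "dF n (dF (Suc n) v) i = \<zero>\<^bsub>F n\<^esub> i"
  proof (cases "i \<le> n")
    case True
    then have idx: "Suc n - i = Suc (n - i)" by simp
    have "dF n (dF (Suc n) v) i =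
        (v (Suc (Suc i)) \<otimes> zz (Suc (Suc i)) \<oplus> v (Suc i) \<otimes> ww (Suc i) (Suc (n - i))) \<otimes> zz (Suc i) \<oplus>
        (v (Suc i) \<otimes> zz (Suc i) \<oplus> v i \<otimes> ww i (Suc (Suc (n - i)))) \<otimes> ww i (Suc (n - i))"
      using True by (simp add: dF_apply[OF dv] dF_apply[OF v] idx)
    also have "\<dots> = v (Suc i) \<otimes> (ww (Suc i) (Suc (n - i)) \<otimes> zz (Suc i)) \<oplus>
        v (Suc i) \<otimes> (zz (Suc i) \<otimes> ww i (Suc (n - i)))"
      by (simp add: c l_distr m_assoc zz_zz ww_ww)
    also have "\<dots> = \<zero>" by (simp add: c ww_zz r_minus R.l_neg)
    finally show ?thesis by (simp add: F_simps(2))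
  qed (simp add: dF_apply[OF dv] F_simps(2))
qed

text \<open>A preimage \<open>b\<close> is found by solving
  \<open>b (i + 1) zz (i + 1) + b i ww i (n + 1 - i) = a i\<close> for increasing \<open>i\<close>.
  The equation for \<open>i = 0\<close> is solved by \<open>a0\<close>. Once equation
  \<open>i\<close> holds, the cycle condition and anticommutation show that \<open>a (i + 1)\<close>
  minus its \<open>ww\<close> term is killed by \<open>zz (i + 1)\<close>, and exactness of the row
  provides the next unknown. So the second direction has to be exact only in column 0 and modulo the
  image of \<open>zz 1\<close>.\<close>

lemma cycle_in_range:
  assumes a: "a \<in> carrier (F n)"
    and cycle: "\<And>i. i < n \<Longrightarrow> a (Suc i) \<otimes> zz (Suc i) \<oplus> a i \<otimes> ww i (n - i) = \<zero>"
    and a0: "\<exists>c\<in>carrier A. \<exists>c'\<in>carrier A. a 0 = c' \<otimes> zz (Suc 0) \<oplus> c \<otimes> ww 0 (Suc n)"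
  shows "a \<in> dF n ` carrier (F (Suc n))"
proof -
  \<comment> \<open>\<open>Q\<close> is equation \<open>i\<close> for two consecutive unknowns. It
    is void above \<open>n\<close>, so the dependent choice never gets stuck.\<close>
  define Q where "Q i b b' \<longleftrightarrow> (i \<le> n \<longrightarrow> b' \<otimes> zz (Suc i) \<oplus> b \<otimes> ww i (Suc (n - i)) = a i)" for i b b'
  define S where "S i b \<longleftrightarrow> b \<in> carrier A \<and> (\<exists>b'\<in>carrier A. Q i b b')" for i b
  have S0: "\<exists>b. S 0 b" using a0 unfolding S_def Q_def by (metis diff_zero)
  have step: "\<exists>b'. S (Suc i) b' \<and> Q i b b'" if "S i b" for i b
  proof -
    from that obtain b' where b: "b \<in> carrier A" and b': "b' \<in> carrier A" and q: "Q i b b'" by (auto simp: S_def)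
    have "\<exists>b''\<in>carrier A. Q (Suc i) b' b''"
    proof (cases "Suc i \<le> n")
      case True
      define j where "j = n - Suc i"
      have j: "n - i = Suc j" using True by (simp add: j_def)
      note c = F_closed[OF a]
      let ?r = "a (Suc i) \<ominus> b' \<otimes> ww (Suc i) (Suc j)"
      have ai: "a i = b' \<otimes> zz (Suc i) \<oplus> b \<otimes> ww i (Suc (Suc j))" using q True j by (simp add: Q_def)
      have "a i \<otimes> ww i (Suc j) = (b' \<otimes> zz (Suc i)) \<otimes> ww i (Suc j)"
        by (simp add: ai b b' l_distr m_assoc ww_ww)
      then have "a (Suc i) \<otimes> zz (Suc i) \<oplus> (b' \<otimes> zz (Suc i)) \<otimes> ww i (Suc j) = \<zero>"
        using cycle[of i] True j by simp
      moreover have "?r \<otimes> zz (Suc i) = a (Suc i) \<otimes> zz (Suc i) \<oplus> (b' \<otimes> zz (Suc i)) \<otimes> ww i (Suc j)"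
        by (simp add: R.minus_eq l_distr l_minus c b' m_assoc ww_zz r_minus)
      ultimately have "?r \<otimes> zz (Suc i) = \<zero>" by simp
      then obtain b'' where b'': "b'' \<in> carrier A" "?r = b'' \<otimes> zz (Suc (Suc i))"
        using zz_exact[of ?r i] c b' by auto
      have "b'' \<otimes> zz (Suc (Suc i)) \<oplus> b' \<otimes> ww (Suc i) (Suc j) = a (Suc i)"
        unfolding b''(2)[symmetric] by (simp add: c b' R.minus_eq R.a_assoc R.l_neg)
      then show ?thesis using b''(1) by (auto simp: Q_def j_def)
    qed (auto simp: Q_def)
    then show ?thesis using b' q by (auto simp: S_def)
  qed
  obtain b where b: "\<forall>i. S i (b i) \<and> Q i (b i) (b (Suc i))"
    using dependent_nat_choice[of S Q] S0 step by blast
  \<comment> \<open>The last equation, for \<open>i = n\<close>, still involves the unknown with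
    index \<open>n + 1\<close>; all later ones are cut off.\<close>
  define v where "v i = (if i \<le> Suc n then b i else \<zero>)" for i
  have v: "v \<in> carrier (F (Suc n))" using b by (auto simp: v_def F_simps(1) S_def)
  have "dF n v = a"
  proof
    fix i show "dF n v i = a i"
      using b a by (auto simp: dF_apply[OF v] v_def Q_def F_simps(1))
  qed
  then show ?thesis using v by blast
qed

lemma F_exact: "exact_augmented A M F dF eF"
  unfolding exact_augmented_def
proof (intro conjI allI)
  show "left_module A M" by (rule left_module_axioms)
  show "eF ` carrier (F 0) = carrier M"
  proof
    show "eF ` carrier (F 0) \<subseteq> carrier M" using module_homD(2)[OF eF_hom] by blast
    show "carrier M \<subseteq> eF ` carrier (F 0)"
    proof
      fix x assume "x \<in> carrier M"
      then obtain a where a: "a \<in> carrier A" "x = a \<odot>\<^bsub>M\<^esub> m" using m_generates by blast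
      define v where "v i = (if i = 0 then a else \<zero>)" for i :: nat
      have "v \<in> carrier (F 0)" using a by (simp add: v_def F_simps(1))
      moreover from this have "eF v = x" by (simp add: eF_def v_def a)
      ultimately show "x \<in> eF ` carrier (F 0)" by blast
    qed
  qed
  show "dF 0 ` carrier (F 1) = {x \<in> carrier (F 0). eF x = \<zero>\<^bsub>M\<^esub>}"
  proof (intro subset_antisym subsetI)
    fix x assume "x \<in> dF 0 ` carrier (F 1)"
    then obtain v where v: "v \<in> carrier (F (Suc 0))" "x = dF 0 v" by auto
    have "eF x = (v (Suc 0) \<otimes> zz (Suc 0) \<oplus> v 0 \<otimes> ww 0 (Suc 0)) \<odot>\<^bsub>M\<^esub> m"
      using module_homD(2)[OF dF_hom v(1)] v by (simp add: eF_def dF_apply)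
    also have "\<dots> = \<zero>\<^bsub>M\<^esub>"
      by (simp add: smult_l_distr smult_assoc F_closed[OF v(1)] m_closed zz_m ww_m smult_r_zero)
    finally show "x \<in> {x \<in> carrier (F 0). eF x = \<zero>\<^bsub>M\<^esub>}"
      using module_homD(2)[OF dF_hom v(1)] v by simp
  next
    fix x assume "x \<in> {x \<in> carrier (F 0). eF x = \<zero>\<^bsub>M\<^esub>}"
    then have x: "x \<in> carrier (F 0)" "x 0 \<odot>\<^bsub>M\<^esub> m = \<zero>\<^bsub>M\<^esub>" by (auto simp: eF_def)
    show "x \<in> dF 0 ` carrier (F 1)"
      using cycle_in_range[OF x(1)] m_exact[OF F_closed[OF x(1)] x(2)] by simp
  qed
  fix n
  show "left_module A (F n)" by (rule F_left_module)
  show "dF n \<in> module_hom A (F (Suc n)) (F n)" by (rule dF_hom)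
  show "dF (Suc n) ` carrier (F (Suc (Suc n))) = {x \<in> carrier (F (Suc n)). dF n x = \<zero>\<^bsub>F n\<^esub>}"
  proof (intro subset_antisym subsetI)
    fix x assume "x \<in> dF (Suc n) ` carrier (F (Suc (Suc n)))"
    then show "x \<in> {x \<in> carrier (F (Suc n)). dF n x = \<zero>\<^bsub>F n\<^esub>}"
      using dF_dF module_homD(2)[OF dF_hom] by blast
  next
    fix x assume "x \<in> {x \<in> carrier (F (Suc n)). dF n x = \<zero>\<^bsub>F n\<^esub>}"
    then have x: "x \<in> carrier (F (Suc n))" "dF n x = \<zero>\<^bsub>F n\<^esub>" by auto
    have cyc: "x (Suc i) \<otimes> zz (Suc i) \<oplus> x i \<otimes> ww i (Suc (n - i)) = \<zero>" if "i \<le> n" for i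
      using fun_cong[OF x(2), of i] that by (simp add: dF_apply[OF x(1)] F_simps(2))
    \<comment> \<open>The cycle condition in column 0 says that \<open>x 0\<close> times
      \<open>ww\<close> is a left multiple of \<open>zz 1\<close>, which is the form that
      \<open>ww_exact\<close> expects.\<close>
    have "x 0 \<otimes> ww 0 (Suc n) = (\<ominus> x (Suc 0)) \<otimes> zz (Suc 0)"
      using cyc[of 0] F_closed[OF x(1)] R.minus_equality[of "x 0 \<otimes> ww 0 (Suc n)" "x (Suc 0) \<otimes> zz (Suc 0)"]
      by (simp add: l_minus R.a_comm)
    then have "\<exists>c\<in>carrier A. \<exists>c'\<in>carrier A. x 0 = c' \<otimes> zz (Suc 0) \<oplus> c \<otimes> ww 0 (Suc (Suc n))"
      using F_closed[OF x(1)] by (intro ww_exact[of _ "\<ominus> x (Suc 0)"]) auto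
    then show "x \<in> dF (Suc n) ` carrier (F (Suc (Suc n)))"
      using cyc by (intro cycle_in_range[OF x(1)]) (auto simp: Suc_diff_le less_Suc_eq_le)
  qed
qed (rule eF_hom)

text \<open>\<open>shift True\<close> lowers the first degree by \<open>2\<close>, \<open>shift False\<close> the second.\<close>

definition shift :: "bool \<Rightarrow> nat \<Rightarrow> (nat \<Rightarrow> 'a) \<Rightarrow> nat \<Rightarrow> 'a" where
  "shift s n = (\<lambda>v\<in>carrier (F (Suc (Suc n))). if s then (\<lambda>i. v (Suc (Suc i))) else (\<lambda>i. if i \<le> n then v i else \<zero>))"

lemma shift_hom: "shift s n \<in> module_hom A (F (Suc (Suc n))) (F n)"
  unfolding shift_def
  by (rule restrict_module_homI[OF F_left_module]) (auto simp: F_simps fun_eq_iff)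

text \<open>Periodicity of \<open>zz\<close> and \<open>ww\<close> makes both shifts chain maps. The
  cut at \<open>n\<close> in \<open>shift False\<close> discards the coordinates whose second degree
  is below 2.\<close>

lemma dF_shift:
  assumes v: "v \<in> carrier (F (Suc (Suc (Suc n))))"
  shows "dF n (shift s (Suc n) v) = shift s n (dF (Suc (Suc n)) v)"
proof
  fix i
  have "shift s (Suc n) v \<in> carrier (F (Suc n))" "dF (Suc (Suc n)) v \<in> carrier (F (Suc (Suc n)))"
    using module_homD(2)[OF shift_hom v] module_homD(2)[OF dF_hom v] .
  then show "dF n (shift s (Suc n) v) i = shift s n (dF (Suc (Suc n)) v) i"
    using v by (simp add: dF_apply shift_def zz_period ww_period Suc_diff_le)
qed

definition coordinate :: "nat \<Rightarrow> nat \<Rightarrow> (nat \<Rightarrow> 'a) \<Rightarrow> 'n" where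
  "coordinate n j = (\<lambda>v\<in>carrier (F n). v j \<odot>\<^bsub>M\<^esub> m)"

lemma coordinate_hom: "coordinate n j \<in> module_hom A (F n) M"
  unfolding coordinate_def
  by (rule restrict_module_homI[OF F_left_module])
    (auto simp: F_simps smult_closed smult_l_distr smult_assoc m_closed)

text \<open>This is minimality of the resolution: every entry of the differential annihilates
  \<open>m\<close>, so each coordinate is a cocycle.\<close>

lemma coordinate_dF:
  assumes v: "v \<in> carrier (F (Suc n))"
  shows "coordinate n j (dF n v) = \<zero>\<^bsub>M\<^esub>"
  using module_homD(2)[OF dF_hom v]
  by (simp add: coordinate_def dF_apply[OF v] smult_l_distr smult_assoc F_closed[OF v] m_closed zz_m ww_m
      smult_r_zero smult_l_zero)

end

section \<open>Comparison of the given resolution with the double complex\<close>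

locale twisted_ext = ext_algebra_setting A M P d e \<iota> + twisted_double_complex A M m zz ww
  for A :: "('a, 'r) ring_scheme" (structure) and M :: "('a, 'n) module" and P :: "nat \<Rightarrow> ('a, 'm) module"
    and d :: "nat \<Rightarrow> 'm \<Rightarrow> 'm" and e :: "'m \<Rightarrow> 'n" and \<iota> :: "'k \<Rightarrow> 'a"
    and m :: 'n and zz :: "nat \<Rightarrow> 'a" and ww :: "nat \<Rightarrow> nat \<Rightarrow> 'a" +
  assumes m_spans: "x \<in> carrier M \<Longrightarrow> \<exists>c. x = \<iota> c \<odot>\<^bsub>M\<^esub> m"
begin

lemma to_F_ex: "\<exists>\<phi>. (\<forall>n. \<phi> n \<in> module_hom A (P n) (F n)) \<and> (\<forall>x\<in>carrier (P 0). eF (\<phi> 0 x) = e x) \<and>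
    (\<forall>n. \<forall>x\<in>carrier (P (Suc n)). dF n (\<phi> (Suc n) x) = \<phi> n (d n x))"
  by (rule chain_map_lift[OF F_exact free_retract_basis P_exactD(3) P_exactD(9) P_exactD(4) P_exactD(8)]) blast+

lemma F_free_retract: "free_retract A {..n} (F n)"
  unfolding F_def by (rule free_module_free_retract) (rule M.ring_axioms)

lemma from_F_ex: "\<exists>\<psi>. (\<forall>n. \<psi> n \<in> module_hom A (F n) (P n)) \<and> (\<forall>v\<in>carrier (F 0). e (\<psi> 0 v) = eF v) \<and>
    (\<forall>n. \<forall>v\<in>carrier (F (Suc n)). d n (\<psi> (Suc n) v) = \<psi> n (dF n v))"
  by (rule chain_map_lift[where C = F and b = dF and X = "\<lambda>n. {..n}" and g = eF, OF P_exact F_free_retract dF_hom dF_dF eF_hom exact_augmentedD(8)[OF F_exact]]) blast+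

text \<open>One comparison map is fixed once and for all, because the dual vectors of all degrees
  have to be pulled back along the same chain map.\<close>

definition "\<phi> = (SOME \<phi>. (\<forall>n. \<phi> n \<in> module_hom A (P n) (F n)) \<and> (\<forall>x\<in>carrier (P 0). eF (\<phi> 0 x) = e x) \<and>
    (\<forall>n. \<forall>x\<in>carrier (P (Suc n)). dF n (\<phi> (Suc n) x) = \<phi> n (d n x)))"

definition "\<psi> = (SOME \<psi>. (\<forall>n. \<psi> n \<in> module_hom A (F n) (P n)) \<and> (\<forall>v\<in>carrier (F 0). e (\<psi> 0 v) = eF v) \<and>
    (\<forall>n. \<forall>v\<in>carrier (F (Suc n)). d n (\<psi> (Suc n) v) = \<psi> n (dF n v)))"

lemma \<phi>:
  shows "\<phi> n \<in> module_hom A (P n) (F n)" "x \<in> carrier (P 0) \<Longrightarrow> eF (\<phi> 0 x) = e x"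
    "y \<in> carrier (P (Suc n)) \<Longrightarrow> dF n (\<phi> (Suc n) y) = \<phi> n (d n y)"
  using someI_ex[OF to_F_ex] unfolding \<phi>_def[symmetric] by auto

lemma \<psi>:
  shows "\<psi> n \<in> module_hom A (F n) (P n)" "v \<in> carrier (F 0) \<Longrightarrow> e (\<psi> 0 v) = eF v"
    "w \<in> carrier (F (Suc n)) \<Longrightarrow> d n (\<psi> (Suc n) w) = \<psi> n (dF n w)"
  using someI_ex[OF from_F_ex] unfolding \<psi>_def[symmetric] by auto

lemmas \<phi>_closed = module_homD(2)[OF \<phi>(1)]
lemmas \<psi>_closed = module_homD(2)[OF \<psi>(1)]
lemmas shift_closed = module_homD(2)[OF shift_hom]

text \<open>The class dual to the basis element of bidegree (j, n - j), read on the given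
  resolution.\<close>

definition dual_vector :: "nat \<Rightarrow> nat \<Rightarrow> 'm \<Rightarrow> 'n" where
  "dual_vector n j = (\<lambda>x\<in>carrier (P n). coordinate n j (\<phi> n x))"

lemma dual_vector_cocycle: "dual_vector n j \<in> Z n"
  using module_hom_compose[OF P_left_module \<phi>(1) coordinate_hom, of n j] coordinate_dF \<phi>(3) \<phi>_closed
  by (simp add: cocycles_def dual_vector_def d_closed flip: \<phi>(3))

text \<open>For \<open>n \<ge> 3\<close> one of \<open>j\<close> and \<open>n - j\<close> is at
  least 2, so the coordinate is the composite of a shift with a coordinate of degree
  \<open>n - 2\<close>. The shift lifts the dual vector of bidegree (2, 0) or (0, 2), hence this
  composite is a product. Bidegree (1, 1) is out of reach of the shifts, which is why all of degree
  2 is among the generators.\<close>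

lemma dual_vector_generated:
  assumes "j \<le> n"
  shows "(n, dual_vector n j) \<in> generated {(n, dual_vector n j) | n j. n \<le> 2 \<and> j \<le> n}"
    (is "_ \<in> generated ?T")
  using assms
proof (induction n arbitrary: j rule: less_induct)
  case (less n)
  show ?case
  proof (cases "n \<le> 2")
    case True
    then show ?thesis using less.prems dual_vector_cocycle by (intro generated.base) auto
  next
    case False
    define k where "k = n - 2"
    have n: "n = Suc (Suc k)" "1 \<le> k" using False by (auto simp: k_def)
    define s where "s \<longleftrightarrow> 2 \<le> j"
    define i where "i = (if s then j - 2 else j)"
    have i: "i \<le> k" using n less.prems by (auto simp: i_def s_def)
    have coord: "coordinate k i (shift s k v) = coordinate n j v" if "v \<in> carrier (F n)" for v
      using that shift_closed[of v k s] i n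
      by (auto simp: coordinate_def shift_def i_def s_def numeral_2_eq_2 Suc_diff_Suc Suc_le_eq)
    define l where "l = (if s then 2 else 0 :: nat)"
    have coord0: "eF (shift s 0 v) = coordinate 2 l v" if "v \<in> carrier (F 2)" for v
      using that shift_closed[of v 0 s] by (auto simp: eF_def coordinate_def shift_def l_def numeral_2_eq_2)
    \<comment> \<open>The shift transported to the given resolution; by \<open>coord0\<close> it
      lifts the dual vector of degree 2.\<close>
    define G where "G r = (\<lambda>x\<in>carrier (P (2 + r)). \<psi> r (shift s r (\<phi> (2 + r) x)))" for r
    have sphi: "(\<lambda>x\<in>carrier (P (2 + r)). shift s r (\<phi> (2 + r) x)) \<in> module_hom A (P (2 + r)) (F r)" for r
      using module_hom_compose[OF P_left_module \<phi>(1) shift_hom[of s r]] by simp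
    have sphi_closed: "shift s r (\<phi> (Suc (Suc r)) x) \<in> carrier (F r)" if "x \<in> carrier (P (Suc (Suc r)))" for r x
      using shift_closed[OF \<phi>_closed[OF that]] .
    have G_hom: "G r \<in> module_hom A (P (2 + r)) (P r)" for r
      using module_hom_compose[OF P_left_module sphi \<psi>(1), of r]
      by (simp add: G_def cong: restrict_cong)
    have sphi_d: "dF r (shift s (Suc r) (\<phi> (Suc (Suc (Suc r))) x)) = shift s r (\<phi> (Suc (Suc r)) (d (Suc (Suc r)) x))"
      if "x \<in> carrier (P (Suc (Suc (Suc r))))" for r x
      using dF_shift[OF \<phi>_closed[OF that]] \<phi>(3)[OF that] by simp
    have G_lift: "G \<in> lifts A P d e 2 (dual_vector 2 l)"
      unfolding lifts_def
    proof (intro CollectI conjI allI ballI)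
      show "G r \<in> module_hom A (P (2 + r)) (P r)" for r by (rule G_hom)
      fix x assume x: "x \<in> carrier (P 2)"
      then have "\<phi> 2 x \<in> carrier (F 2)" "shift s 0 (\<phi> 2 x) \<in> carrier (F 0)"
        using \<phi>_closed[of x 2] sphi_closed[of x 0] by (simp_all add: numeral_2_eq_2)
      then show "e (G 0 x) = dual_vector 2 l x"
        using x coord0 by (simp add: G_def \<psi>(2) dual_vector_def)
    next
      fix r x assume x: "x \<in> carrier (P (2 + Suc r))"
      then show "d r (G (Suc r) x) = G r (d (2 + r) x)"
        using sphi_d[of x r] sphi_closed[of x "Suc r"] d_closed[of x "Suc (Suc r)"] by (simp add: G_def \<psi>(3))
    qed
    have "(k, dual_vector k i) \<in> generated ?T" using less.IH i n by simp
    moreover have "(2, dual_vector 2 l) \<in> generated ?T"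
      using dual_vector_cocycle by (intro generated.base) (auto simp: l_def)
    ultimately have prod: "(2 + k, compose (carrier (P (2 + k))) (dual_vector k i) (G k)) \<in> generated ?T"
      using G_lift by (rule generated.mult)
    let ?p = "compose (carrier (P (2 + k))) (dual_vector k i) (G k)"
    \<comment> \<open>The composite of \<psi> and \<phi> on the double complex is the identity only
      up to homotopy. But \<phi> after \<open>G\<close> and the shift after \<phi> cover the same
      map to \<open>M\<close>, so their difference covers zero and the coordinate of it is a
      coboundary.\<close>
    define H where "H r = (\<lambda>x\<in>carrier (P (2 + r)).
      (\<lambda>x\<in>carrier (P (2 + r)). \<phi> r (G r x)) x \<ominus>\<^bsub>F r\<^esub> (\<lambda>x\<in>carrier (P (2 + r)). shift s r (\<phi> (2 + r) x)) x)" for r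
    have H_hom: "H r \<in> module_hom A (P (2 + r)) (F r)" for r
      unfolding H_def
      using P_left_module F_left_module module_hom_compose[OF P_left_module G_hom \<phi>(1)] sphi
      by (rule module_hom_diff)
    have minus: "h (H r x) = h (\<phi> r (G r x)) \<ominus>\<^bsub>N\<^esub> h (shift s r (\<phi> (Suc (Suc r)) x))"
      if "x \<in> carrier (P (Suc (Suc r)))" "left_module A N" "h \<in> module_hom A (F r) N" for h r x and N :: "('a, 'z) module"
    proof -
      have "G r x \<in> carrier (P r)" using module_homD(2)[OF G_hom, of x r] that(1) by simp
      from module_hom_minus[OF F_left_module that(2,3) \<phi>_closed[OF this] sphi_closed[OF that(1)]] that(1)
      show ?thesis by (simp add: H_def)
    qed
    have dual_G: "?p x = coordinate k i (\<phi> k (G k x))" if "x \<in> carrier (P (Suc (Suc k)))" for x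
      using that module_homD(2)[OF G_hom, of x k] by (simp add: compose_def dual_vector_def)
    have "(\<lambda>x\<in>carrier (P (2 + k)). coordinate k i (H k x)) \<in> B (2 + k)"
    proof (rule null_chain_map_coboundary[OF F_exact coordinate_hom coordinate_dF H_hom])
      fix r x assume "x \<in> carrier (P (2 + Suc r))"
      then have x: "x \<in> carrier (P (Suc (Suc (Suc r))))" by simp
      have "G (Suc r) x \<in> carrier (P (Suc r))" "d (Suc (Suc r)) x \<in> carrier (P (Suc (Suc r)))"
        using module_homD(2)[OF G_hom, of x "Suc r"] d_closed[OF x] x by simp_all
      then show "dF r (H (Suc r) x) = H r (d (2 + r) x)"
        using minus[OF x F_left_module dF_hom] sphi_d[OF x] liftsD(3)[OF G_lift, of x r] x
        by (simp add: H_def \<phi>(3))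
    next
      have "eF (H 0 x) = \<zero>\<^bsub>M\<^esub>" if "x \<in> carrier (P 2)" for x
      proof -
        have x: "x \<in> carrier (P (Suc (Suc 0)))" using that by (simp add: numeral_2_eq_2)
        have "eF (H 0 x) = eF (\<phi> 0 (G 0 x)) \<ominus>\<^bsub>M\<^esub> eF (shift s 0 (\<phi> (Suc (Suc 0)) x))"
          using minus[OF x M eF_hom] .
        also have "eF (\<phi> 0 (G 0 x)) = eF (shift s 0 (\<phi> (Suc (Suc 0)) x))"
          using x module_homD(2)[OF G_hom, of x 0] sphi_closed[OF x]
          by (simp add: \<phi>(2) G_def \<psi>(2) numeral_2_eq_2)
        finally show ?thesis
          using module_homD(2)[OF eF_hom sphi_closed[OF x]] by (simp add: M.M.minus_eq M.M.r_neg)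
      qed
      then have "(\<lambda>x\<in>carrier (P 2). eF (H 0 x)) = zero_cochain 2" by (intro restrict_ext) simp
      then show "(\<lambda>x\<in>carrier (P 2). eF (H 0 x)) \<in> B 2" using zero_coboundary by simp
    qed
    moreover have "coordinate k i (H k x) = ?p x \<ominus>\<^bsub>M\<^esub> dual_vector n j x" if "x \<in> carrier (P (2 + k))" for x
      using that minus[of x k M, OF _ M coordinate_hom] dual_G coord \<phi>_closed[of x n]
      by (simp add: n dual_vector_def)
    ultimately have "(\<lambda>x\<in>carrier (P (2 + k)). ?p x \<ominus>\<^bsub>M\<^esub> dual_vector n j x) \<in> B (2 + k)"
      by (simp cong: restrict_cong)
    with prod dual_vector_cocycle[of n j] show ?thesis
      using generated.cohomologous[of "2 + k" ?p ?T "dual_vector n j"] by (simp add: n)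
  qed
qed

text \<open>A homomorphism into \<open>M\<close> is determined by its values on the unit vectors,
  and \<open>m_spans\<close> makes these scalar multiples of \<open>m\<close>; it is therefore a
  scalar combination of coordinates.\<close>

lemma pullback_generated:
  assumes h: "h \<in> module_hom A (F n) M"
  shows "(n, \<lambda>x\<in>carrier (P n). h (\<phi> n x)) \<in> generated {(n, dual_vector n j) | n j. n \<le> 2 \<and> j \<le> n}"
    (is "_ \<in> generated ?T")
proof -
  have uv: "unit_vector A j \<in> carrier (F n)" if "j \<le> n" for j
    unfolding F_def using that by (intro M.unit_vector_closed) simp
  have "\<exists>c. h (unit_vector A j) = \<iota> c \<odot>\<^bsub>M\<^esub> m" if "j \<le> n" for j
    using m_spans[OF module_homD(2)[OF h uv[OF that]]] .
  then obtain c where c: "\<And>j. j \<le> n \<Longrightarrow> h (unit_vector A j) = \<iota> (c j) \<odot>\<^bsub>M\<^esub> m" by metis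
  \<comment> \<open>The partial sums of this combination, so that the rule \<open>add\<close> can be
    applied one term at a time.\<close>
  define K where "K = rec_nat (\<lambda>v\<in>carrier (F n). \<zero>\<^bsub>M\<^esub>)
    (\<lambda>t k. \<lambda>v\<in>carrier (F n). k v \<oplus>\<^bsub>M\<^esub> \<iota> (c t) \<odot>\<^bsub>M\<^esub> coordinate n t v)"
  have K0: "K 0 = (\<lambda>v\<in>carrier (F n). \<zero>\<^bsub>M\<^esub>)"
    and KS: "K (Suc t) = (\<lambda>v\<in>carrier (F n). K t v \<oplus>\<^bsub>M\<^esub> \<iota> (c t) \<odot>\<^bsub>M\<^esub> coordinate n t v)" for t
    by (simp_all add: K_def)
  note coord = module_homD[OF coordinate_hom]
  have K: "K t \<in> module_hom A (F n) M" for t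
  proof (induction t)
    case 0
    show ?case unfolding K0 by (rule restrict_module_homI[OF F_left_module]) (auto simp: M.smult_r_zero)
  next
    case (Suc t)
    note K = module_homD[OF Suc]
    show ?case unfolding KS
      by (rule restrict_module_homI[OF F_left_module])
        (simp_all add: K coord M.smult_closed scalar_closed M.smult_r_distr scalar_commute M.M.a_ac)
  qed
  have K_unit: "K t (unit_vector A j) = (if j < t then \<iota> (c j) \<odot>\<^bsub>M\<^esub> m else \<zero>\<^bsub>M\<^esub>)" if "j \<le> n" for t j
  proof (induction t)
    case (Suc t)
    have "coordinate n t (unit_vector A j) = (if j = t then m else \<zero>\<^bsub>M\<^esub>)"
      using uv[OF that] by (auto simp: coordinate_def unit_vector_def M.smult_one M.smult_l_zero m_closed)
    then show ?case
      using uv[OF that] Suc by (auto simp: KS M.smult_r_zero scalar_closed M.smult_closed m_closed less_Suc_eq)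
  qed (use uv[OF that] in \<open>simp add: K0\<close>)
  have eq: "h v = K (Suc n) v" if "v \<in> carrier (F n)" for v
  proof (rule M.free_module_hom_eqI[of h "{..n}" M "K (Suc n)"])
    show "h \<in> module_hom A (free_module A {..n}) M" "K (Suc n) \<in> module_hom A (free_module A {..n}) M"
      "v \<in> carrier (free_module A {..n})"
      using h K that by (simp_all add: F_def)
  qed (use M c K_unit in auto)
  have "(n, \<lambda>x\<in>carrier (P n). K t (\<phi> n x)) \<in> generated ?T" if "t \<le> Suc n" for t
    using that
  proof (induction t)
    case 0
    have "(\<lambda>x\<in>carrier (P n). K 0 (\<phi> n x)) = zero_cochain n"
      by (intro restrict_ext) (simp add: K0 \<phi>_closed)
    then show ?case using generated.zero[of n ?T] by (simp only:)
  next
    case (Suc t)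
    have IH: "(n, \<lambda>x\<in>carrier (P n). K t (\<phi> n x)) \<in> generated ?T"
      using Suc.prems by (intro Suc.IH) simp
    have "(n, scale_cochain n (c t) (dual_vector n t)) \<in> generated ?T"
      using Suc.prems by (intro generated.scale dual_vector_generated) simp
    with IH have "(n, add_cochain n (\<lambda>x\<in>carrier (P n). K t (\<phi> n x)) (scale_cochain n (c t) (dual_vector n t))) \<in> generated ?T"
      by (rule generated.add)
    moreover have "add_cochain n (\<lambda>x\<in>carrier (P n). K t (\<phi> n x)) (scale_cochain n (c t) (dual_vector n t)) =
        (\<lambda>x\<in>carrier (P n). K (Suc t) (\<phi> n x))"
      by (intro restrict_ext) (simp add: KS \<phi>_closed dual_vector_def)
    ultimately show ?case by (simp only:)
  qed
  from this[of "Suc n"] show ?thesis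
    using eq \<phi>_closed by (simp cong: restrict_cong)
qed

text \<open>Since \<psi> after \<phi> covers the identity of \<open>M\<close>, it is homotopic to
  the identity, and every cocycle is cohomologous to one pulled back from the double
  complex.\<close>

theorem finitely_generated_ext: "finitely_generated_algebra E"
proof (rule finitely_generated_ext_algebra)
  let ?T = "{(n, dual_vector n j) | n j. n \<le> 2 \<and> j \<le> n}"
  have "?T \<subseteq> (\<lambda>(n, j). (n, dual_vector n j)) ` ({..2} \<times> {..2})" by auto
  then show "finite ?T" by (rule finite_subset) simp
  show "f \<in> Z n" if "(n, f) \<in> ?T" for n f using that dual_vector_cocycle by auto
  fix n f assume f: "f \<in> Z n"
  define h where "h = (\<lambda>v\<in>carrier (F n). f (\<psi> n v))"
  have h: "h \<in> module_hom A (F n) M"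
    unfolding h_def using F_left_module \<psi>(1) cocyclesD(1)[OF f] by (rule module_hom_compose)
  let ?p = "\<lambda>x\<in>carrier (P n). h (\<phi> n x)"
  define H where "H r = (\<lambda>x\<in>carrier (P r).
    (\<lambda>x\<in>carrier (P r). \<psi> r (\<phi> r x)) x \<ominus>\<^bsub>P r\<^esub> (\<lambda>x\<in>carrier (P r). x) x)" for r
  have H_hom: "H r \<in> module_hom A (P r) (P r)" for r
    unfolding H_def
  proof (rule module_hom_diff[OF P_left_module P_left_module])
    show "(\<lambda>x\<in>carrier (P r). \<psi> r (\<phi> r x)) \<in> module_hom A (P r) (P r)"
      using P_left_module \<phi>(1) \<psi>(1) by (rule module_hom_compose)
    show "(\<lambda>x\<in>carrier (P r). x) \<in> module_hom A (P r) (P r)"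
      by (rule restrict_module_homI[OF P_left_module]) auto
  qed
  have minus: "k (H r x) = k (\<psi> r (\<phi> r x)) \<ominus>\<^bsub>N\<^esub> k x"
    if "x \<in> carrier (P r)" "left_module A N" "k \<in> module_hom A (P r) N" for k r x and N :: "('a, 'z) module"
    using module_hom_minus[OF P_left_module that(2,3) \<psi>_closed[OF \<phi>_closed[OF that(1)]] that(1)] that(1)
    by (simp add: H_def)
  have "(\<lambda>x\<in>carrier (P (0 + n)). f (H n x)) \<in> B (0 + n)"
  proof (rule null_chain_map_coboundary[OF P_exact cocyclesD(1,2)[OF f]])
    show "H r \<in> module_hom A (P (0 + r)) (P r)" for r using H_hom by simp
    fix r x assume "x \<in> carrier (P (0 + Suc r))"
    then have x: "x \<in> carrier (P (Suc r))" by simp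
    then show "d r (H (Suc r) x) = H r (d (0 + r) x)"
      using minus[OF x P_left_module P_exactD(3)] d_closed[OF x] \<psi>(3)[OF \<phi>_closed[OF x]] \<phi>(3)[OF x]
      by (simp add: H_def)
  next
    have "e (H 0 x) = \<zero>\<^bsub>M\<^esub>" if x: "x \<in> carrier (P 0)" for x
      using minus[OF x M P_exactD(4)] \<phi>(2)[OF x] \<psi>(2)[OF \<phi>_closed[OF x]] module_homD(2)[OF P_exactD(4) x]
      by (simp add: M.M.minus_eq M.M.r_neg)
    then have "(\<lambda>x\<in>carrier (P 0). e (H 0 x)) = zero_cochain 0" by (intro restrict_ext) simp
    then show "(\<lambda>x\<in>carrier (P 0). e (H 0 x)) \<in> B 0" using zero_coboundary by simp
  qed
  moreover have "f (H n x) = ?p x \<ominus>\<^bsub>M\<^esub> f x" if "x \<in> carrier (P n)" for x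
    using minus[OF that M cocyclesD(1)[OF f]] that \<phi>_closed by (simp add: h_def)
  ultimately have "(\<lambda>x\<in>carrier (P n). ?p x \<ominus>\<^bsub>M\<^esub> f x) \<in> B n"
    by (simp cong: restrict_cong)
  with pullback_generated[OF h] f show "(n, f) \<in> generated ?T" by (rule generated.cohomologous)
qed

end

section \<open>A representation of \<open>A5(\<beta>)\<close>\<close>

lemma poly_mapping_single_induct [case_names zero add single]:
  fixes r :: "'w \<Rightarrow>\<^sub>0 'b::comm_monoid_add"
  assumes "Q 0" and "\<And>r s. Q r \<Longrightarrow> Q s \<Longrightarrow> Q (r + s)" and "\<And>w c. Q (Poly_Mapping.single w c)"
  shows "Q r"
proof (induction r rule: update_induct)
  case const
  then show ?case by (rule assms(1))
next
  case (update f w c)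
  have "Poly_Mapping.update w c f = f + Poly_Mapping.single w c"
    using update(1) by (intro poly_mapping_eqI) (auto simp: lookup_update lookup_add lookup_single in_keys_iff when_def)
  then show ?case using assms(2,3) update(3) by simp
qed

section \<open>The free algebra acting on functionals\<close>

type_synonym 'k grid = "nat \<Rightarrow> nat \<Rightarrow> nat \<Rightarrow> 'k"

text \<open>A function \<open>f\<close> on \<open>nat\<^sup>3\<close> is thought of as a linear functional with value \<open>f i j l\<close> at
  \<open>z\<^sup>i y\<^sup>j x\<^sup>l\<close>, where \<open>x = [y, z]\<close>. The algebra acts on functionals from the right, and these are the
  resulting operators.\<close>

definition op_z :: "'k::field grid \<Rightarrow> 'k grid" where
  "op_z f = (\<lambda>i j l. f (Suc i) j l)"

text \<open>This encodes y z^i = z^i y + i z^(i-1) x. At \<open>i = 0\<close> the truncated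
  \<open>i - 1\<close> is harmless because of the factor \<open>of_nat i\<close>.\<close>

definition op_y :: "'k::field grid \<Rightarrow> 'k grid" where
  "op_y f = (\<lambda>i j l. f i (Suc j) l + of_nat i * f (i - 1) j (Suc l))"

definition op_x :: "'k::field grid \<Rightarrow> 'k grid" where
  "op_x f = (\<lambda>i j l. f i j (Suc l))"

primrec op_gen :: "generator \<Rightarrow> 'k::field grid \<Rightarrow> 'k grid" where
  "op_gen Gen_z = op_z"
| "op_gen Gen_y = op_y"

primrec op_word :: "generator list \<Rightarrow> 'k::field grid \<Rightarrow> 'k grid" where
  "op_word [] f = f"
| "op_word (g # w) f = op_word w (op_gen g f)"

definition act :: "'k::field free_algebra \<Rightarrow> 'k grid \<Rightarrow> 'k grid" where
  "act r f = (\<lambda>i j l. \<Sum>w\<in>Poly_Mapping.keys r. Poly_Mapping.lookup r w * op_word (letters w) f i j l)"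

abbreviation grid_add :: "'k::field grid \<Rightarrow> 'k grid \<Rightarrow> 'k grid" where
  "grid_add f g \<equiv> \<lambda>i j l. f i j l + g i j l"
abbreviation grid_scale :: "'k::field \<Rightarrow> 'k grid \<Rightarrow> 'k grid" where
  "grid_scale c f \<equiv> \<lambda>i j l. c * f i j l"

lemma op_gen_linear:
  "op_gen g (grid_add f h) = grid_add (op_gen g f) (op_gen g h)"
  "op_gen g (grid_scale c f) = grid_scale c (op_gen g f)"
  by (cases g; simp add: op_z_def op_y_def fun_eq_iff algebra_simps)+

lemma op_word_linear:
  "op_word w (grid_add f h) = grid_add (op_word w f) (op_word w h)"
  "op_word w (grid_scale c f) = grid_scale c (op_word w f)"
  by (induction w arbitrary: f h) (simp_all add: op_gen_linear)

lemma op_word_append: "op_word (v @ w) f = op_word w (op_word v f)"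
  by (induction v arbitrary: f) simp_all

lemma act_add: "act (r + s) f = grid_add (act r f) (act s f)"
  unfolding act_def by (intro ext setsum_keys_plus_distrib) (simp_all add: algebra_simps)

lemma act_single: "act (Poly_Mapping.single w c) f = grid_scale c (op_word (letters w) f)"
  by (simp add: act_def)

lemma act_zero: "act 0 f = (\<lambda>i j l. 0)"
  by (simp add: act_def)

lemma act_linear:
  "act r (grid_add f h) = grid_add (act r f) (act r h)"
  "act r (grid_scale c f) = grid_scale c (act r f)"
  by (simp_all add: act_def op_word_linear algebra_simps sum.distrib sum_distrib_left)

text \<open>The left factor acts first because this is a right action: the value of
  \<open>act r f\<close> at a monomial is the value of the functional at r times that
  monomial.\<close>

lemma act_mult: "act (r * s) f = act s (act r f)"
proof (induction r rule: poly_mapping_single_induct)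
  case zero
  show ?case using act_linear(2)[of s 0 "\<lambda>_ _ _. 0"] by (simp add: act_zero)
next
  case (add r t)
  then show ?case by (simp add: distrib_right act_add act_linear)
next
  case (single v c)
  show ?case
  proof (induction s rule: poly_mapping_single_induct)
    case (single w c')
    show ?case
      by (simp add: mult_single act_single op_word_linear plus_free_monoid_def op_word_append mult.left_commute mult.assoc)
  qed (simp_all add: act_zero distrib_left act_add)
qed

lemma act_uminus: "act (- r) f = grid_scale (- 1) (act r f)"
  by (simp add: act_def sum_negf)

lemma act_diff: "act (r - s) f = (\<lambda>i j l. act r f i j l - act s f i j l)"
  using act_add[of r "- s" f] by (simp add: act_uminus)

lemma act_power: "act (r ^ n) f = (act r ^^ n) f"
proof (induction n arbitrary: f)
  case 0
  have "act 1 f = grid_scale 1 (op_word (letters 0) f)" using act_single[of 0 1 f] by simp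
  then show ?case by (simp add: zero_free_monoid_def)
next
  case (Suc n)
  then show ?case by (simp add: act_mult funpow_swap1)
qed

lemma act_gens: "act free_z = op_z" "act free_y = op_y" "act (scalar c) = grid_scale c"
  by (auto simp: act_single zero_free_monoid_def fun_eq_iff)

lemma act_x: "act (commutator free_y free_z) = op_x"
proof
  fix f :: "'k::field grid"
  \<comment> \<open>At \<open>i = 0\<close> truncated subtraction makes \<open>Suc (i - 1)\<close>
    equal to 1, but the coefficient of that term is zero.\<close>
  have "of_nat (Suc i) * f i j l - of_nat i * f (Suc (i - 1)) j l = f i j l" for i j l
    by (cases i) (simp_all add: algebra_simps)
  then show "act (commutator free_y free_z) f = op_x f"
    by (simp add: commutator_def act_diff act_mult act_gens op_x_def op_y_def op_z_def fun_eq_iff algebra_simps)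
qed

lemma op_x_power: "(op_x ^^ n) f i j l = f i j (l + n)"
  by (induction n arbitrary: l) (simp_all add: op_x_def)

lemma op_z_power: "(op_z ^^ n) f i j l = f (i + n) j l"
  by (induction n arbitrary: i) (simp_all add: op_z_def)

lemma op_y_power_0: "(op_y ^^ n) f 0 j l = f 0 (j + n) l"
  by (induction n arbitrary: j) (simp_all add: op_y_def)

text \<open>The operator form of y^(n+1) z = z y^(n+1) + (n+1) y^n x. In characteristic p it shows
  that y^p commutes with z.\<close>

lemma op_z_op_y_power:
  "op_z ((op_y ^^ Suc n) f) = grid_add ((op_y ^^ Suc n) (op_z f)) (grid_scale (of_nat (Suc n)) ((op_y ^^ n) (op_x f)))"
proof (induction n)
  case 0
  have "of_nat (Suc i) * f i j l = of_nat i * f (Suc (i - 1)) j l + f i j l" for i j l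
    by (cases i) (simp_all add: algebra_simps)
  then show ?case by (simp add: op_z_def op_y_def op_x_def fun_eq_iff algebra_simps)
next
  case (Suc n)
  have zy: "op_z (op_y g) = grid_add (op_y (op_z g)) (op_x g)" for g :: "'a grid"
  proof -
    have "of_nat (Suc i) * g i j l = of_nat i * g (Suc (i - 1)) j l + g i j l" for i j l
      by (cases i) (simp_all add: algebra_simps)
    then show ?thesis by (simp add: op_z_def op_y_def op_x_def fun_eq_iff algebra_simps)
  qed
  have xy: "op_x ((op_y ^^ n) g) = (op_y ^^ n) (op_x g)" for n and g :: "'a grid"
    by (induction n) (simp_all add: op_y_def op_x_def fun_eq_iff)
  have "op_z ((op_y ^^ Suc (Suc n)) f) = grid_add (op_y (op_z ((op_y ^^ Suc n) f))) (op_x ((op_y ^^ Suc n) f))"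
    using zy by simp
  also have "\<dots> = grid_add ((op_y ^^ Suc (Suc n)) (op_z f))
      (grid_add (grid_scale (of_nat (Suc n)) ((op_y ^^ Suc n) (op_x f))) ((op_y ^^ Suc n) (op_x f)))"
    unfolding Suc xy by (simp add: op_gen_linear[of Gen_y, unfolded op_gen.simps] add.assoc)
  finally show ?case by (simp add: fun_eq_iff algebra_simps)
qed

section \<open>Functionals on the quotient and a nonzero socle element\<close>

locale a5 =
  fixes p :: nat and \<beta> :: "'k::field"
  assumes prime: "prime p" and p_ge_3: "p \<ge> 3" and char: "CHAR('k) = p" and \<beta>_nonzero: "\<beta> \<noteq> 0"
begin

lemma of_nat_p [simp]: "(of_nat p :: 'k) = 0"
  using of_nat_CHAR[where 'a = 'k] char by simp

text \<open>A model of the linear forms on A: the conditions express x^p = y^p = 0 and z^p = \<beta>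
  x - y x^(p-1) on monomials, while centrality of x is built into the operators.\<close>

definition functionals :: "'k grid set" where
  "functionals = {f. (\<forall>i j l. p \<le> j \<or> p \<le> l \<longrightarrow> f i j l = 0) \<and>
     (\<forall>i j l. f (i + p) j l = \<beta> * f i j (Suc l) - f i (Suc j) (l + (p - 1)))}"

lemma functionalsD:
  assumes "f \<in> functionals"
  shows "p \<le> j \<or> p \<le> l \<Longrightarrow> f i j l = 0" "f (i + p) j l = \<beta> * f i j (Suc l) - f i (Suc j) (l + (p - 1))"
  using assms by (auto simp: functionals_def)

text \<open>Stability under y depends on the characteristic: the factor
  \<open>of_nat (i + p)\<close> has to equal \<open>of_nat i\<close>.\<close>

lemma functionals_op_gen:
  assumes f: "f \<in> functionals"
  shows "op_gen g f \<in> functionals"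
proof (cases g)
  case Gen_z
  then show ?thesis using functionalsD(1)[OF f] functionalsD(2)[OF f, of "Suc _"]
    by (auto simp: functionals_def op_z_def)
next
  case Gen_y
  have "op_y f (i + p) j l = \<beta> * op_y f i j (Suc l) - op_y f i (Suc j) (l + (p - 1))" for i j l
  proof (cases i)
    case 0
    then show ?thesis using functionalsD(2)[OF f, of 0 "Suc j" l] by (simp add: op_y_def)
  next
    case (Suc k)
    have "op_y f (i + p) j l = f (i + p) (Suc j) l + of_nat (Suc k) * f (k + p) j (Suc l)"
      using Suc by (simp add: op_y_def)
    also have "\<dots> = \<beta> * (f i (Suc j) (Suc l) + of_nat (Suc k) * f k j (Suc (Suc l))) -
        (f i (Suc (Suc j)) (l + (p - 1)) + of_nat (Suc k) * f k (Suc j) (Suc l + (p - 1)))"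
      unfolding functionalsD(2)[OF f] by (simp add: algebra_simps del: of_nat_Suc)
    finally show ?thesis using Suc by (simp add: op_y_def)
  qed
  then show ?thesis using functionalsD(1)[OF f] Gen_y by (simp add: functionals_def op_y_def)
qed

lemma functionals_act:
  assumes f: "f \<in> functionals"
  shows "act r f \<in> functionals"
proof (induction r rule: poly_mapping_single_induct)
  case zero
  show ?case by (simp add: act_zero functionals_def)
next
  case (add r s)
  then show ?case by (simp add: act_add functionals_def algebra_simps)
next
  case (single w c)
  have "op_word v f \<in> functionals" for v
    using f by (induction v arbitrary: f) (simp_all add: functionals_op_gen)
  note v = functionalsD[OF this]
  show ?case
    by (simp add: act_single functionals_def v right_diff_distrib mult.left_commute)
qed

lemma act_relation:
  assumes f: "f \<in> functionals" and r: "r \<in> A5_relations p \<beta>"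
  shows "act r f = (\<lambda>i j l. 0)"
proof -
  let ?x = "commutator free_y free_z :: 'k free_algebra"
  have zy: "commutator free_z free_y = - ?x" by (simp add: commutator_def)
  have xy: "op_x (op_y f) = op_y (op_x f)" and xz: "op_x (op_z f) = op_z (op_x f)"
    by (simp_all add: op_x_def op_y_def op_z_def)
  consider "r = ?x ^ p" | "r = free_y ^ p" | "r = commutator (- ?x) free_y" | "r = commutator (- ?x) free_z"
    | "r = free_z ^ p + free_y * ?x ^ (p - 1) - scalar \<beta> * ?x"
    using r unfolding A5_relations_def Let_def zy by blast
  then show ?thesis
  proof cases
    case 1
    then show ?thesis
      using functionalsD(1)[OF f] by (simp add: act_power act_x op_x_power fun_eq_iff)
  next
    case 2
    obtain q where q: "p = Suc q" using p_ge_3 by (cases p) auto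
    \<comment> \<open>At \<open>i = 0\<close> the operator of y only raises the second index, so y^p
      is easy to evaluate there. Commuting y^p with z^i reduces every \<open>i\<close> to this
      case.\<close>
    have comm: "op_z ((op_y ^^ p) g) = (op_y ^^ p) (op_z g)" for g :: "'k grid"
      using op_z_op_y_power[of q g] of_nat_p unfolding q by (simp del: funpow.simps of_nat_Suc)
    have "(op_z ^^ i) ((op_y ^^ p) f) = (op_y ^^ p) ((op_z ^^ i) f)" for i
      by (induction i) (simp_all add: comm)
    then have "(op_y ^^ p) f i j l = (op_y ^^ p) ((op_z ^^ i) f) 0 j l" for i j l
      using op_z_power[of i "(op_y ^^ p) f" 0 j l] by simp
    also have "\<dots> i j l = f i (j + p) l" for i j l by (simp add: op_y_power_0 op_z_power)
    finally show ?thesis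
      using 2 functionalsD(1)[OF f] by (simp add: act_power act_gens fun_eq_iff)
  next
    case 3
    then show ?thesis
      using xy op_gen_linear(2)[of Gen_y "- 1" "op_x f"]
      by (simp add: commutator_def[of "- _"] act_diff act_mult act_uminus act_x act_gens)
  next
    case 4
    then show ?thesis
      using xz op_gen_linear(2)[of Gen_z "- 1" "op_x f"]
      by (simp add: commutator_def[of "- _"] act_diff act_mult act_uminus act_x act_gens)
  next
    case 5
    \<comment> \<open>After x^(p-1) the correction term of \<open>op_y\<close> sits at an exponent
      of x that is at least p, where functionals vanish.\<close>
    have "l + (p - 1) + 1 \<ge> p" for l by simp
    then have "f (i - 1) j (Suc (l + (p - 1))) = 0" for i j l
      using functionalsD(1)[OF f] by (metis Suc_eq_plus1)
    then have "(op_x ^^ (p - 1)) (op_y f) i j l = f i (Suc j) (l + (p - 1))" for i j l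
      unfolding op_x_power by (simp add: op_y_def)
    moreover have "(op_z ^^ p) f i j l = \<beta> * f i j (Suc l) - f i (Suc j) (l + (p - 1))" for i j l
      using functionalsD(2)[OF f] by (simp add: op_z_power)
    ultimately show ?thesis
      unfolding 5 by (simp add: act_diff act_add act_mult act_power act_x act_gens op_x_def[of f] op_x_def[of "grid_scale _ f"])
  qed
qed

text \<open>The annihilator of a set of functionals that is stable under the action is a two-sided
  ideal; stability is what closes it under multiplication from the left.\<close>

lemma act_ideal:
  assumes r: "r \<in> A5_ideal p \<beta>" and f: "f \<in> functionals"
  shows "act r f = (\<lambda>i j l. 0)"
proof -
  define K where "K = {r :: 'k free_algebra. \<forall>f\<in>functionals. act r f = (\<lambda>i j l. 0)}"
  have zero: "act s (\<lambda>i j l. 0) = (\<lambda>i j l. 0)" for s :: "'k free_algebra"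
    using act_linear(2)[of s 0 "\<lambda>_ _ _. 0"] by simp
  have "ideal K type_ring"
  proof (rule idealI[OF ring_type_ring])
    have grp: "group (add_monoid (type_ring :: 'k free_algebra ring))"
      by (rule abelian_group.a_group[OF ring.is_abelian_group[OF ring_type_ring]])
    show "subgroup K (add_monoid type_ring)"
    proof (rule group.subgroupI[OF grp])
      fix r :: "'k free_algebra"
      assume "r \<in> K"
      moreover have "inv\<^bsub>add_monoid type_ring\<^esub> r = - r"
        by (rule group.inv_equality[OF grp]) simp_all
      ultimately show "inv\<^bsub>add_monoid type_ring\<^esub> r \<in> K" by (simp add: K_def act_uminus)
    qed (auto simp: K_def act_add act_zero intro: exI[of _ 0])
  qed (simp_all add: K_def act_mult zero functionals_act)
  moreover have "A5_relations p \<beta> \<subseteq> K" using act_relation by (auto simp: K_def)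
  ultimately have "A5_ideal p \<beta> \<subseteq> K"
    unfolding A5_ideal_def by (rule ring.genideal_minimal[OF ring_type_ring])
  then show ?thesis using r f by (auto simp: K_def)
qed

text \<open>The functional that takes the coefficient of \<open>z\<^sup>p\<^sup>-\<^sup>1 y\<^sup>p\<^sup>-\<^sup>1 x\<^sup>p\<^sup>-\<^sup>1\<close>; the recursion reduces powers
  \<open>z\<^sup>a\<^sup>p\<^sup>+\<^sup>b\<close> with \<open>z\<^sup>p = \<beta> x - y x\<^sup>p\<^sup>-\<^sup>1\<close>.\<close>

primrec top_coeff :: "nat \<Rightarrow> nat \<Rightarrow> nat \<Rightarrow> nat \<Rightarrow> 'k" where
  "top_coeff 0 b j l = (if b = p - 1 \<and> j = p - 1 \<and> l = p - 1 then 1 else 0)"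
| "top_coeff (Suc a) b j l = \<beta> * top_coeff a b j (Suc l) - top_coeff a b (Suc j) (l + (p - 1))"

lemma top_coeff_eq_0: "p \<le> j \<or> p \<le> l \<Longrightarrow> top_coeff a b j l = 0"
proof (induction a arbitrary: j l)
  case 0
  then show ?case using p_ge_3 by auto
next
  case (Suc a)
  have "p \<le> j \<or> p \<le> Suc l" "p \<le> Suc j \<or> p \<le> l + (p - 1)" using Suc.prems p_ge_3 by auto
  then show ?case using Suc.IH by simp
qed

lemma top_coeff_functional: "(\<lambda>i. top_coeff (i div p) (i mod p)) \<in> functionals"
  using p_ge_3 by (auto simp: functionals_def top_coeff_eq_0)

text \<open>At \<open>j = p - 1\<close> the second summand of the recursion has y-exponent p and
  vanishes, so every step contributes a factor \<beta> and raises the exponent of x by one.\<close>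

lemma top_coeff_power: "top_coeff a (p - 1) (p - 1) l = (if l + a = p - 1 then \<beta> ^ a else 0)"
  using p_ge_3 by (induction a arbitrary: l) (simp_all add: top_coeff_eq_0)

text \<open>Write p^2 - 1 = (p - 1) p + (p - 1). Next to y^(p-1) each z^p acts as \<beta> x, so the
  functional above takes the value \<beta>^(p-1) on this element.\<close>

lemma socle_nonzero: "free_z ^ (p * p - 1) * free_y ^ (p - 1) \<notin> A5_ideal p \<beta>"
proof
  assume "free_z ^ (p * p - 1) * free_y ^ (p - 1) \<in> A5_ideal p \<beta>"
  from fun_cong[OF fun_cong[OF fun_cong[OF act_ideal[OF this top_coeff_functional], of 0], of 0], of 0]
  have "top_coeff ((p * p - 1) div p) ((p * p - 1) mod p) (p - 1) 0 = 0"
    by (simp add: act_mult act_power act_gens op_y_power_0 op_z_power)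
  moreover have "p * p - 1 = (p - 1) + (p - 1) * p"
    using p_ge_3 by (cases p) auto
  then have "(p * p - 1) div p = p - 1" "(p * p - 1) mod p = p - 1"
    using p_ge_3 by (metis add.commute div_less div_mult_self1 add_0 diff_less gr0I less_numeral_extra(1) not_numeral_le_zero,
      metis mod_mult_self1 mod_less diff_less gr0I less_numeral_extra(1) not_numeral_le_zero)
  ultimately show False using \<beta>_nonzero top_coeff_power[of "p - 1" 0] by simp
qed

end

section \<open>Computations in \<open>A5(\<beta>)\<close>\<close>

lemma free_algebra_induct [case_names scalar add mult_z mult_y]:
  fixes r :: "'k::field free_algebra"
  assumes "\<And>c. Q (scalar c)" and "\<And>r s. Q r \<Longrightarrow> Q s \<Longrightarrow> Q (r + s)"
    and "\<And>r. Q r \<Longrightarrow> Q (r * free_z)" and "\<And>r. Q r \<Longrightarrow> Q (r * free_y)"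
  shows "Q r"
proof (induction r rule: poly_mapping_single_induct)
  case zero
  show ?case using assms(1)[of 0] by simp
next
  case (add r s)
  then show ?case by (rule assms(2))
next
  case (single w c)
  have "Q (Poly_Mapping.single (Word v) c)" for v
  proof (induction v rule: rev_induct)
    case Nil
    show ?case using assms(1)[of c] by (simp add: zero_free_monoid_def)
  next
    case (snoc g v)
    have "Poly_Mapping.single (Word (v @ [g])) c =
        Poly_Mapping.single (Word v) c * Poly_Mapping.single (Word [g]) 1"
      by (simp add: mult_single plus_free_monoid_def)
    with snoc assms(3,4) show ?case by (cases g) simp_all
  qed
  then show ?case by (cases w) simp
qed

lemma scalar_mult_commute: "r * scalar c = scalar c * (r :: 'k::field free_algebra)"
proof (induction r rule: poly_mapping_single_induct)
  case (add r s)
  then show ?case by (simp add: distrib_left distrib_right)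
qed (simp_all add: mult_single mult.commute)

lemma scalar_mult_left_commute: "r * (scalar c * s) = scalar c * (r * (s :: 'k::field free_algebra))"
  by (metis mult.assoc scalar_mult_commute)

text \<open>Here \<open>k\<close> is p - 2, so \<open>Suc k\<close> is p - 1 and the exponents can
  be written without subtraction.\<close>

locale a5_calculus = a5 p \<beta> for p :: nat and \<beta> :: "'k::field" +
  fixes k :: nat
  assumes p_eq: "p = Suc (Suc k)"
begin

lemma p_facts: "1 \<le> k" "p - 1 = Suc k" "p - Suc 0 = Suc k" "p \<le> Suc k + Suc k" "p \<le> k + Suc k"
  using p_ge_3 p_eq by auto

lemma power_p: "(r :: 'k free_algebra) ^ p = r ^ Suc k * r" "(r :: 'k free_algebra) ^ p = r * r ^ Suc k"
  by (simp only: p_eq power_Suc2) (simp only: p_eq power_Suc)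

abbreviation "I \<equiv> A5_ideal p \<beta>"

interpretation I: ideal I "type_ring :: 'k free_algebra ring"
  by (rule ideal_A5_ideal)

lemma I_closed:
  "0 \<in> I" "r \<in> I \<Longrightarrow> s \<in> I \<Longrightarrow> r + s \<in> I" "r \<in> I \<Longrightarrow> s * r \<in> I" "r \<in> I \<Longrightarrow> r * s \<in> I"
  "r \<in> I \<Longrightarrow> - r \<in> I" "r \<in> I \<Longrightarrow> s \<in> I \<Longrightarrow> r - s \<in> I"
proof -
  show zero: "0 \<in> I" using additive_subgroup.zero_closed[OF ideal.axioms(1)[OF ideal_A5_ideal]] by fastforce
  show add: "r \<in> I \<Longrightarrow> s \<in> I \<Longrightarrow> r + s \<in> I" for r s
    using additive_subgroup.a_closed[OF ideal.axioms(1)[OF ideal_A5_ideal], of r p \<beta> s] by simp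
  show mult: "r \<in> I \<Longrightarrow> s * r \<in> I" for r s using I.I_l_closed[of r s] by simp
  show "r \<in> I \<Longrightarrow> r * s \<in> I" using I.I_r_closed[of r s] by simp
  show minus: "r \<in> I \<Longrightarrow> - r \<in> I" for r using mult[of r "- 1"] by simp
  show "r \<in> I \<Longrightarrow> s \<in> I \<Longrightarrow> r - s \<in> I" using add[of r "- s"] minus by simp
qed

text \<open>Computing in the free algebra modulo \<open>I\<close> keeps the simplification rules of
  the type class of rings available, which do not apply to the record of the quotient ring.\<close>

definition eqv :: "'k free_algebra \<Rightarrow> 'k free_algebra \<Rightarrow> bool" (infix \<open>\<sim>\<close> 50) where
  "r \<sim> s \<longleftrightarrow> r - s \<in> I"

lemma eqv_refl [simp, intro]: "r \<sim> r"
  by (simp add: eqv_def I_closed)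

lemma eqv_sym: "r \<sim> s \<Longrightarrow> s \<sim> r"
  using I_closed(5)[of "r - s"] by (simp add: eqv_def)

lemma eqv_trans [trans]: "r \<sim> s \<Longrightarrow> s \<sim> t \<Longrightarrow> r \<sim> t"
  using I_closed(2)[of "r - s" "s - t"] by (simp add: eqv_def)

lemma eqv_add: "r \<sim> s \<Longrightarrow> r' \<sim> s' \<Longrightarrow> r + r' \<sim> s + s'"
  using I_closed(2)[of "r - s" "r' - s'"] by (simp add: eqv_def algebra_simps)

lemma eqv_diff: "r \<sim> s \<Longrightarrow> r' \<sim> s' \<Longrightarrow> r - r' \<sim> s - s'"
  using I_closed(6)[of "r - s" "r' - s'"] by (simp add: eqv_def algebra_simps)

lemma eqv_mult: "r \<sim> s \<Longrightarrow> r' \<sim> s' \<Longrightarrow> r * r' \<sim> s * s'"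
proof -
  assume "r \<sim> s" "r' \<sim> s'"
  then have "(r - s) * r' + s * (r' - s') \<in> I" by (simp add: eqv_def I_closed)
  then show ?thesis by (simp add: eqv_def algebra_simps)
qed

lemma eqv_l: "r \<sim> s \<Longrightarrow> t * r \<sim> t * s"
  by (rule eqv_mult) auto

lemma eqv_r: "r \<sim> s \<Longrightarrow> r * t \<sim> s * t"
  by (rule eqv_mult) auto

lemma eqv_lr: "r \<sim> s \<Longrightarrow> t * r * t' \<sim> t * s * t'"
  by (intro eqv_l eqv_r)

text \<open>A certificate of congruence: the difference is displayed as a two-sided multiple of a
  known element of \<open>I\<close>, and only an identity in the free algebra remains to be
  checked.\<close>

lemma eqv_cert: "r \<sim> s \<Longrightarrow> t - t' = c * (r - s) * c' \<Longrightarrow> t \<sim> t'"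
  by (simp add: eqv_def I_closed)

lemma eqv_cert2: "r \<sim> s \<Longrightarrow> r' \<sim> s' \<Longrightarrow> t - t' = c * (r - s) * c' + b * (r' - s') * b' \<Longrightarrow> t \<sim> t'"
  by (simp add: eqv_def I_closed)

section \<open>Immediate consequences of the relations\<close>

definition "Z = (free_z :: 'k free_algebra)"
definition "Y = (free_y :: 'k free_algebra)"
definition "X = commutator Y Z"
definition "S c = scalar (c :: 'k)"

lemma S_move: "r * S c = S c * r" "r * (S c * s) = S c * (r * s)"
  unfolding S_def by (rule scalar_mult_commute scalar_mult_left_commute)+

text \<open>Instances are taken because the general rule, used for rewriting, could exchange two
  scalars forever.\<close>

lemmas S_simps = S_move[of X] S_move[of Y] S_move[of Z] S_move[of "X ^ _"] S_move[of "Y ^ _"] S_move[of "Z ^ _"]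

lemma S_mult: "S c * (S c' * r) = S (c * c') * r" "S c * S c' = S (c * c')" "S 1 = 1" "S 0 = 0"
  unfolding S_def by (simp_all add: mult_single flip: mult.assoc)

lemma YZ: "Z * Y = Y * Z - X"
  by (simp add: X_def commutator_def)

lemma relation: "r \<in> A5_relations p \<beta> \<Longrightarrow> r \<in> I"
  unfolding A5_ideal_def using ring.genideal_self[OF ring_type_ring, of "A5_relations p \<beta>"] by auto

lemma
  X_power_p: "X ^ p \<sim> 0" and Y_power_p: "Y ^ p \<sim> 0"
  and XY: "X * Y \<sim> Y * X" and XZ: "X * Z \<sim> Z * X"
  and Z_power_p: "Z ^ p \<sim> S \<beta> * X - Y * X ^ Suc k"
proof -
  have rel: "A5_relations p \<beta> = {X ^ p, Y ^ p, commutator (commutator Z Y) Y, commutator (commutator Z Y) Z,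
      Z ^ p + Y * X ^ Suc k - S \<beta> * X}"
    by (simp add: p_facts A5_relations_def Let_def Z_def Y_def X_def S_def)
  show "X ^ p \<sim> 0" "Y ^ p \<sim> 0" using relation[of "X ^ p"] relation[of "Y ^ p"] by (simp_all add: rel eqv_def)
  have zy: "commutator Z Y = - X" by (simp add: X_def commutator_def)
  have "commutator (- X) Y \<in> I" "commutator (- X) Z \<in> I"
    using relation by (simp_all add: rel zy)
  then have "- commutator (- X) Y \<in> I" "- commutator (- X) Z \<in> I" by (simp_all only: I_closed(5))
  then show "X * Y \<sim> Y * X" "X * Z \<sim> Z * X" by (simp_all add: eqv_def commutator_def)
  show "Z ^ p \<sim> S \<beta> * X - Y * X ^ Suc k"
    using relation[of "Z ^ p + Y * X ^ Suc k - S \<beta> * X"] by (simp add: rel eqv_def algebra_simps)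
qed

lemma X_central: "X * r \<sim> r * X"
proof (induction r rule: free_algebra_induct)
  case (scalar c)
  then show ?case by (simp add: scalar_mult_commute)
next
  case (add r s)
  then show ?case by (simp add: distrib_left distrib_right eqv_add)
next
  case (mult_z r)
  show ?case by (rule eqv_cert2[OF mult_z XZ, of _ _ 1 Z r 1]) (simp add: algebra_simps Z_def)
next
  case (mult_y r)
  show ?case by (rule eqv_cert2[OF mult_y XY, of _ _ 1 Y r 1]) (simp add: algebra_simps Y_def)
qed

lemma X_power_central: "X ^ n * r \<sim> r * X ^ n"
proof (induction n)
  case (Suc n)
  have "X ^ Suc n * r = X * (X ^ n * r)" by (simp add: mult.assoc)
  also have "\<dots> \<sim> X * (r * X ^ n)" using Suc by (rule eqv_l)
  also have "\<dots> = X * r * X ^ n" by (simp add: mult.assoc)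
  also have "\<dots> \<sim> r * X * X ^ n" by (rule eqv_r[OF X_central])
  finally show ?case by (simp add: mult.assoc)
qed simp

lemma X_power_0: "p \<le> n \<Longrightarrow> X ^ n \<sim> 0"
  using eqv_r[OF X_power_p, of "X ^ (n - p)"] by (simp flip: power_add)

lemma of_nat_p_free: "(of_nat p :: 'k free_algebra) = 0"
  by (simp flip: single_of_nat)

text \<open>By the last relation z^p is a multiple of x, and x^(p-1) times x is zero.\<close>

lemma XZp_0: "X ^ Suc k * (r * Z ^ p) \<sim> 0"
proof -
  have "X ^ Suc k * (r * Z ^ p) = X ^ Suc k * r * Z ^ p" by (simp add: mult.assoc)
  also have "\<dots> \<sim> r * X ^ Suc k * (S \<beta> * X - Y * X ^ Suc k)"
    by (intro eqv_mult X_power_central Z_power_p)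
  also have "\<dots> = S \<beta> * r * X ^ p - r * (X ^ Suc k * Y) * X ^ Suc k"
    by (simp add: power_p(1) S_simps S_move[of r] algebra_simps del: power_Suc)
  also have "\<dots> \<sim> S \<beta> * r * 0 - r * (Y * X ^ Suc k) * X ^ Suc k"
    by (intro eqv_diff eqv_l eqv_r X_power_p X_power_central)
  also have "r * (Y * X ^ Suc k) * X ^ Suc k = r * Y * X ^ (Suc k + Suc k)" by (simp only: power_add mult.assoc)
  also have "S \<beta> * r * 0 - r * Y * X ^ (Suc k + Suc k) = - (r * Y * X ^ (Suc k + Suc k))" by simp
  also have "\<dots> \<sim> - (r * Y * 0)"
    using eqv_diff[OF eqv_refl[of 0] eqv_l[OF X_power_0[OF p_facts(4)], of "r * Y"]] by simp
  finally show ?thesis by simp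
qed

lemma Z_power_Y: "Z ^ Suc n * Y \<sim> Y * Z ^ Suc n - of_nat (Suc n) * (X * Z ^ n)"
proof (induction n)
  case 0
  show ?case by (simp add: YZ)
next
  case (Suc n)
  have "Z ^ Suc (Suc n) * Y = Z * (Z ^ Suc n * Y)" by (simp add: mult.assoc)
  also have "\<dots> \<sim> Z * (Y * Z ^ Suc n - of_nat (Suc n) * (X * Z ^ n))" by (rule eqv_l[OF Suc])
  also have "\<dots> = Z * Y * Z ^ Suc n - of_nat (Suc n) * (Z * X * Z ^ n)"
    by (simp add: right_diff_distrib mult.assoc mult_of_nat_commute[of _ Z] del: of_nat_Suc)
      (simp add: mult_of_nat_commute[symmetric] flip: mult.assoc del: of_nat_Suc)
  also have "\<dots> \<sim> Z * Y * Z ^ Suc n - of_nat (Suc n) * (X * Z * Z ^ n)"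
    by (intro eqv_diff eqv_refl eqv_l eqv_r eqv_sym[OF XZ])
  also have "\<dots> = Y * Z ^ Suc (Suc n) - of_nat (Suc (Suc n)) * (X * Z ^ Suc n)"
    by (simp add: YZ algebra_simps)
  finally show ?case .
qed

text \<open>The coefficient -(p - 1) is 1 in characteristic p.\<close>

lemma Z_power_q_Y: "Z ^ Suc k * Y \<sim> Y * Z ^ Suc k + X * Z ^ k"
proof -
  have "(of_nat (Suc k) :: 'k free_algebra) = - 1"
    using of_nat_p_free unfolding p_eq by (simp add: eq_neg_iff_add_eq_0 add.commute)
  then show ?thesis using Z_power_Y[of k] by (simp del: of_nat_Suc)
qed

section \<open>The element u and the twisted generator\<close>

lemma \<beta>_inverse: "\<beta> * (inverse \<beta> * inverse \<beta>) = inverse \<beta>" "inverse \<beta> * inverse \<beta> * \<beta> = inverse \<beta>"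
  using \<beta>_nonzero by (simp_all add: field_simps)

text \<open>With t = y x^(p-2) the relation reads z^p = (\<beta> - t) x, and \<open>v\<close>
  consists of the first two terms of the series for the inverse of \<beta> - t. The error \<beta>^-2
  t^2 is killed by x, since 2(p - 2) + 1 >= p.\<close>

definition "v = S (inverse \<beta>) + S (inverse \<beta> * inverse \<beta>) * (Y * X ^ k)"

text \<open>\<open>u\<close> represents \<open>x / z\<close>, so that \<open>y\<^sub>1 = z y z\<^sup>-\<^sup>1\<close> is \<open>y - u\<close>.\<close>

definition "u = v * Z ^ Suc k"

lemma uZ: "u * Z \<sim> X"
proof -
  have "u * Z = v * Z ^ p" by (simp add: u_def power_p(1) mult.assoc del: power_Suc)
  also have "\<dots> \<sim> v * (S \<beta> * X - Y * X ^ Suc k)" by (rule eqv_l[OF Z_power_p])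
  also have "\<dots> = X - S (inverse \<beta> * inverse \<beta>) * Y * (X ^ k * Y) * X ^ Suc k"
    using \<beta>_nonzero by (simp add: v_def S_simps S_mult \<beta>_inverse algebra_simps power_commutes)
  also have "\<dots> \<sim> X - S (inverse \<beta> * inverse \<beta>) * Y * (Y * X ^ k) * X ^ Suc k"
    by (intro eqv_diff eqv_refl eqv_lr X_power_central)
  also have "\<dots> = X - S (inverse \<beta> * inverse \<beta>) * Y * Y * X ^ (k + Suc k)"
    by (simp only: power_add mult.assoc)
  also have "\<dots> \<sim> X - S (inverse \<beta> * inverse \<beta>) * Y * Y * 0"
    by (intro eqv_diff eqv_refl eqv_l X_power_0 p_facts)
  finally show ?thesis by simp
qed

lemma vY: "v * Y \<sim> Y * v"
  by (rule eqv_cert[OF X_power_central[of k Y], of _ _ "S (inverse \<beta> * inverse \<beta>) * Y" 1])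
    (simp add: v_def S_simps S_mult algebra_simps)

text \<open>Together with \<open>uu\<close>, which identifies the second summand with u^2, this is
  [u, y] = u^2.\<close>

lemma uY: "u * Y \<sim> Y * u + X * (v * Z ^ k)"
proof -
  have "u * Y = v * (Z ^ Suc k * Y)" by (simp add: u_def mult.assoc)
  also have "\<dots> \<sim> v * (Y * Z ^ Suc k + X * Z ^ k)" by (rule eqv_l[OF Z_power_q_Y])
  also have "\<dots> = v * Y * Z ^ Suc k + v * X * Z ^ k" by (simp add: distrib_left mult.assoc)
  also have "\<dots> \<sim> Y * v * Z ^ Suc k + X * v * Z ^ k"
    by (intro eqv_add eqv_r vY eqv_sym[OF X_central])
  finally show ?thesis by (simp add: u_def mult.assoc)
qed

text \<open>With z invertible, both sides would be x^2 z^-2. Here \<open>uZ\<close> gives u z^(p-1)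
  = x z^(p-2). Expanding the second factor u reduces the claim to this, once the first one has been
  moved past y x^(p-2); the extra term that \<open>uY\<close> produces is the one killed in
  \<open>w0\<close>.\<close>

lemma uu: "u * u \<sim> X * (v * Z ^ k)"
proof -
  have uZq: "u * Z ^ Suc k \<sim> X * Z ^ k"
    using eqv_r[OF uZ, of "Z ^ k"] by (simp add: mult.assoc)
  \<comment> \<open>The powers collect to x^(p-1) and z^(2p-3), and 2p - 3 >= p, so
    \<open>XZp_0\<close> applies.\<close>
  have w0: "X * (v * Z ^ k) * X ^ k * Z ^ Suc k \<sim> 0"
  proof -
    obtain l where l: "k = Suc l" using p_facts(1) by (cases k) auto
    have "X * (v * Z ^ k) * X ^ k * Z ^ Suc k = X * (v * Z ^ k * X ^ k) * Z ^ Suc k" by (simp add: mult.assoc)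
    also have "\<dots> \<sim> X * (X ^ k * (v * Z ^ k)) * Z ^ Suc k"
      by (intro eqv_lr eqv_sym[OF X_power_central])
    also have "\<dots> = X ^ Suc k * (v * (Z ^ k * Z ^ Suc k))" by (simp add: mult.assoc)
    also have "Z ^ k * Z ^ Suc k = Z ^ p * Z ^ l"
      by (simp only: power_add[symmetric] p_eq l) simp
    also have "X ^ Suc k * (v * (Z ^ p * Z ^ l)) = X ^ Suc k * (v * Z ^ p) * Z ^ l" by (simp add: mult.assoc)
    also have "\<dots> \<sim> 0 * Z ^ l" by (rule eqv_r[OF XZp_0])
    finally show ?thesis by simp
  qed
  have "u * Y * X ^ k * Z ^ Suc k \<sim> (Y * u + X * (v * Z ^ k)) * X ^ k * Z ^ Suc k"
    by (intro eqv_r uY)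
  also have "\<dots> = Y * (u * X ^ k) * Z ^ Suc k + X * (v * Z ^ k) * X ^ k * Z ^ Suc k"
    by (simp add: distrib_right mult.assoc)
  also have "\<dots> \<sim> Y * (X ^ k * u) * Z ^ Suc k + 0"
    by (intro eqv_add w0 eqv_lr eqv_sym[OF X_power_central])
  also have "\<dots> = Y * X ^ k * (u * Z ^ Suc k)" by (simp add: mult.assoc)
  also have "\<dots> \<sim> Y * X ^ k * (X * Z ^ k)" by (rule eqv_l[OF uZq])
  finally have uYXZ: "u * Y * X ^ k * Z ^ Suc k \<sim> Y * X ^ k * (X * Z ^ k)" .
  have "u * u = S (inverse \<beta>) * (u * Z ^ Suc k) + S (inverse \<beta> * inverse \<beta>) * (u * Y * X ^ k * Z ^ Suc k)"
    by (subst (2) u_def) (simp add: v_def S_simps S_mult S_move[of u] distrib_left distrib_right mult.assoc)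
  also have "\<dots> \<sim> S (inverse \<beta>) * (X * Z ^ k) + S (inverse \<beta> * inverse \<beta>) * (Y * X ^ k * (X * Z ^ k))"
    by (intro eqv_add eqv_l uZq uYXZ)
  also have "\<dots> = v * X * Z ^ k" by (simp add: v_def distrib_right mult.assoc)
  also have "\<dots> \<sim> X * v * Z ^ k" by (intro eqv_r eqv_sym[OF X_central])
  finally show ?thesis by (simp add: mult.assoc)
qed

definition "Y\<^sub>1 = Y - u"

lemma Y\<^sub>1_Z: "Y\<^sub>1 * Z \<sim> Z * Y"
  using eqv_diff[OF eqv_refl[of "Y * Z"] uZ] by (simp add: Y\<^sub>1_def YZ left_diff_distrib)

text \<open>In the induction step [u, y] = u^2 makes the two terms in u^2 cancel, so the expansion
  stays linear in u. For exponent p the linear term vanishes as well.\<close>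

lemma Y\<^sub>1_power: "Y\<^sub>1 ^ Suc n \<sim> Y ^ Suc n - of_nat (Suc n) * (Y ^ n * u)"
proof (induction n)
  case 0
  show ?case by (simp add: Y\<^sub>1_def)
next
  case (Suc n)
  let ?c = "of_nat (Suc n) :: 'k free_algebra"
  have uY': "u * Y \<sim> Y * u + u * u"
    using eqv_trans[OF uY eqv_add[OF eqv_refl eqv_sym[OF uu]]] .
  have "Y\<^sub>1 ^ Suc (Suc n) = Y\<^sub>1 ^ Suc n * Y\<^sub>1" by (simp only: power_Suc2)
  also have "\<dots> \<sim> (Y ^ Suc n - ?c * (Y ^ n * u)) * (Y - u)"
    using eqv_r[OF Suc] by (simp only: Y\<^sub>1_def)
  also have "\<dots> \<sim> Y ^ Suc (Suc n) - of_nat (Suc (Suc n)) * (Y ^ Suc n * u)"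
  proof (rule eqv_cert[OF uY'])
    have "Y ^ Suc n * Y = Y ^ Suc (Suc n)" "Y ^ n * (Y * r) = Y ^ Suc n * r" for r
      by (simp_all only: power_Suc2 mult.assoc)
    moreover have "of_nat (Suc (Suc n)) = 1 + ?c" by simp
    ultimately show "(Y ^ Suc n - ?c * (Y ^ n * u)) * (Y - u) - (Y ^ Suc (Suc n) - of_nat (Suc (Suc n)) * (Y ^ Suc n * u)) =
        (- ?c * Y ^ n) * (u * Y - (Y * u + u * u)) * 1"
      by (simp add: algebra_simps del: power_Suc of_nat_Suc)
  qed
  finally show ?case .
qed

lemma Y\<^sub>1_power_p: "Y\<^sub>1 ^ p \<sim> 0"
proof -
  have "Y\<^sub>1 ^ p \<sim> Y ^ p - of_nat p * (Y ^ Suc k * u)"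
    using Y\<^sub>1_power[of "Suc k"] unfolding p_eq[symmetric] .
  also have "\<dots> \<sim> 0" using Y_power_p by (simp add: of_nat_p_free)
  finally show ?thesis .
qed

lemma Y\<^sub>1_power_Z: "Y\<^sub>1 ^ n * Z \<sim> Z * Y ^ n"
proof (induction n)
  case (Suc n)
  have "Y\<^sub>1 ^ Suc n * Z = Y\<^sub>1 ^ n * (Y\<^sub>1 * Z)" by (simp only: power_Suc2 mult.assoc)
  also have "\<dots> \<sim> Y\<^sub>1 ^ n * (Z * Y)" by (rule eqv_l[OF Y\<^sub>1_Z])
  also have "\<dots> = Y\<^sub>1 ^ n * Z * Y" by (simp add: mult.assoc)
  also have "\<dots> \<sim> Z * Y ^ n * Y" by (rule eqv_r[OF Suc])
  finally show ?case by (simp only: power_Suc2 mult.assoc)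
qed simp

section \<open>High powers of z\<close>

lemma Z_power_pn: "\<exists>c. Z ^ (p * n) \<sim> X ^ n * c"
proof (induction n)
  case 0
  show ?case by (rule exI[of _ 1]) simp
next
  case (Suc n)
  then obtain c where c: "Z ^ (p * n) \<sim> X ^ n * c" by blast
  let ?v = "S \<beta> - Y * X ^ k"
  have "Z ^ p \<sim> S \<beta> * X - Y * X ^ k * X" using Z_power_p by (simp only: power_Suc2 mult.assoc)
  also have "\<dots> = ?v * X" by (simp add: left_diff_distrib)
  finally have zp: "Z ^ p \<sim> ?v * X" .
  have "Z ^ (p * Suc n) = Z ^ p * Z ^ (p * n)" by (simp only: mult_Suc_right power_add)
  also have "\<dots> \<sim> ?v * X * (X ^ n * c)" by (intro eqv_mult zp c)
  also have "\<dots> = ?v * X ^ Suc n * c" by (simp add: mult.assoc)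
  also have "\<dots> \<sim> X ^ Suc n * ?v * c" by (intro eqv_r eqv_sym[OF X_power_central])
  finally show ?case by (intro exI[of _ "?v * c"]) (simp only: mult.assoc)
qed

definition "N = p * p - 1"

lemma N_eq: "p * p = Suc N" "N = Suc (p * Suc k + k)"
  by (simp_all only: N_def) (simp_all add: p_eq)

lemma Z_power_0: "Suc N \<le> n \<Longrightarrow> Z ^ n \<sim> 0"
proof -
  assume n: "Suc N \<le> n"
  obtain c where "Z ^ (p * p) \<sim> X ^ p * c" using Z_power_pn by blast
  also have "\<dots> \<sim> 0 * c" by (rule eqv_r[OF X_power_p])
  finally have "Z ^ (p * p) * Z ^ (n - Suc N) \<sim> 0 * c * Z ^ (n - Suc N)" by (rule eqv_r)
  also have "Z ^ (p * p) * Z ^ (n - Suc N) = Z ^ n"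
    unfolding power_add[symmetric] N_eq(1) using n by simp
  finally show ?thesis by simp
qed

definition "\<zeta> = Z ^ N"

text \<open>The commutator is a multiple of x z^(N-1). Here z^(N-1) contains z^(p(p-1)), which is a
  multiple of x^(p-1), so a factor x^p appears.\<close>

lemma \<zeta>_Y: "\<zeta> * Y \<sim> Y * \<zeta>"
proof -
  obtain c where c: "Z ^ (p * Suc k) \<sim> X ^ Suc k * c" using Z_power_pn by blast
  have "X * Z ^ (p * Suc k + k) = X * Z ^ (p * Suc k) * Z ^ k" by (simp only: power_add mult.assoc)
  also have "\<dots> \<sim> X * (X ^ Suc k * c) * Z ^ k" by (rule eqv_lr[OF c])
  also have "\<dots> = X ^ p * (c * Z ^ k)" by (simp add: power_p(2) mult.assoc del: power_Suc)
  also have "\<dots> \<sim> 0 * (c * Z ^ k)" by (rule eqv_r[OF X_power_p])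
  finally have "X * Z ^ (p * Suc k + k) \<sim> 0" by simp
  then have "Y * Z ^ N - of_nat N * (X * Z ^ (p * Suc k + k)) \<sim> Y * Z ^ N - of_nat N * 0"
    by (intro eqv_diff eqv_refl eqv_l)
  then show ?thesis using eqv_trans[OF Z_power_Y[of "p * Suc k + k"]] unfolding \<zeta>_def N_eq(2) by simp
qed

text \<open>Move z^N past \<open>v\<close>; then it meets z^(p-1) and the exponent exceeds
  N.\<close>

lemma \<zeta>_u: "\<zeta> * u \<sim> 0"
proof -
  have "\<zeta> * v \<sim> v * \<zeta>"
  proof -
    have "\<zeta> * Y * X ^ k \<sim> Y * \<zeta> * X ^ k" by (rule eqv_r[OF \<zeta>_Y])
    also have "\<dots> = Y * (\<zeta> * X ^ k)" by (simp add: mult.assoc)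
    also have "\<dots> \<sim> Y * (X ^ k * \<zeta>)" by (intro eqv_l eqv_sym[OF X_power_central])
    finally have "S (inverse \<beta> * inverse \<beta>) * (\<zeta> * Y * X ^ k) \<sim> S (inverse \<beta> * inverse \<beta>) * (Y * (X ^ k * \<zeta>))"
      by (rule eqv_l)
    from eqv_add[OF eqv_refl[of "S (inverse \<beta>) * \<zeta>"] this] show ?thesis
      by (simp add: v_def S_simps S_move[of \<zeta>] distrib_left distrib_right mult.assoc)
  qed
  then have "\<zeta> * v * Z ^ Suc k \<sim> v * \<zeta> * Z ^ Suc k" by (rule eqv_r)
  also have "\<dots> = v * Z ^ (N + Suc k)" by (simp only: \<zeta>_def power_add mult.assoc)
  also have "\<dots> \<sim> v * 0" by (intro eqv_l Z_power_0) simp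
  finally show ?thesis by (simp add: u_def mult.assoc)
qed

lemma Y_power_\<zeta>: "Y ^ n * \<zeta> \<sim> \<zeta> * Y ^ n"
proof (induction n)
  case (Suc n)
  have "Y ^ Suc n * \<zeta> = Y ^ n * (Y * \<zeta>)" by (simp only: power_Suc2 mult.assoc)
  also have "\<dots> \<sim> Y ^ n * (\<zeta> * Y)" by (rule eqv_l[OF eqv_sym[OF \<zeta>_Y]])
  also have "\<dots> = Y ^ n * \<zeta> * Y" by (simp add: mult.assoc)
  also have "\<dots> \<sim> \<zeta> * Y ^ n * Y" by (rule eqv_r[OF Suc])
  finally show ?case by (simp only: power_Suc2 mult.assoc)
qed simp

lemma \<zeta>_Y\<^sub>1: "\<zeta> * Y\<^sub>1 \<sim> Y * \<zeta>"
  using eqv_diff[OF \<zeta>_Y \<zeta>_u] by (simp add: Y\<^sub>1_def right_diff_distrib)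

lemma \<zeta>_Y\<^sub>1_power: "\<zeta> * Y\<^sub>1 ^ n \<sim> Y ^ n * \<zeta>"
proof (induction n)
  case (Suc n)
  have "\<zeta> * Y\<^sub>1 ^ Suc n = \<zeta> * Y\<^sub>1 * Y\<^sub>1 ^ n" by (simp add: mult.assoc)
  also have "\<dots> \<sim> Y * \<zeta> * Y\<^sub>1 ^ n" by (rule eqv_r[OF \<zeta>_Y\<^sub>1])
  also have "\<dots> = Y * (\<zeta> * Y\<^sub>1 ^ n)" by (simp add: mult.assoc)
  also have "\<dots> \<sim> Y * (Y ^ n * \<zeta>)" by (rule eqv_l[OF Suc])
  finally show ?case by (simp add: mult.assoc)
qed simp

lemma socle: "\<not> Y ^ Suc k * \<zeta> \<sim> 0"
proof
  assume "Y ^ Suc k * \<zeta> \<sim> 0"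
  then have "\<zeta> * Y ^ Suc k \<sim> 0" using eqv_trans[OF eqv_sym[OF Y_power_\<zeta>]] by blast
  then show False using socle_nonzero by (simp add: eqv_def \<zeta>_def N_def Z_def Y_def p_facts)
qed


section \<open>Polynomials in y as representatives modulo A z\<close>

definition pol :: "(nat \<Rightarrow> 'k) \<Rightarrow> 'k free_algebra" where
  "pol c = (\<Sum>j<p. S (c j) * Y ^ j)"

lemma pol_eq: "pol c = (\<Sum>j<Suc (Suc k). S (c j) * Y ^ j)"
  unfolding pol_def unfolding p_eq ..

lemma S_add: "S (c + c') = S c + S c'"
  by (simp add: S_def single_add)

lemma pol_add: "pol (\<lambda>j. c j + c' j) = pol c + pol c'"
  by (simp add: pol_def S_add distrib_right sum.distrib)

lemma pol_0: "pol (\<lambda>j. 0) = 0"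
  by (simp add: pol_def S_mult)

lemma pol_cong: "(\<And>j. j < p \<Longrightarrow> c j = c' j) \<Longrightarrow> pol c = pol c'"
  by (simp add: pol_def)

lemma pol_Y: "pol c * Y \<sim> pol (\<lambda>j. if j = 0 then 0 else c (j - 1))"
proof -
  have "pol c * Y = (\<Sum>j<Suc (Suc k). S (c j) * Y ^ Suc j)"
    unfolding pol_eq sum_distrib_right by (simp only: mult.assoc power_Suc2)
  also have "\<dots> = (\<Sum>j<Suc k. S (c j) * Y ^ Suc j) + S (c (Suc k)) * Y ^ p"
    unfolding p_eq by (simp only: sum.lessThan_Suc[of _ "Suc k"])
  also have "\<dots> \<sim> (\<Sum>j<Suc k. S (c j) * Y ^ Suc j) + S (c (Suc k)) * 0"
    by (intro eqv_add eqv_refl eqv_l Y_power_p)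
  also have "\<dots> = pol (\<lambda>j. if j = 0 then 0 else c (j - 1))"
    unfolding pol_eq sum.lessThan_Suc_shift[of _ "Suc k"] by (simp add: S_mult)
  finally show ?thesis .
qed

lemma pol_Y_power: "pol c * Y ^ m \<sim> pol (\<lambda>j. if j < m then 0 else c (j - m))"
proof (induction m)
  case (Suc m)
  have "pol c * Y ^ Suc m = pol c * Y ^ m * Y" by (simp only: power_Suc2 mult.assoc)
  also have "\<dots> \<sim> pol (\<lambda>j. if j < m then 0 else c (j - m)) * Y" by (rule eqv_r[OF Suc])
  also have "\<dots> \<sim> pol (\<lambda>j. if j = 0 then 0 else (if j - 1 < m then 0 else c (j - 1 - m)))" by (rule pol_Y)
  also have "\<dots> = pol (\<lambda>j. if j < Suc m then 0 else c (j - Suc m))" by (rule pol_cong) auto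
  finally show ?case .
qed simp

text \<open>Induction on the last letter. Appending y preserves A z because z y equals
  \<open>Y\<^sub>1\<close> times z.\<close>

lemma span: "\<exists>c a. r \<sim> pol c + a * Z"
proof (induction r rule: free_algebra_induct)
  case (scalar c)
  have "pol (\<lambda>j. if j = 0 then c else 0) = S c"
    unfolding pol_eq sum.lessThan_Suc_shift[of _ "Suc k"] by (simp add: S_mult)
  then have "scalar c \<sim> pol (\<lambda>j. if j = 0 then c else 0) + 0 * Z" by (simp add: S_def)
  then show ?case by blast
next
  case (add r s)
  then obtain c a c' a' where "r \<sim> pol c + a * Z" "s \<sim> pol c' + a' * Z" by blast
  from eqv_add[OF this] have "r + s \<sim> pol (\<lambda>j. c j + c' j) + (a + a') * Z"
    by (simp add: pol_add algebra_simps)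
  then show ?case by blast
next
  case (mult_z r)
  have "r * free_z \<sim> pol (\<lambda>j. 0) + r * Z" by (simp add: pol_0 Z_def)
  then show ?case by blast
next
  case (mult_y r)
  then obtain c a where "r \<sim> pol c + a * Z" by blast
  then have "r * Y \<sim> (pol c + a * Z) * Y" by (rule eqv_r)
  also have "\<dots> = pol c * Y + a * (Z * Y)" by (simp add: distrib_right mult.assoc)
  also have "\<dots> \<sim> pol (\<lambda>j. if j = 0 then 0 else c (j - 1)) + a * (Y\<^sub>1 * Z)"
    by (intro eqv_add pol_Y eqv_l eqv_sym[OF Y\<^sub>1_Z])
  finally show ?case unfolding Y_def mult.assoc[symmetric] by blast
qed

text \<open>If the coefficients below \<open>j\<close> vanish, multiplication by y^(p-1-j) moves the
  term of degree \<open>j\<close> to y^(p-1) and all higher terms into the multiples of y^p. What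
  remains is \<open>c j\<close> times the nonzero element of \<open>socle\<close>.\<close>

lemma pol_\<zeta>:
  assumes "pol c * \<zeta> \<sim> 0" "j < p"
  shows "c j = 0"
  using assms(2)
proof (induction j rule: less_induct)
  case (less j)
  define m where "m = Suc k - j"
  have m: "m + j = Suc k" using less.prems by (simp add: m_def p_eq)
  have "pol (\<lambda>i. if i < m then 0 else c (i - m)) = (\<Sum>i<p. if i = Suc k then S (c j) * Y ^ Suc k else 0)"
    unfolding pol_def
  proof (rule sum.cong[OF refl])
    fix i assume "i \<in> {..<p}"
    then have i: "i \<le> Suc k" by (simp add: p_eq)
    show "S (if i < m then 0 else c (i - m)) * Y ^ i = (if i = Suc k then S (c j) * Y ^ Suc k else 0)"
    proof (cases "i = Suc k")
      case True
      moreover from this have "\<not> i < m" "i - m = j" using m by linarith+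
      ultimately show ?thesis by simp
    next
      case False
      have "c (i - m) = 0" if "\<not> i < m"
        using less.IH[of "i - m"] less.prems that False i m by (simp add: less_diff_conv2)
      then show ?thesis using False by (simp add: S_mult)
    qed
  qed
  also have "\<dots> = S (c j) * Y ^ Suc k" by (simp add: p_eq)
  finally have "pol c * Y ^ m \<sim> S (c j) * Y ^ Suc k" using pol_Y_power[of c m] by simp
  then have "S (c j) * Y ^ Suc k * \<zeta> \<sim> pol c * Y ^ m * \<zeta>" by (intro eqv_r) (rule eqv_sym)
  also have "\<dots> = pol c * (Y ^ m * \<zeta>)" by (simp add: mult.assoc)
  also have "\<dots> \<sim> pol c * (\<zeta> * Y ^ m)" by (rule eqv_l[OF Y_power_\<zeta>])
  also have "\<dots> = pol c * \<zeta> * Y ^ m" by (simp add: mult.assoc)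
  also have "\<dots> \<sim> 0 * Y ^ m" by (rule eqv_r[OF assms(1)])
  finally have z: "S (inverse (c j)) * (S (c j) * (Y ^ Suc k * \<zeta>)) \<sim> S (inverse (c j)) * 0"
    by (intro eqv_l) (simp add: mult.assoc)
  show "c j = 0"
  proof (rule ccontr)
    assume "c j \<noteq> 0"
    then have "Y ^ Suc k * \<zeta> \<sim> 0" using z by (simp add: S_mult del: power_Suc)
    then show False using socle by simp
  qed
qed

section \<open>Exactness in both directions\<close>

lemma Z_\<zeta>: "Z * \<zeta> \<sim> 0" "\<zeta> * Z \<sim> 0"
  using Z_power_0[of "Suc N"] by (simp_all add: \<zeta>_def power_commutes)

text \<open>Factors z are split off from the right one at a time. If r = s z^m with m < N, then s
  z^N is a right multiple of r z and vanishes. By \<open>pol_\<zeta>\<close> the polynomial part of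
  s is zero, so s lies in A z.\<close>

lemma Z_exact:
  assumes r: "r * Z \<sim> 0"
  shows "\<exists>s. r \<sim> s * \<zeta>"
proof -
  have "m \<le> N \<Longrightarrow> \<exists>s. r \<sim> s * Z ^ m" for m
  proof (induction m)
    case 0
    have "r \<sim> r * Z ^ 0" by simp
    then show ?case by blast
  next
    case (Suc m)
    then obtain s where s: "r \<sim> s * Z ^ m" by auto
    obtain c a where ca: "s \<sim> pol c + a * Z" using span by blast
    \<comment> \<open>The form \<open>Suc n\<close> leaves at least one factor z to the right of r =
      s z^m, which is what annihilates r.\<close>
    obtain n where n: "N = m + Suc n" using Suc.prems less_imp_Suc_add[of m N] by auto
    have \<zeta>: "\<zeta> = Z ^ m * (Z * Z ^ n)" by (simp only: \<zeta>_def n power_add power_Suc)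
    have "pol c * \<zeta> \<sim> (s - a * Z) * \<zeta>"
      using eqv_r[OF eqv_diff[OF eqv_sym[OF ca] eqv_refl[of "a * Z"]], of \<zeta>] by simp
    also have "\<dots> = s * Z ^ m * (Z * Z ^ n) - a * (Z * \<zeta>)"
      by (simp only: left_diff_distrib mult.assoc \<zeta>)
    also have "\<dots> \<sim> r * (Z * Z ^ n) - a * 0"
      by (intro eqv_diff eqv_r eqv_l eqv_sym[OF s] Z_\<zeta>)
    also have "\<dots> = r * Z * Z ^ n" by (simp add: mult.assoc)
    also have "\<dots> \<sim> 0 * Z ^ n" by (rule eqv_r[OF r])
    finally have "pol c * \<zeta> \<sim> 0" by simp
    then have "pol c = pol (\<lambda>j. 0)" by (intro pol_cong) (rule pol_\<zeta>)
    then have "s \<sim> a * Z" using ca by (simp add: pol_0)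
    from eqv_trans[OF s eqv_r[OF this]] have "r \<sim> a * Z ^ Suc m" by (simp add: mult.assoc)
    then show ?case by blast
  qed
  from this[of N] show ?thesis by (simp add: \<zeta>_def)
qed

text \<open>Right multiplication by z^N kills A z and is injective on polynomials in y, so its
  kernel is A z.\<close>

lemma \<zeta>_exact:
  assumes r: "r * \<zeta> \<sim> 0"
  shows "\<exists>s. r \<sim> s * Z"
proof -
  obtain c a where ca: "r \<sim> pol c + a * Z" using span by blast
  have "pol c * \<zeta> \<sim> (r - a * Z) * \<zeta>"
    using eqv_r[OF eqv_diff[OF eqv_sym[OF ca] eqv_refl[of "a * Z"]], of \<zeta>] by simp
  also have "\<dots> = r * \<zeta> - a * (Z * \<zeta>)" by (simp add: left_diff_distrib mult.assoc)
  also have "\<dots> \<sim> 0 - a * 0" by (intro eqv_diff eqv_l Z_\<zeta> r)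
  finally have "pol c * \<zeta> \<sim> 0" by simp
  then have "pol c = pol (\<lambda>j. 0)" by (intro pol_cong) (rule pol_\<zeta>)
  then show ?thesis using ca by (auto simp: pol_0)
qed

lemma pol_factor:
  assumes "\<And>j. j < n \<Longrightarrow> c j = 0"
  shows "\<exists>s. pol c \<sim> s * Y ^ n"
proof -
  have "pol (\<lambda>j. c (j + n)) * Y ^ n \<sim> pol (\<lambda>j. if j < n then 0 else c (j - n + n))"
    by (rule pol_Y_power)
  also have "\<dots> = pol c" by (rule pol_cong) (simp add: assms)
  finally show ?thesis using eqv_sym by blast
qed

text \<open>Right multiplication by y preserves A z, so r may be replaced by its polynomial part. If
  that times y^m lies in A z, it is killed by z^N, and \<open>pol_\<zeta>\<close> forces its
  coefficients below degree p - m to vanish.\<close>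

lemma Y_power_exact:
  assumes r: "r * Y ^ m \<sim> s * Z"
  shows "\<exists>a a'. r \<sim> a' * Z + a * Y ^ (p - m)"
proof -
  obtain c a where ca: "r \<sim> pol c + a * Z" using span by blast
  let ?c = "\<lambda>j. if j < m then 0 else c (j - m)"
  have "pol ?c \<sim> pol c * Y ^ m" by (rule eqv_sym[OF pol_Y_power])
  also have "\<dots> \<sim> (r - a * Z) * Y ^ m"
    using eqv_r[OF eqv_diff[OF eqv_sym[OF ca] eqv_refl[of "a * Z"]], of "Y ^ m"] by simp
  also have "\<dots> = r * Y ^ m - a * (Z * Y ^ m)" by (simp add: left_diff_distrib mult.assoc)
  also have "\<dots> \<sim> s * Z - a * (Y\<^sub>1 ^ m * Z)"
    by (intro eqv_diff eqv_l r eqv_sym[OF Y\<^sub>1_power_Z])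
  also have "\<dots> = (s - a * Y\<^sub>1 ^ m) * Z" by (simp add: left_diff_distrib mult.assoc)
  finally have "pol ?c * \<zeta> \<sim> (s - a * Y\<^sub>1 ^ m) * Z * \<zeta>" by (rule eqv_r)
  also have "\<dots> = (s - a * Y\<^sub>1 ^ m) * (Z * \<zeta>)" by (simp add: mult.assoc)
  also have "\<dots> \<sim> (s - a * Y\<^sub>1 ^ m) * 0" by (intro eqv_l Z_\<zeta>)
  finally have "pol ?c * \<zeta> \<sim> 0" by simp
  then have c0: "?c j = 0" if "j < p" for j using pol_\<zeta> that by blast
  have "c j = 0" if "j < p - m" for j using c0[of "j + m"] that by simp
  from pol_factor[of "p - m" c, OF this] obtain t where "pol c \<sim> t * Y ^ (p - m)" by blast
  from eqv_trans[OF ca eqv_add[OF this eqv_refl]] show ?thesis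
    unfolding add.commute[of _ "a * Z"] by blast
qed

lemma eqv_lookup_0: "r \<sim> s \<Longrightarrow> Poly_Mapping.lookup r 0 = Poly_Mapping.lookup s 0"
  using A5_ideal_lookup_0[of p "r - s" \<beta>] p_ge_3 by (simp add: eqv_def lookup_minus)

lemma lookup_0_simps:
  "Poly_Mapping.lookup Z 0 = 0" "Poly_Mapping.lookup Y 0 = 0" "Poly_Mapping.lookup X 0 = 0"
  "Poly_Mapping.lookup (S c) 0 = c"
  by (simp_all add: Z_def Y_def S_def X_def lookup_generator_0 lookup_commutator_0)

lemma augmentation_exact:
  assumes "Poly_Mapping.lookup r 0 = 0"
  shows "\<exists>a a'. r \<sim> a' * Z + a * Y"
proof -
  obtain c a where ca: "r \<sim> pol c + a * Z" using span by blast
  have "Poly_Mapping.lookup (pol c) 0 = c 0"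
    unfolding pol_eq sum.lessThan_Suc_shift[of _ "Suc k"]
    by (simp add: lookup_add lookup_mult_0 lookup_0_simps lookup_sum)
  then have "c 0 = 0" using eqv_lookup_0[OF ca] assms by (simp add: lookup_add lookup_mult_0 lookup_0_simps)
  then obtain t where "pol c \<sim> t * Y" using pol_factor[of 1 c] by auto
  from eqv_trans[OF ca eqv_add[OF this eqv_refl]] show ?thesis
    unfolding add.commute[of _ "a * Z"] by blast
qed

section \<open>The double complex over the quotient ring\<close>

abbreviation "cl \<equiv> A5_class p \<beta>"

lemma cl_eq_iff: "cl r = cl s \<longleftrightarrow> r \<sim> s"
proof -
  have cl: "cl r = {h + r | h. h \<in> I}" for r by (auto simp: A5_class_def a_r_coset_def')
  show ?thesis
  proof
    assume "cl r = cl s"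
    moreover have "r \<in> cl r" using I_closed(1) unfolding cl by force
    ultimately show "r \<sim> s" unfolding cl by (auto simp: eqv_def)
  next
    have "cl r \<subseteq> cl s" if "r \<sim> s" for r s
    proof
      fix t assume "t \<in> cl r"
      then obtain h where "h \<in> I" "t = h + r" unfolding cl by blast
      then have "h + (r - s) \<in> I" "t = (h + (r - s)) + s" using that I_closed(2) by (auto simp: eqv_def)
      then show "t \<in> cl s" unfolding cl by blast
    qed
    then show "cl r = cl s" if "r \<sim> s" using that eqv_sym by blast
  qed
qed

lemma A5_ring: "ring (A5 p \<beta>)"
  using trivial_module_left_module[of p \<beta>] p_ge_3 by (simp add: left_module_def)

lemma cl_hom:
  "cl r \<oplus>\<^bsub>A5 p \<beta>\<^esub> cl s = cl (r + s)" "cl r \<otimes>\<^bsub>A5 p \<beta>\<^esub> cl s = cl (r * s)"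
  "\<zero>\<^bsub>A5 p \<beta>\<^esub> = cl 0" "\<ominus>\<^bsub>A5 p \<beta>\<^esub> cl r = cl (- r)" "cl r \<in> carrier (A5 p \<beta>)"
proof -
  interpret I: ideal I "type_ring :: 'k free_algebra ring" by (rule ideal_A5_ideal)
  interpret R: ring "A5 p \<beta>" by (rule A5_ring)
  show add: "cl r \<oplus>\<^bsub>A5 p \<beta>\<^esub> cl s = cl (r + s)" for r s
    using I.a_rcos_sum[of r s] by (simp add: A5_def A5_class_def FactRing_def)
  show "cl r \<otimes>\<^bsub>A5 p \<beta>\<^esub> cl s = cl (r * s)"
    using I.rcoset_mult_add[of r s] by (simp add: A5_def A5_class_def FactRing_def)
  show car: "cl r \<in> carrier (A5 p \<beta>)" for r by (simp add: A5_carrier)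
  have "cl 0 \<oplus>\<^bsub>A5 p \<beta>\<^esub> cl 0 = cl 0" by (simp add: add)
  then show zero: "\<zero>\<^bsub>A5 p \<beta>\<^esub> = cl 0" using car[of 0] by simp
  show "\<ominus>\<^bsub>A5 p \<beta>\<^esub> cl r = cl (- r)"
    by (rule R.minus_equality) (simp_all add: add zero car)
qed

definition "power_y j = (if odd j then 1 else Suc k)" for j :: nat
definition "zz i = cl (if odd i then Z else \<zeta>)" for i :: nat
text \<open>Passing z turns y into \<open>Y\<^sub>1\<close> and passing z^N turns it back, so the
  entry depends only on the parity of the column. The sign makes the squares anticommute.\<close>

definition "ww i j = cl (if even i then Y ^ power_y j else - (Y\<^sub>1 ^ power_y j))" for i j :: nat

lemma power_y_add: "power_y (Suc j) + power_y j = p"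
  by (simp add: power_y_def p_eq)

lemma power_y_Suc: "p - power_y j = power_y (Suc j)"
  by (simp add: power_y_def p_eq)

lemma lookup_\<zeta>: "Poly_Mapping.lookup \<zeta> 0 = 0"
  by (simp add: \<zeta>_def lookup_mult_0 lookup_0_simps N_eq(2))

lemma lookup_Y\<^sub>1: "Poly_Mapping.lookup Y\<^sub>1 0 = 0"
  by (simp add: Y\<^sub>1_def u_def lookup_minus lookup_mult_0 lookup_power_0 lookup_0_simps)

lemma act_cl: "cl r \<odot>\<^bsub>trivial_module\<^esub> x = Poly_Mapping.lookup r 0 * (x :: 'k)"
  by (rule trivial_module_smult) (use p_ge_3 in simp)

lemma A5_twisted_double_complex: "twisted_double_complex (A5 p \<beta>) trivial_module 1 zz ww"
proof (intro twisted_double_complex.intro twisted_double_complex_axioms.intro)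
  note cl = cl_hom cl_eq_iff
  have tm: "carrier trivial_module = (UNIV :: 'k set)" "\<zero>\<^bsub>trivial_module\<^esub> = (0 :: 'k)"
    by (simp_all add: trivial_module_def)
  have power_y_pos: "power_y j > 0" for j by (simp add: power_y_def)
  show "left_module (A5 p \<beta>) trivial_module" using trivial_module_left_module[of p \<beta>] p_ge_3 by simp
  show "(1 :: 'k) \<in> carrier trivial_module" by (simp add: tm)
  show "\<exists>a\<in>carrier (A5 p \<beta>). x = a \<odot>\<^bsub>trivial_module\<^esub> 1" for x :: 'k
    by (rule bexI[of _ "cl (S x)"]) (simp_all add: act_cl lookup_0_simps cl_hom)
  show "zz i \<in> carrier (A5 p \<beta>)" "ww i j \<in> carrier (A5 p \<beta>)" for i j by (simp_all add: zz_def ww_def cl_hom)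
  show "zz (Suc (Suc i)) \<otimes>\<^bsub>A5 p \<beta>\<^esub> zz (Suc i) = \<zero>\<^bsub>A5 p \<beta>\<^esub>" for i
    by (simp add: zz_def cl Z_\<zeta>)
  show "ww i (Suc (Suc j)) \<otimes>\<^bsub>A5 p \<beta>\<^esub> ww i (Suc j) = \<zero>\<^bsub>A5 p \<beta>\<^esub>" for i j
    using Y_power_p Y\<^sub>1_power_p by (simp add: ww_def cl power_y_add flip: power_add)
  show "ww (Suc i) (Suc j) \<otimes>\<^bsub>A5 p \<beta>\<^esub> zz (Suc i) = \<ominus>\<^bsub>A5 p \<beta>\<^esub> (zz (Suc i) \<otimes>\<^bsub>A5 p \<beta>\<^esub> ww i (Suc j))" for i j
  proof (cases "even i")
    case True
    then show ?thesis
      using eqv_diff[OF eqv_refl[of 0] Y\<^sub>1_power_Z[of "power_y (Suc j)"]] by (simp add: zz_def ww_def cl)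
  next
    case False
    then show ?thesis
      using eqv_sym[OF \<zeta>_Y\<^sub>1_power[of "power_y (Suc j)"]] by (simp add: zz_def ww_def cl)
  qed
  show "zz (Suc i) \<odot>\<^bsub>trivial_module\<^esub> (1 :: 'k) = \<zero>\<^bsub>trivial_module\<^esub>" for i
    by (simp add: zz_def act_cl lookup_0_simps lookup_\<zeta> tm)
  show "ww i (Suc j) \<odot>\<^bsub>trivial_module\<^esub> (1 :: 'k) = \<zero>\<^bsub>trivial_module\<^esub>" for i j
    using power_y_pos[of "Suc j"] by (simp add: ww_def act_cl lookup_0_simps lookup_Y\<^sub>1 lookup_power_0 tm zero_power)
  show "zz (Suc (Suc (Suc i))) = zz (Suc i)" "ww (Suc (Suc i)) (Suc j) = ww i (Suc j)"
    "ww i (Suc (Suc (Suc j))) = ww i (Suc j)" for i j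
    by (simp_all add: zz_def ww_def power_y_def)
next
  fix a i assume "a \<in> carrier (A5 p \<beta>)" and az: "a \<otimes>\<^bsub>A5 p \<beta>\<^esub> zz (Suc i) = \<zero>\<^bsub>A5 p \<beta>\<^esub>"
  then obtain r where r: "a = cl r" by (auto simp: A5_carrier)
  have "\<exists>s. a = cl s \<otimes>\<^bsub>A5 p \<beta>\<^esub> zz (Suc (Suc i))"
    using az Z_exact[of r] \<zeta>_exact[of r] by (cases "even i") (auto simp: r zz_def cl_hom cl_eq_iff)
  then show "\<exists>b\<in>carrier (A5 p \<beta>). a = b \<otimes>\<^bsub>A5 p \<beta>\<^esub> zz (Suc (Suc i))" using cl_hom(5) by blast
next
  fix a b j assume "a \<in> carrier (A5 p \<beta>)" "b \<in> carrier (A5 p \<beta>)"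
    and ab: "a \<otimes>\<^bsub>A5 p \<beta>\<^esub> ww 0 (Suc j) = b \<otimes>\<^bsub>A5 p \<beta>\<^esub> zz (Suc 0)"
  then obtain r s where r: "a = cl r" and s: "b = cl s" by (auto simp: A5_carrier)
  have "r * Y ^ power_y (Suc j) \<sim> s * Z" using ab by (simp add: r s ww_def zz_def cl_hom cl_eq_iff)
  from Y_power_exact[OF this] obtain t t' where "r \<sim> t' * Z + t * Y ^ power_y (Suc (Suc j))"
    unfolding power_y_Suc by blast
  then have "a = cl t' \<otimes>\<^bsub>A5 p \<beta>\<^esub> zz (Suc 0) \<oplus>\<^bsub>A5 p \<beta>\<^esub> cl t \<otimes>\<^bsub>A5 p \<beta>\<^esub> ww 0 (Suc (Suc j))"
    by (simp add: r ww_def zz_def cl_hom cl_eq_iff)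
  then show "\<exists>c\<in>carrier (A5 p \<beta>). \<exists>c'\<in>carrier (A5 p \<beta>).
      a = c' \<otimes>\<^bsub>A5 p \<beta>\<^esub> zz (Suc 0) \<oplus>\<^bsub>A5 p \<beta>\<^esub> c \<otimes>\<^bsub>A5 p \<beta>\<^esub> ww 0 (Suc (Suc j))"
    using cl_hom(5) by blast
next
  fix a assume "a \<in> carrier (A5 p \<beta>)" and am: "a \<odot>\<^bsub>trivial_module\<^esub> (1 :: 'k) = \<zero>\<^bsub>trivial_module\<^esub>"
  then obtain r where r: "a = cl r" by (auto simp: A5_carrier)
  have "Poly_Mapping.lookup r 0 = 0" using am by (simp add: r act_cl) (simp add: trivial_module_def)
  from augmentation_exact[OF this] obtain t t' where "r \<sim> t' * Z + t * Y" by blast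
  then have "a = cl t' \<otimes>\<^bsub>A5 p \<beta>\<^esub> zz (Suc 0) \<oplus>\<^bsub>A5 p \<beta>\<^esub> cl t \<otimes>\<^bsub>A5 p \<beta>\<^esub> ww 0 (Suc 0)"
    by (simp add: r ww_def zz_def power_y_def cl_hom cl_eq_iff)
  then show "\<exists>c\<in>carrier (A5 p \<beta>). \<exists>c'\<in>carrier (A5 p \<beta>).
      a = c' \<otimes>\<^bsub>A5 p \<beta>\<^esub> zz (Suc 0) \<oplus>\<^bsub>A5 p \<beta>\<^esub> c \<otimes>\<^bsub>A5 p \<beta>\<^esub> ww 0 (Suc 0)"
    using cl_hom(5) by blast
qed

end

theorem mainTheorem2:
  fixes p :: nat and \<beta> :: "'k::field"
    and P :: "nat \<Rightarrow> ('k free_algebra set, 'm) module"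
    and d :: "nat \<Rightarrow> 'm \<Rightarrow> 'm" and e :: "'m \<Rightarrow> 'k"
  assumes "prime p" and "p \<ge> 3" and "CHAR('k) = p" and "\<beta> \<noteq> 0"
    and "projective_resolution (A5 p \<beta>) trivial_module P d e"
  shows "finitely_generated_algebra
    (ext_algebra (\<lambda>c. A5_class p \<beta> (scalar c)) (A5 p \<beta>) trivial_module P d e)"
proof -
  interpret a5_calculus p \<beta> "p - 2"
    using assms(1-4) by unfold_locales auto
  have "twisted_ext (A5 p \<beta>) trivial_module P d e (\<lambda>c. cl (scalar c)) 1 zz ww"
  proof (intro twisted_ext.intro ext_algebra_setting.intro ext_setting.intro
      ext_algebra_setting_axioms.intro twisted_ext_axioms.intro)
    show "left_module (A5 p \<beta>) (trivial_module :: ('k free_algebra set, 'k) module)"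
      using trivial_module_left_module[of p \<beta>] p_ge_3 by simp
    show "projective_resolution (A5 p \<beta>) trivial_module P d e" by fact
    show "twisted_double_complex (A5 p \<beta>) trivial_module 1 zz ww" by (rule A5_twisted_double_complex)
    show "cl (scalar c) \<in> carrier (A5 p \<beta>)" for c by (rule cl_hom)
    show "\<exists>c. x = cl (scalar c) \<odot>\<^bsub>trivial_module\<^esub> 1" for x :: 'k
      by (rule exI[of _ x]) (simp add: act_cl)
    fix a and x c :: 'k
    assume "a \<in> carrier (A5 p \<beta>)"
    then obtain r where "a = cl r" by (auto simp: A5_carrier)
    then show "cl (scalar c) \<odot>\<^bsub>trivial_module\<^esub> (a \<odot>\<^bsub>trivial_module\<^esub> x) =
        a \<odot>\<^bsub>trivial_module\<^esub> (cl (scalar c) \<odot>\<^bsub>trivial_module\<^esub> x)"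
      by (simp add: act_cl mult.left_commute)
  qed
  then show ?thesis by (rule twisted_ext.finitely_generated_ext)
qed

end
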